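(* Let $F:(M^m,g)\to(B^n,g')$ be a surjective Clairaut conformal submersion between Riemannian manifolds, with connected fibers, dilation $\lambda$ and $r=e^f$, where $f:M\to\mathbb{R}$ is smooth. Let $\psi$ be the function on $B$ such that $\psi(F(x))=\frac{1}{\lambda(x)}$ for all $x\in M$. Then $F:(M,g)\to(B,\psi^2 g')$ is a Clairaut Riemannian submersion with $r=e^f$.
   Context: All manifolds, maps and functions are smooth; $\dim M=m$, $\dim B=n$. For a submersion $F:(M,g)\to(B,g')$, the vertical distribution is $\ker F_\ast$ and the horizontal distribution is its $g$-orthogonal complement. $F$ is a conformal submersion with dilation $\lambda:M\to\mathbb{R}^+$ if $g'(F_\ast X,F_\ast Y)=\lambda^2 g(X,Y)$ for all horizontal $X,Y$; it is a Riemannian submersion if $\lambda\equiv 1$. A conformal (resp. Riemannian) submersion $F$ is a Clairaut conformal (resp. Clairaut Riemannian) submersion with function $r:M\to\mathbb{R}^+$ if for every geodesic $\alpha$ on $(M,g)$ the function $t\mapsto r(\alpha(t))\sin\omega(t)$ is constant, where $\omega(t)\in[0,\pi/2]$ is the angle between $\dot\alpha(t)$ and the horizontal space at $\alpha(t)$. *)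

theory Defs
  imports "HOL-Analysis.Analysis"
begin

text \<open>
  A manifold of dimension \<open>DIM('e)\<close> is a Hausdorff second countable type \<open>'a\<close> with a smooth
  atlas \<open>A\<close>, whose charts are pairs \<open>(U, \<phi>)\<close>; values of \<open>\<phi>\<close> off \<open>U\<close> are irrelevant.  The class
  \<open>euclidean_space\<close> makes every dimension positive.
\<close>

type_synonym ('a, 'e) chart = "'a set \<times> ('a \<Rightarrow> 'e)"

text \<open>The two predicates below are only used for open \<open>S\<close>.\<close>

primrec differentiable_upto ::
    "nat \<Rightarrow> 'e::real_normed_vector set \<Rightarrow> ('e \<Rightarrow> 'f::real_normed_vector) \<Rightarrow> bool" where
  "differentiable_upto 0 S h \<longleftrightarrow> continuous_on S h"
| "differentiable_upto (Suc k) S h \<longleftrightarrow>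
     (\<forall>x\<in>S. h differentiable (at x)) \<and>
     (\<forall>v. differentiable_upto k S (\<lambda>x. frechet_derivative h (at x) v))"

definition smooth_on :: "'e::real_normed_vector set \<Rightarrow> ('e \<Rightarrow> 'f::real_normed_vector) \<Rightarrow> bool" where
  "smooth_on S h \<longleftrightarrow> (\<forall>k. differentiable_upto k S h)"

definition chart_inv :: "('a, 'e) chart \<Rightarrow> 'e \<Rightarrow> 'a" where
  "chart_inv c = inv_into (fst c) (snd c)"

definition smooth_atlas ::
    "('a::{t2_space,second_countable_topology}, 'e::euclidean_space) chart set \<Rightarrow> bool" where
  "smooth_atlas A \<longleftrightarrow>
     (\<forall>c\<in>A. open (fst c) \<and> open (snd c ` fst c) \<and>
        homeomorphism (fst c) (snd c ` fst c) (snd c) (chart_inv c)) \<and>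
     (\<Union>c\<in>A. fst c) = UNIV \<and>
     (\<forall>c\<in>A. \<forall>d\<in>A. smooth_on (snd c ` (fst c \<inter> fst d)) (snd d \<circ> chart_inv c))"

definition charts_at :: "('a, 'e) chart set \<Rightarrow> 'a \<Rightarrow> ('a, 'e) chart set" where
  "charts_at A p = {c \<in> A. p \<in> fst c}"

definition smooth_fun :: "('a, 'e::euclidean_space) chart set \<Rightarrow> ('a \<Rightarrow> real) \<Rightarrow> bool" where
  "smooth_fun A h \<longleftrightarrow> (\<forall>c\<in>A. smooth_on (snd c ` fst c) (h \<circ> chart_inv c))"

definition smooth_map ::
    "('a::topological_space, 'e::euclidean_space) chart set \<Rightarrow>
     ('b::topological_space, 'f::euclidean_space) chart set \<Rightarrow> ('a \<Rightarrow> 'b) \<Rightarrow> bool" where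
  "smooth_map A B F \<longleftrightarrow> continuous_on UNIV F \<and>
     (\<forall>c\<in>A. \<forall>d\<in>B. smooth_on (snd c ` (fst c \<inter> F -` fst d)) (snd d \<circ> F \<circ> chart_inv c))"

definition smooth_curve ::
    "('a::topological_space, 'e::euclidean_space) chart set \<Rightarrow> real set \<Rightarrow> (real \<Rightarrow> 'a) \<Rightarrow> bool" where
  "smooth_curve A I \<alpha> \<longleftrightarrow> continuous_on I \<alpha> \<and>
     (\<forall>c\<in>A. smooth_on (I \<inter> \<alpha> -` fst c) (snd c \<circ> \<alpha>))"

text \<open>
  A tangent vector at \<open>p\<close> is the family of its coordinate representations in the charts around \<open>p\<close>,
  related by the derivatives of the transition maps.  It is set to \<open>0\<close> on all other charts, so that
  equality of tangent vectors is equality of functions.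
\<close>

type_synonym ('a, 'e) tvec = "('a, 'e) chart \<Rightarrow> 'e"

definition tangent_space :: "('a, 'e::euclidean_space) chart set \<Rightarrow> 'a \<Rightarrow> ('a, 'e) tvec set" where
  "tangent_space A p = {v.
     (\<forall>c\<in>charts_at A p. \<forall>d\<in>charts_at A p.
        v d = frechet_derivative (snd d \<circ> chart_inv c) (at (snd c p)) (v c)) \<and>
     (\<forall>c. c \<notin> charts_at A p \<longrightarrow> v c = 0)}"

text \<open>The tangent vector at \<open>p\<close> whose representation in the chart \<open>c\<close> is \<open>u\<close>.\<close>

definition coord_vec ::
    "('a, 'e::euclidean_space) chart set \<Rightarrow> 'a \<Rightarrow> ('a, 'e) chart \<Rightarrow> 'e \<Rightarrow> ('a, 'e) tvec" where
  "coord_vec A p c u = (\<lambda>d. if d \<in> charts_at A p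
     then frechet_derivative (snd d \<circ> chart_inv c) (at (snd c p)) u else 0)"

text \<open>By the chain rule the value does not depend on the choice of the chart around \<open>p\<close>.\<close>

definition differential ::
    "('a, 'e::euclidean_space) chart set \<Rightarrow> ('b, 'f::euclidean_space) chart set \<Rightarrow> ('a \<Rightarrow> 'b) \<Rightarrow>
     'a \<Rightarrow> ('a, 'e) tvec \<Rightarrow> ('b, 'f) tvec" where
  "differential A B F p v = (\<lambda>d. if d \<in> charts_at B (F p)
     then (let c = (SOME c. c \<in> charts_at A p)
           in frechet_derivative (snd d \<circ> F \<circ> chart_inv c) (at (snd c p)) (v c))
     else 0)"

definition velocity ::
    "('a, 'e::euclidean_space) chart set \<Rightarrow> (real \<Rightarrow> 'a) \<Rightarrow> real \<Rightarrow> ('a, 'e) tvec" where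
  "velocity A \<alpha> t = (\<lambda>c. if c \<in> charts_at A (\<alpha> t)
     then vector_derivative (snd c \<circ> \<alpha>) (at t) else 0)"

text \<open>Only the values of \<open>g p\<close> on \<open>tangent_space A p\<close> matter.\<close>

type_synonym ('a, 'e) metric = "'a \<Rightarrow> ('a, 'e) tvec \<Rightarrow> ('a, 'e) tvec \<Rightarrow> real"

definition metric_coord ::
    "('a, 'e::euclidean_space) chart set \<Rightarrow> ('a, 'e) metric \<Rightarrow> ('a, 'e) chart \<Rightarrow>
     'e \<Rightarrow> 'e \<Rightarrow> 'e \<Rightarrow> real" where
  "metric_coord A g c x u w =
     (let p = chart_inv c x in g p (coord_vec A p c u) (coord_vec A p c w))"

definition riemannian_metric ::
    "('a, 'e::euclidean_space) chart set \<Rightarrow> ('a, 'e) metric \<Rightarrow> bool" where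
  "riemannian_metric A g \<longleftrightarrow>
     (\<forall>p. \<forall>u\<in>tangent_space A p. \<forall>v\<in>tangent_space A p. g p u v = g p v u) \<and>
     (\<forall>p. \<forall>u\<in>tangent_space A p. \<forall>v\<in>tangent_space A p. \<forall>w\<in>tangent_space A p. \<forall>a b.
        g p (\<lambda>c. a *\<^sub>R u c + b *\<^sub>R v c) w = a * g p u w + b * g p v w) \<and>
     (\<forall>p. \<forall>u\<in>tangent_space A p. u \<noteq> (\<lambda>c. 0) \<longrightarrow> 0 < g p u u) \<and>
     (\<forall>c\<in>A. \<forall>u w. smooth_on (snd c ` fst c) (\<lambda>x. metric_coord A g c x u w))"

definition riemannian_manifold ::
    "('a::{t2_space,second_countable_topology}, 'e::euclidean_space) chart set \<Rightarrow>
     ('a, 'e) metric \<Rightarrow> bool" where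
  "riemannian_manifold A g \<longleftrightarrow> smooth_atlas A \<and> riemannian_metric A g"

text \<open>
  \<open>christoffel A g c x u v\<close> is the vector with \<open>k\<close>-th component \<open>\<Gamma>\<^sup>k\<^sub>i\<^sub>j u\<^sup>i v\<^sup>j\<close>, where \<open>\<Gamma>\<close> are the Christoffel
  symbols of the Levi-Civita connection in the chart \<open>c\<close> at the coordinate point \<open>x\<close>, that is
  \<open>g\<^sub>k\<^sub>l \<Gamma>\<^sup>k\<^sub>i\<^sub>j = (\<partial>\<^sub>i g\<^sub>j\<^sub>l + \<partial>\<^sub>j g\<^sub>i\<^sub>l - \<partial>\<^sub>l g\<^sub>i\<^sub>j) / 2\<close>.
\<close>

definition christoffel ::
    "('a, 'e::euclidean_space) chart set \<Rightarrow> ('a, 'e) metric \<Rightarrow> ('a, 'e) chart \<Rightarrow>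
     'e \<Rightarrow> 'e \<Rightarrow> 'e \<Rightarrow> 'e" where
  "christoffel A g c x u v = (THE z. \<forall>w. metric_coord A g c x z w =
     (frechet_derivative (\<lambda>y. metric_coord A g c y v w) (at x) u
      + frechet_derivative (\<lambda>y. metric_coord A g c y u w) (at x) v
      - frechet_derivative (\<lambda>y. metric_coord A g c y u v) (at x) w) / 2)"

definition geodesic ::
    "('a::topological_space, 'e::euclidean_space) chart set \<Rightarrow> ('a, 'e) metric \<Rightarrow>
     real set \<Rightarrow> (real \<Rightarrow> 'a) \<Rightarrow> bool" where
  "geodesic A g I \<alpha> \<longleftrightarrow> open I \<and> is_interval I \<and> smooth_curve A I \<alpha> \<and>
     (\<forall>t\<in>I. \<forall>c\<in>charts_at A (\<alpha> t).
        vector_derivative (\<lambda>s. vector_derivative (snd c \<circ> \<alpha>) (at s)) (at t)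
        + christoffel A g c (snd c (\<alpha> t))
            (vector_derivative (snd c \<circ> \<alpha>) (at t)) (vector_derivative (snd c \<circ> \<alpha>) (at t)) = 0)"

definition submersion ::
    "('a::topological_space, 'e::euclidean_space) chart set \<Rightarrow>
     ('b::topological_space, 'f::euclidean_space) chart set \<Rightarrow> ('a \<Rightarrow> 'b) \<Rightarrow> bool" where
  "submersion A B F \<longleftrightarrow> smooth_map A B F \<and>
     (\<forall>p. differential A B F p ` tangent_space A p = tangent_space B (F p))"

definition vertical_space ::
    "('a, 'e::euclidean_space) chart set \<Rightarrow> ('b, 'f::euclidean_space) chart set \<Rightarrow> ('a \<Rightarrow> 'b) \<Rightarrow>
     'a \<Rightarrow> ('a, 'e) tvec set" where
  "vertical_space A B F p = {v \<in> tangent_space A p. differential A B F p v = (\<lambda>d. 0)}"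

definition horizontal_space ::
    "('a, 'e::euclidean_space) chart set \<Rightarrow> ('a, 'e) metric \<Rightarrow>
     ('b, 'f::euclidean_space) chart set \<Rightarrow> ('a \<Rightarrow> 'b) \<Rightarrow> 'a \<Rightarrow> ('a, 'e) tvec set" where
  "horizontal_space A g B F p =
     {v \<in> tangent_space A p. \<forall>w\<in>vertical_space A B F p. g p v w = 0}"

definition conformal_submersion ::
    "('a::{t2_space,second_countable_topology}, 'e::euclidean_space) chart set \<Rightarrow>
     ('a, 'e) metric \<Rightarrow>
     ('b::{t2_space,second_countable_topology}, 'f::euclidean_space) chart set \<Rightarrow>
     ('b, 'f) metric \<Rightarrow> ('a \<Rightarrow> 'b) \<Rightarrow> ('a \<Rightarrow> real) \<Rightarrow> bool" where
  "conformal_submersion A g B g' F lam \<longleftrightarrow>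
     riemannian_manifold A g \<and> riemannian_manifold B g' \<and> submersion A B F \<and>
     smooth_fun A lam \<and> (\<forall>p. 0 < lam p) \<and>
     (\<forall>p. \<forall>u\<in>horizontal_space A g B F p. \<forall>v\<in>horizontal_space A g B F p.
        g' (F p) (differential A B F p u) (differential A B F p v) = (lam p)\<^sup>2 * g p u v)"

definition riemannian_submersion ::
    "('a::{t2_space,second_countable_topology}, 'e::euclidean_space) chart set \<Rightarrow>
     ('a, 'e) metric \<Rightarrow>
     ('b::{t2_space,second_countable_topology}, 'f::euclidean_space) chart set \<Rightarrow>
     ('b, 'f) metric \<Rightarrow> ('a \<Rightarrow> 'b) \<Rightarrow> bool" where
  "riemannian_submersion A g B g' F \<longleftrightarrow> conformal_submersion A g B g' F (\<lambda>_. 1)"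

definition horizontal_part ::
    "('a, 'e::euclidean_space) chart set \<Rightarrow> ('a, 'e) metric \<Rightarrow>
     ('b, 'f::euclidean_space) chart set \<Rightarrow> ('a \<Rightarrow> 'b) \<Rightarrow> 'a \<Rightarrow> ('a, 'e) tvec \<Rightarrow> ('a, 'e) tvec" where
  "horizontal_part A g B F p v =
     (THE h. h \<in> horizontal_space A g B F p \<and> (\<lambda>c. v c - h c) \<in> vertical_space A B F p)"

text \<open>The angle, in \<open>[0, \<pi>/2]\<close>, between a nonzero tangent vector and its orthogonal projection
  to the horizontal space; it is \<open>\<pi>/2\<close> for vertical vectors.\<close>

definition horizontal_angle ::
    "('a, 'e::euclidean_space) chart set \<Rightarrow> ('a, 'e) metric \<Rightarrow>
     ('b, 'f::euclidean_space) chart set \<Rightarrow> ('a \<Rightarrow> 'b) \<Rightarrow> 'a \<Rightarrow> ('a, 'e) tvec \<Rightarrow> real" where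
  "horizontal_angle A g B F p v =
     (let h = horizontal_part A g B F p v in arccos (sqrt (g p h h) / sqrt (g p v v)))"

text \<open>Constant geodesics, for which the angle is meaningless, satisfy the last clause trivially.\<close>

definition clairaut ::
    "('a::topological_space, 'e::euclidean_space) chart set \<Rightarrow> ('a, 'e) metric \<Rightarrow>
     ('b, 'f::euclidean_space) chart set \<Rightarrow> ('a \<Rightarrow> 'b) \<Rightarrow> ('a \<Rightarrow> real) \<Rightarrow> bool" where
  "clairaut A g B F r \<longleftrightarrow> smooth_fun A r \<and> (\<forall>p. 0 < r p) \<and>
     (\<forall>I \<alpha>. geodesic A g I \<alpha> \<longrightarrow>
        (\<lambda>t. r (\<alpha> t) * sin (horizontal_angle A g B F (\<alpha> t) (velocity A \<alpha> t))) constant_on I)"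

definition clairaut_conformal_submersion ::
    "('a::{t2_space,second_countable_topology}, 'e::euclidean_space) chart set \<Rightarrow>
     ('a, 'e) metric \<Rightarrow>
     ('b::{t2_space,second_countable_topology}, 'f::euclidean_space) chart set \<Rightarrow>
     ('b, 'f) metric \<Rightarrow> ('a \<Rightarrow> 'b) \<Rightarrow> ('a \<Rightarrow> real) \<Rightarrow> ('a \<Rightarrow> real) \<Rightarrow> bool" where
  "clairaut_conformal_submersion A g B g' F lam r \<longleftrightarrow>
     conformal_submersion A g B g' F lam \<and> clairaut A g B F r"

definition clairaut_riemannian_submersion ::
    "('a::{t2_space,second_countable_topology}, 'e::euclidean_space) chart set \<Rightarrow>
     ('a, 'e) metric \<Rightarrow>
     ('b::{t2_space,second_countable_topology}, 'f::euclidean_space) chart set \<Rightarrow>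
     ('b, 'f) metric \<Rightarrow> ('a \<Rightarrow> 'b) \<Rightarrow> ('a \<Rightarrow> real) \<Rightarrow> bool" where
  "clairaut_riemannian_submersion A g B g' F r \<longleftrightarrow>
     riemannian_submersion A g B g' F \<and> clairaut A g B F r"

end

theory Submission
  imports Defs
begin

text \<open>
  Write \<open>G = F\<^sup>*g'\<close> and \<open>\<mu> = 1 / \<lambda>\<^sup>2\<close>.  The form \<open>Q = g - \<mu> G\<close> is nonnegative, vanishes on horizontal vectors,
  and \<open>g(v, v) sin\<^sup>2 \<omega> = Q(v, v)\<close>.  Hence \<open>r\<^sup>2 Q(v, v)\<close> is a constant multiple of \<open>g(v, v)\<close> along
  every geodesic, and its derivative at a point is a cubic polynomial in the initial velocity that
  vanishes identically.  For the velocity \<open>s X + V\<close>, with \<open>X\<close> horizontal and \<open>V\<close> vertical, the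
  coefficient of \<open>s\<^sup>2\<close> is, up to a nonzero factor, \<open>d\<mu>(V) G(X, X)\<close>; the derivatives of \<open>Q(X, X)\<close> drop out since
  a constant horizontal \<open>X\<close> minimises the nonnegative function \<open>x \<mapsto> Q\<^sub>x(X, X)\<close> at the base point.
  Therefore \<open>\<lambda>\<close> is locally constant, hence constant, on the connected fibres.  So \<open>1 / \<lambda>\<close> descends to \<open>\<psi>\<close>, which
  is smooth because \<open>F\<close> has smooth local sections, and multiplying \<open>g'\<close> by \<open>\<psi>\<^sup>2\<close> cancels the dilation.
\<close>

section \<open>Smooth maps between Euclidean spaces\<close>

text \<open>\<open>clairaut\<close> does not mention the metric of the base, so it survives the
  change of \<open>g'\<close> verbatim; all the content lies in the constancy of the dilation along
  fibres. The relation is squared because the sine of the angle need not be differentiable at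
  horizontal velocities, whereas \<open>Q\<close> is smooth in position and quadratic in velocity.
  Vectors are kept constant in a chart, so \<open>X\<close> is horizontal and \<open>V\<close>
  vertical at the base point only. The acceleration \<open>a\<close> enters through
  \<open>Q(V, a) = g(V, a)\<close>, which the geodesic equation turns into first derivatives of
  \<open>g\<close>; these combine with those inside \<open>Q\<close>. What is left besides the
  wanted term are derivatives of \<open>G\<close>, and they cancel: \<open>dF V = 0\<close> and the
  symmetry of the second derivative of \<open>F\<close> give
  \<open>dG_V(X, X) = 2 dG_X(X, V)\<close>. Every velocity \<open>s X + V\<close> has to be the
  initial velocity of a geodesic, hence the existence theorem for smooth differential equations.
  Since \<open>geodesic\<close> asks for its equation in every chart, the transformation law of the
  equation is needed as well.\<close>

lemma differentiable_upto_cong: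
  assumes "open S" "\<And>x. x \<in> S \<Longrightarrow> f x = g x" "differentiable_upto k S f"
  shows "differentiable_upto k S g"
  using assms(2,3)
proof (induction k arbitrary: f g)
  case 0
  then show ?case by (simp cong: continuous_on_cong)
next
  case (Suc k)
  have hd: "(g has_derivative frechet_derivative f (at x)) (at x)" if "x \<in> S" for x
  proof -
    have "(f has_derivative frechet_derivative f (at x)) (at x)"
      using Suc.prems(2) that frechet_derivative_works by auto
    then show ?thesis
      by (rule has_derivative_transform_within_open[OF _ assms(1) that]) (use Suc.prems in auto)
  qed
  have "frechet_derivative f (at x) v = frechet_derivative g (at x) v" if "x \<in> S" for x v
    using frechet_derivative_at[OF hd[OF that]] by simp
  moreover have "differentiable_upto k S (\<lambda>x. frechet_derivative f (at x) v)" for v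
    using Suc.prems(2) by simp
  ultimately have "differentiable_upto k S (\<lambda>x. frechet_derivative g (at x) v)" for v
    using Suc.IH[of "\<lambda>x. frechet_derivative f (at x) v" "\<lambda>x. frechet_derivative g (at x) v"] by simp
  then show ?case
    using hd by (auto simp: differentiable_def)
qed

text \<open>The induction step of the closure properties below: a derivative computed by hand
  replaces the opaque choice \<open>frechet_derivative\<close>.\<close>

lemma differentiable_upto_SucI:
  assumes "open S" "\<And>x. x \<in> S \<Longrightarrow> (h has_derivative h' x) (at x)"
    "\<And>v. differentiable_upto k S (\<lambda>x. h' x v)"
  shows "differentiable_upto (Suc k) S h"
proof -
  have "h' x v = frechet_derivative h (at x) v" if "x \<in> S" for x v
    using frechet_derivative_at[OF assms(2)[OF that]] by simp
  then have "differentiable_upto k S (\<lambda>x. frechet_derivative h (at x) v)" for v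
    using differentiable_upto_cong[OF assms(1) _ assms(3), of v "\<lambda>x. frechet_derivative h (at x) v"] by simp
  then show ?thesis
    using assms(2) by (auto simp: differentiable_def)
qed

lemma differentiable_upto_has_derivative:
  assumes "differentiable_upto (Suc k) S h" "x \<in> S"
  shows "(h has_derivative frechet_derivative h (at x)) (at x)"
  using assms frechet_derivative_works by auto

lemma differentiable_upto_frechet:
  "differentiable_upto (Suc k) S h \<Longrightarrow> differentiable_upto k S (\<lambda>x. frechet_derivative h (at x) v)"
  by simp

lemma differentiable_upto_subset:
  "S \<subseteq> T \<Longrightarrow> differentiable_upto k T h \<Longrightarrow> differentiable_upto k S h"
  by (induction k arbitrary: h) (auto intro: continuous_on_subset)

lemma differentiable_upto_Suc:
  "differentiable_upto (Suc k) S h \<Longrightarrow> differentiable_upto k S h"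
proof (induction k arbitrary: h)
  case 0
  then show ?case
    by (auto intro!: continuous_at_imp_continuous_on differentiable_imp_continuous_within)
next
  case (Suc k)
  have "differentiable_upto k S (\<lambda>x. frechet_derivative h (at x) v)" for v
    by (rule Suc.IH) (use Suc.prems in simp)
  then show ?case using Suc.prems by auto
qed

lemma differentiable_upto_local:
  assumes "\<And>x. x \<in> S \<Longrightarrow> \<exists>T. open T \<and> x \<in> T \<and> differentiable_upto k T h"
  shows "differentiable_upto k S h"
  using assms
proof (induction k arbitrary: h)
  case 0
  show ?case
    unfolding differentiable_upto.simps
  proof (rule continuous_at_imp_continuous_on, rule ballI)
    fix x assume "x \<in> S"
    then show "isCont h x"
      using 0[of x] by (auto simp: continuous_on_eq_continuous_at)
  qed
next
  case (Suc k)
  have "differentiable_upto k S (\<lambda>x. frechet_derivative h (at x) v)" for v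
    using Suc.prems by (intro Suc.IH) (metis differentiable_upto.simps(2))
  moreover have "h differentiable at x" if "x \<in> S" for x
    using Suc.prems[OF that] by auto
  ultimately show ?case by auto
qed

lemma differentiable_upto_const: "differentiable_upto k S (\<lambda>x. c)"
  by (induction k arbitrary: c) auto

lemma differentiable_upto_bounded_linear:
  assumes "open S" "bounded_linear L" "differentiable_upto k S f"
  shows "differentiable_upto k S (\<lambda>x. L (f x))"
  using assms(3)
proof (induction k arbitrary: f)
  case 0
  then show ?case
    using assms(2) linear_continuous_on_compose bounded_linear.continuous_on by auto
next
  case (Suc k)
  show ?case
  proof (rule differentiable_upto_SucI[OF assms(1)])
    fix x assume "x \<in> S"
    then show "((\<lambda>x. L (f x)) has_derivative (\<lambda>v. L (frechet_derivative f (at x) v))) (at x)"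
      by (rule bounded_linear.has_derivative[OF assms(2) differentiable_upto_has_derivative[OF Suc.prems]])
  next
    fix v
    show "differentiable_upto k S (\<lambda>x. L (frechet_derivative f (at x) v))"
      by (rule Suc.IH) (use Suc.prems in simp)
  qed
qed

lemma differentiable_upto_ident: "open S \<Longrightarrow> differentiable_upto k S (\<lambda>x. x)"
  by (cases k) (auto intro: continuous_on_id differentiable_upto_const)

lemma differentiable_upto_add:
  assumes "open S" "differentiable_upto k S f" "differentiable_upto k S g"
  shows "differentiable_upto k S (\<lambda>x. f x + g x)"
  using assms(2,3)
proof (induction k arbitrary: f g)
  case 0
  then show ?case by (auto intro: continuous_on_add)
next
  case (Suc k)
  show ?case
  proof (rule differentiable_upto_SucI[OF assms(1)])
    fix x assume "x \<in> S"
    then show "((\<lambda>x. f x + g x) has_derivative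
       (\<lambda>v. frechet_derivative f (at x) v + frechet_derivative g (at x) v)) (at x)"
      by (intro has_derivative_add differentiable_upto_has_derivative[OF Suc.prems(1)]
          differentiable_upto_has_derivative[OF Suc.prems(2)])
  next
    fix v
    show "differentiable_upto k S (\<lambda>x. frechet_derivative f (at x) v + frechet_derivative g (at x) v)"
      by (rule Suc.IH) (use Suc.prems in simp_all)
  qed
qed

lemma differentiable_upto_sum:
  assumes "open S" "\<And>i. i \<in> I \<Longrightarrow> differentiable_upto k S (f i)"
  shows "differentiable_upto k S (\<lambda>x. \<Sum>i\<in>I. f i x)"
  using assms(2)
  by (induction I rule: infinite_finite_induct)
    (auto intro: differentiable_upto_const differentiable_upto_add[OF assms(1)])

lemma (in bounded_bilinear) differentiable_upto:
  assumes "open S" "differentiable_upto k S f" "differentiable_upto k S g"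
  shows "differentiable_upto k S (\<lambda>x. prod (f x) (g x))"
  using assms(2,3)
proof (induction k arbitrary: f g)
  case 0
  then show ?case by (auto intro: continuous_on)
next
  case (Suc k)
  show ?case
  proof (rule differentiable_upto_SucI[OF assms(1)])
    fix x assume "x \<in> S"
    then show "((\<lambda>x. prod (f x) (g x)) has_derivative (\<lambda>v. prod (f x) (frechet_derivative g (at x) v)
       + prod (frechet_derivative f (at x) v) (g x))) (at x)"
      by (intro FDERIV differentiable_upto_has_derivative[OF Suc.prems(1)]
          differentiable_upto_has_derivative[OF Suc.prems(2)])
  next
    fix v
    have "differentiable_upto k S f" "differentiable_upto k S g"
      using Suc.prems differentiable_upto_Suc by blast+
    then show "differentiable_upto k S (\<lambda>x. prod (f x) (frechet_derivative g (at x) v)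
       + prod (frechet_derivative f (at x) v) (g x))"
      by (intro differentiable_upto_add[OF assms(1)] Suc.IH) (use Suc.prems in simp_all)
  qed
qed

lemma frechet_derivative_basis:
  fixes f :: "'e::euclidean_space \<Rightarrow> 'f::real_normed_vector"
  assumes "f differentiable (at x)"
  shows "frechet_derivative f (at x) v = (\<Sum>i\<in>Basis. (v \<bullet> i) *\<^sub>R frechet_derivative f (at x) i)"
proof -
  have "linear (frechet_derivative f (at x))" using assms by (rule linear_frechet_derivative)
  then have "frechet_derivative f (at x) (\<Sum>i\<in>Basis. (v \<bullet> i) *\<^sub>R i) =
    (\<Sum>i\<in>Basis. (v \<bullet> i) *\<^sub>R frechet_derivative f (at x) i)"
    by (simp add: linear_sum linear_scale)
  then show ?thesis by (simp add: euclidean_representation)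
qed

text \<open>The chain rule evaluates the derivative of \<open>g\<close> at a moving point in a
  moving direction, while \<open>differentiable_upto\<close> speaks of fixed directions only.
  Expanding the direction in a basis gives a sum of products, to which the induction hypothesis
  applies because \<open>g\<close> is arbitrary in it.\<close>

lemma differentiable_upto_compose:
  fixes f :: "'d::real_normed_vector \<Rightarrow> 'e::euclidean_space" and g :: "'e \<Rightarrow> 'f::real_normed_vector"
  assumes "open S" "open T" "f ` S \<subseteq> T" "differentiable_upto k T g" "differentiable_upto k S f"
  shows "differentiable_upto k S (\<lambda>x. g (f x))"
  using assms(4,5)
proof (induction k arbitrary: g)
  case 0
  then show ?case using assms(3) continuous_on_compose2 by auto
next
  case (Suc k)
  have d: "g differentiable at (f x)" if "x \<in> S" for x
    using that Suc.prems assms(3) by auto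
  show ?case
  proof (rule differentiable_upto_SucI[OF assms(1)])
    fix x assume x: "x \<in> S"
    then have "((\<lambda>x. g (f x)) has_derivative (\<lambda>v. frechet_derivative g (at (f x)) (frechet_derivative f (at x) v))) (at x)"
      by (intro has_derivative_compose[OF differentiable_upto_has_derivative[OF Suc.prems(2)]
            differentiable_upto_has_derivative[OF Suc.prems(1)]])
       (use assms(3) in auto)
    then show "((\<lambda>x. g (f x)) has_derivative (\<lambda>v. \<Sum>i\<in>Basis. (frechet_derivative f (at x) v \<bullet> i) *\<^sub>R
        frechet_derivative g (at (f x)) i)) (at x)"
      by (subst frechet_derivative_basis[OF d[OF x], symmetric])
  next
    fix v
    have "differentiable_upto k S f" using Suc.prems differentiable_upto_Suc by blast
    then show "differentiable_upto k S (\<lambda>x. \<Sum>i\<in>Basis. (frechet_derivative f (at x) v \<bullet> i) *\<^sub>R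
        frechet_derivative g (at (f x)) i)"
      by (intro differentiable_upto_sum[OF assms(1)]
          bounded_bilinear.differentiable_upto[OF bounded_bilinear_scaleR assms(1)]
          differentiable_upto_bounded_linear[OF assms(1) bounded_linear_inner_left]
          Suc.IH)
        (use Suc.prems in simp_all)
  qed
qed

text \<open>The derivative is a product of the inverse itself, twice, and the derivative of
  \<open>f\<close>; this lets the order grow by one in each induction step.\<close>

lemma differentiable_upto_inverse:
  fixes f :: "'e::real_normed_vector \<Rightarrow> real"
  assumes "open S" "\<And>x. x \<in> S \<Longrightarrow> f x \<noteq> 0" "differentiable_upto k S f"
  shows "differentiable_upto k S (\<lambda>x. inverse (f x))"
  using assms(3)
proof (induction k)
  case 0
  then show ?case using assms(2) by (auto intro: continuous_on_inverse)
next
  case (Suc k)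
  have k: "differentiable_upto k S f" using Suc.prems differentiable_upto_Suc by blast
  show ?case
  proof (rule differentiable_upto_SucI[OF assms(1)])
    fix x assume x: "x \<in> S"
    show "((\<lambda>x. inverse (f x)) has_derivative
        (\<lambda>v. (- 1) *\<^sub>R (inverse (f x) * frechet_derivative f (at x) v * inverse (f x)))) (at x)"
      using Deriv.has_derivative_inverse[OF assms(2)[OF x] differentiable_upto_has_derivative[OF Suc.prems x]]
      by simp
  next
    fix v
    show "differentiable_upto k S (\<lambda>x. (- 1) *\<^sub>R (inverse (f x) * frechet_derivative f (at x) v * inverse (f x)))"
      by (intro differentiable_upto_bounded_linear[OF assms(1) bounded_linear_scaleR_right]
          bounded_bilinear.differentiable_upto[OF bounded_bilinear_mult assms(1)] Suc.IH k)
        (use Suc.prems in simp)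
  qed
qed

lemma differentiable_upto_Pair:
  assumes "open S" "differentiable_upto k S f" "differentiable_upto k S g"
  shows "differentiable_upto k S (\<lambda>x. (f x, g x))"
proof -
  have "differentiable_upto k S (\<lambda>x. (f x, 0) + (0, g x))"
    by (rule differentiable_upto_add[OF assms(1)
          differentiable_upto_bounded_linear[OF assms(1) _ assms(2), of "\<lambda>x. (x, 0)"]
          differentiable_upto_bounded_linear[OF assms(1) _ assms(3), of "\<lambda>x. (0, x)"]])
      (intro bounded_linear_Pair bounded_linear_ident bounded_linear_zero)+
  then show ?thesis by simp
qed

section \<open>Closure properties of smooth maps\<close>

lemma smooth_on_cong: "open S \<Longrightarrow> (\<And>x. x \<in> S \<Longrightarrow> f x = g x) \<Longrightarrow> smooth_on S f \<Longrightarrow> smooth_on S g"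
  unfolding smooth_on_def by (intro allI, rule differentiable_upto_cong[of S f g]) auto

lemma smooth_on_subset: "S \<subseteq> T \<Longrightarrow> smooth_on T h \<Longrightarrow> smooth_on S h"
  unfolding smooth_on_def by (intro allI, rule differentiable_upto_subset) auto

lemma smooth_on_local:
  "(\<And>x. x \<in> S \<Longrightarrow> \<exists>T. open T \<and> x \<in> T \<and> smooth_on T h) \<Longrightarrow> smooth_on S h"
  unfolding smooth_on_def by (intro allI differentiable_upto_local) blast

lemma smooth_on_frechet:
  "smooth_on S h \<Longrightarrow> smooth_on S (\<lambda>x. frechet_derivative h (at x) v)"
  unfolding smooth_on_def by (intro allI differentiable_upto_frechet, drule spec)

lemma smooth_on_differentiable: "smooth_on S h \<Longrightarrow> x \<in> S \<Longrightarrow> h differentiable (at x)"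
  by (auto simp: smooth_on_def dest!: spec[of _ "Suc 0"])

lemma smooth_on_has_derivative:
  "smooth_on S h \<Longrightarrow> x \<in> S \<Longrightarrow> (h has_derivative frechet_derivative h (at x)) (at x)"
  using smooth_on_differentiable frechet_derivative_works by blast

lemma smooth_on_continuous: "smooth_on S h \<Longrightarrow> continuous_on S h"
  by (auto simp: smooth_on_def dest!: spec[of _ 0])

lemma smooth_on_const: "smooth_on S (\<lambda>x. c)"
  by (simp add: smooth_on_def differentiable_upto_const)

lemma smooth_on_ident: "open S \<Longrightarrow> smooth_on S (\<lambda>x. x)"
  by (simp add: smooth_on_def differentiable_upto_ident)

lemma smooth_on_bounded_linear:
  "open S \<Longrightarrow> bounded_linear L \<Longrightarrow> smooth_on S f \<Longrightarrow> smooth_on S (\<lambda>x. L (f x))"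
  by (simp add: smooth_on_def differentiable_upto_bounded_linear)

lemma smooth_on_add:
  "open S \<Longrightarrow> smooth_on S f \<Longrightarrow> smooth_on S g \<Longrightarrow> smooth_on S (\<lambda>x. f x + g x)"
  by (simp add: smooth_on_def differentiable_upto_add)

lemma smooth_on_sum:
  "open S \<Longrightarrow> (\<And>i. i \<in> I \<Longrightarrow> smooth_on S (f i)) \<Longrightarrow> smooth_on S (\<lambda>x. \<Sum>i\<in>I. f i x)"
  by (simp add: smooth_on_def differentiable_upto_sum)

lemma smooth_on_scaleR:
  "open S \<Longrightarrow> smooth_on S f \<Longrightarrow> smooth_on S g \<Longrightarrow> smooth_on S (\<lambda>x. f x *\<^sub>R g x)"
  by (simp add: smooth_on_def bounded_bilinear.differentiable_upto[OF bounded_bilinear_scaleR])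

lemma smooth_on_mult:
  fixes f g :: "_ \<Rightarrow> real"
  shows "open S \<Longrightarrow> smooth_on S f \<Longrightarrow> smooth_on S g \<Longrightarrow> smooth_on S (\<lambda>x. f x * g x)"
  by (simp add: smooth_on_def bounded_bilinear.differentiable_upto[OF bounded_bilinear_mult])

lemma smooth_on_inner:
  "open S \<Longrightarrow> smooth_on S f \<Longrightarrow> smooth_on S g \<Longrightarrow> smooth_on S (\<lambda>x. f x \<bullet> g x)"
  by (simp add: smooth_on_def bounded_bilinear.differentiable_upto[OF bounded_bilinear_inner])

lemma smooth_on_minus: "open S \<Longrightarrow> smooth_on S f \<Longrightarrow> smooth_on S (\<lambda>x. - f x)"
  using smooth_on_bounded_linear[OF _ bounded_linear_minus[OF bounded_linear_ident]] by blast

lemma smooth_on_diff: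
  "open S \<Longrightarrow> smooth_on S f \<Longrightarrow> smooth_on S g \<Longrightarrow> smooth_on S (\<lambda>x. f x - g x)"
  using smooth_on_add[of S f "\<lambda>x. - g x"] smooth_on_minus[of S g] by simp

lemma smooth_on_inverse:
  fixes f :: "_ \<Rightarrow> real"
  shows "open S \<Longrightarrow> (\<And>x. x \<in> S \<Longrightarrow> f x \<noteq> 0) \<Longrightarrow> smooth_on S f \<Longrightarrow> smooth_on S (\<lambda>x. inverse (f x))"
  by (simp add: smooth_on_def differentiable_upto_inverse)

lemma smooth_on_Pair:
  "open S \<Longrightarrow> smooth_on S f \<Longrightarrow> smooth_on S g \<Longrightarrow> smooth_on S (\<lambda>x. (f x, g x))"
  by (simp add: smooth_on_def differentiable_upto_Pair)

lemma smooth_on_compose: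
  fixes f :: "'d::real_normed_vector \<Rightarrow> 'e::euclidean_space" and g :: "'e \<Rightarrow> 'f::real_normed_vector"
  shows "open S \<Longrightarrow> open T \<Longrightarrow> f ` S \<subseteq> T \<Longrightarrow> smooth_on T g \<Longrightarrow> smooth_on S f \<Longrightarrow>
    smooth_on S (\<lambda>x. g (f x))"
  unfolding smooth_on_def by (intro allI, rule differentiable_upto_compose[of S T f _ g]) auto

section \<open>Symmetry of second derivatives\<close>

text \<open>Mixed second differences: both iterated derivatives are values of the same difference
  quotient, by applying the mean value theorem twice.\<close>

lemma second_difference_mvt:
  fixes h :: "'e::real_normed_vector \<Rightarrow> real"
  assumes "ball x r \<subseteq> S" "0 < e" "e * (norm u + norm v) < r"
    and 1: "\<And>y. y \<in> S \<Longrightarrow> h differentiable (at y)"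
    and 2: "\<And>y. y \<in> S \<Longrightarrow> (\<lambda>y. frechet_derivative h (at y) u) differentiable (at y)"
  obtains y where "dist x y < r" "dist x y \<le> e * (norm u + norm v)"
    "h (x + e *\<^sub>R u + e *\<^sub>R v) - h (x + e *\<^sub>R u) - h (x + e *\<^sub>R v) + h x =
      e * e * frechet_derivative (\<lambda>y. frechet_derivative h (at y) u) (at y) v"
proof -
  have near: "dist x (x + a *\<^sub>R u + b *\<^sub>R v) \<le> e * (norm u + norm v)" if "0 \<le> a" "a \<le> e" "0 \<le> b" "b \<le> e" for a b
  proof -
    have "norm (a *\<^sub>R u + b *\<^sub>R v) \<le> a * norm u + b * norm v"
      using norm_triangle_ineq[of "a *\<^sub>R u" "b *\<^sub>R v"] that by simp
    also have "\<dots> \<le> e * norm u + e * norm v"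
      using that by (intro add_mono mult_right_mono) auto
    finally show ?thesis by (simp add: dist_norm algebra_simps norm_minus_commute)
  qed
  have inS: "x + a *\<^sub>R u + b *\<^sub>R v \<in> S" if "0 \<le> a" "a \<le> e" "0 \<le> b" "b \<le> e" for a b
    using near[OF that] assms(1,3) by (auto simp: subset_eq)
  define k where "k = (\<lambda>a. h (x + a *\<^sub>R u + e *\<^sub>R v) - h (x + a *\<^sub>R u))"
  let ?Du = "\<lambda>y. frechet_derivative h (at y) u"
  let ?Dvu = "\<lambda>y. frechet_derivative ?Du (at y) v"
  have lin: "linear (frechet_derivative h (at y))" if "y \<in> S" for y
    using 1[OF that] by (rule linear_frechet_derivative)
  have lin2: "linear (frechet_derivative ?Du (at y))" if "y \<in> S" for y
    using 2[OF that] by (rule linear_frechet_derivative)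
  have line: "((\<lambda>a. h (x + a *\<^sub>R u + b *\<^sub>R v)) has_derivative (\<lambda>d. d * ?Du (x + a *\<^sub>R u + b *\<^sub>R v))) (at a)"
    if "0 \<le> a" "a \<le> e" "0 \<le> b" "b \<le> e" for a b
  proof -
    have "((\<lambda>a. x + a *\<^sub>R u + b *\<^sub>R v) has_derivative (\<lambda>d. d *\<^sub>R u)) (at a)"
      by (auto intro!: derivative_eq_intros)
    from has_derivative_compose[OF this iffD1[OF frechet_derivative_works 1[OF inS[OF that]]]]
    show ?thesis by (simp add: linear_scale[OF lin[OF inS[OF that]]])
  qed
  have "\<exists>z>0. z < e \<and> k e - k 0 = (e - 0) * (?Du (x + z *\<^sub>R u + e *\<^sub>R v) - ?Du (x + z *\<^sub>R u))"
  proof (rule MVT2[OF assms(2)])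
    fix a assume a: "0 \<le> a" "a \<le> e"
    have "(k has_derivative (\<lambda>d. d * ?Du (x + a *\<^sub>R u + e *\<^sub>R v) - d * ?Du (x + a *\<^sub>R u))) (at a)"
      unfolding k_def using line[of a e] line[of a 0] a assms(2) by (intro has_derivative_diff) auto
    then show "(k has_real_derivative ?Du (x + a *\<^sub>R u + e *\<^sub>R v) - ?Du (x + a *\<^sub>R u)) (at a)"
      unfolding has_field_derivative_def by (rule has_derivative_eq_rhs) (simp add: fun_eq_iff algebra_simps)
  qed
  then obtain z where z: "0 < z" "z < e"
    "k e - k 0 = e * (?Du (x + z *\<^sub>R u + e *\<^sub>R v) - ?Du (x + z *\<^sub>R u))" by auto
  have "\<exists>w>0. w < e \<and> ?Du (x + z *\<^sub>R u + e *\<^sub>R v) - ?Du (x + z *\<^sub>R u + 0 *\<^sub>R v) =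
     (e - 0) * ?Dvu (x + z *\<^sub>R u + w *\<^sub>R v)"
  proof (rule MVT2[OF assms(2)])
    fix b assume b: "0 \<le> b" "b \<le> e"
    have S: "x + z *\<^sub>R u + b *\<^sub>R v \<in> S" using inS z b by auto
    have "((\<lambda>b. x + z *\<^sub>R u + b *\<^sub>R v) has_derivative (\<lambda>d. d *\<^sub>R v)) (at b)"
      by (auto intro!: derivative_eq_intros)
    from has_derivative_compose[OF this iffD1[OF frechet_derivative_works 2[OF S]]]
    show "((\<lambda>b. ?Du (x + z *\<^sub>R u + b *\<^sub>R v)) has_real_derivative ?Dvu (x + z *\<^sub>R u + b *\<^sub>R v)) (at b)"
      by (simp add: linear_scale[OF lin2[OF S]] has_field_derivative_def mult_commute_abs)
  qed
  then obtain w where w: "0 < w" "w < e"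
    "?Du (x + z *\<^sub>R u + e *\<^sub>R v) - ?Du (x + z *\<^sub>R u) = e * ?Dvu (x + z *\<^sub>R u + w *\<^sub>R v)" by auto
  show thesis
  proof
    show "dist x (x + z *\<^sub>R u + w *\<^sub>R v) \<le> e * (norm u + norm v)"
      using near[of z w] z w by auto
    then show "dist x (x + z *\<^sub>R u + w *\<^sub>R v) < r" using assms(3) by simp
    show "h (x + e *\<^sub>R u + e *\<^sub>R v) - h (x + e *\<^sub>R u) - h (x + e *\<^sub>R v) + h x =
      e * e * ?Dvu (x + z *\<^sub>R u + w *\<^sub>R v)"
      using z(3) w(3) by (simp add: k_def)
  qed
qed

text \<open>Up to the factor \<open>e * e\<close>, both iterated derivatives take the value of one
  and the same second difference, at two points near \<open>x\<close>. Continuity then forces them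
  to agree at \<open>x\<close>.\<close>

lemma symmetric_second_frechet_real:
  fixes h :: "'e::real_normed_vector \<Rightarrow> real"
  assumes "open S" "smooth_on S h" "x \<in> S"
  shows "frechet_derivative (\<lambda>y. frechet_derivative h (at y) u) (at x) v =
         frechet_derivative (\<lambda>y. frechet_derivative h (at y) v) (at x) u"
    (is "?A x = ?B x")
proof (rule ccontr)
  assume ne: "?A x \<noteq> ?B x"
  \<comment> \<open>Half of the gap: numbers within \<open>d\<close> of the two distinct values
    cannot coincide.\<close>
  define d where "d = \<bar>?A x - ?B x\<bar> / 2"
  have d: "d > 0" using ne by (simp add: d_def)
  have cont: "isCont ?A x" "isCont ?B x"
    using assms smooth_on_continuous[OF smooth_on_frechet[OF smooth_on_frechet[OF assms(2)]]]
    by (auto simp: continuous_on_eq_continuous_at)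
  obtain r1 where r1: "r1 > 0" "\<And>y. dist x y < r1 \<Longrightarrow> \<bar>?A y - ?A x\<bar> < d"
    using cont(1) d unfolding continuous_at_eps_delta dist_real_def by (metis dist_commute dist_norm real_norm_def)
  obtain r2 where r2: "r2 > 0" "\<And>y. dist x y < r2 \<Longrightarrow> \<bar>?B y - ?B x\<bar> < d"
    using cont(2) d unfolding continuous_at_eps_delta dist_real_def by (metis dist_commute dist_norm real_norm_def)
  obtain r3 where r3: "r3 > 0" "ball x r3 \<subseteq> S" using assms open_contains_ball by blast
  define r where "r = min r1 (min r2 r3)"
  have r: "r > 0" "ball x r \<subseteq> S" using r1 r2 r3 by (auto simp: r_def)
  \<comment> \<open>The added 1 avoids a zero denominator when \<open>u\<close> and \<open>v\<close>
    both vanish. The parallelogram with sides \<open>e *\<^sub>R u\<close> and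
    \<open>e *\<^sub>R v\<close> stays in the ball of radius \<open>r\<close>.\<close>
  define e where "e = r / (2 * (norm u + norm v + 1))"
  have pos: "norm u + norm v + 1 > 0" by (simp add: add_nonneg_pos)
  have e0: "e > 0" using r pos by (simp add: e_def)
  have "e * (norm u + norm v) \<le> e * (norm u + norm v + 1)" using e0 by simp
  also have "\<dots> = r / 2" using pos by (simp add: e_def field_simps)
  also have "\<dots> < r" using r by simp
  finally have e: "e * (norm u + norm v) < r" .
  note D = smooth_on_differentiable[OF assms(2)] smooth_on_differentiable[OF smooth_on_frechet[OF assms(2)]]
  obtain y where y: "dist x y < r"
    "h (x + e *\<^sub>R u + e *\<^sub>R v) - h (x + e *\<^sub>R u) - h (x + e *\<^sub>R v) + h x = e * e * ?A y"
    using second_difference_mvt[OF r(2) e0 e D] by metis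
  have e': "e * (norm v + norm u) < r" using e by (simp add: add.commute)
  obtain y' where y': "dist x y' < r"
    "h (x + e *\<^sub>R v + e *\<^sub>R u) - h (x + e *\<^sub>R v) - h (x + e *\<^sub>R u) + h x = e * e * ?B y'"
    using second_difference_mvt[OF r(2) e0 e' D] by metis
  have eq: "x + e *\<^sub>R v + e *\<^sub>R u = x + e *\<^sub>R u + e *\<^sub>R v" by (simp add: algebra_simps)
  have "e * e * ?A y = e * e * ?B y'" using y(2) y'(2) unfolding eq by linarith
  then have "?A y = ?B y'" using e0 by simp
  moreover have "\<bar>?A y - ?A x\<bar> < d" "\<bar>?B y' - ?B x\<bar> < d"
    using r1 r2 y(1) y'(1) by (auto simp: r_def)
  ultimately have "\<bar>?A x - ?B x\<bar> < d + d" by linarith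
  then show False by (simp add: d_def)
qed

lemma frechet_derivative_bounded_linear:
  assumes "bounded_linear L" "f differentiable (at x)"
  shows "frechet_derivative (\<lambda>x. L (f x)) (at x) v = L (frechet_derivative f (at x) v)"
  using frechet_derivative_at[OF bounded_linear.has_derivative[OF assms(1) iffD1[OF frechet_derivative_works assms(2)]]]
  by (metis)

lemma symmetric_second_frechet:
  fixes h :: "'e::real_normed_vector \<Rightarrow> 'f::euclidean_space"
  assumes "open S" "smooth_on S h" "x \<in> S"
  shows "frechet_derivative (\<lambda>y. frechet_derivative h (at y) u) (at x) v =
         frechet_derivative (\<lambda>y. frechet_derivative h (at y) v) (at x) u"
proof (rule euclidean_eqI)
  fix i :: 'f assume "i \<in> Basis"
  note bl = bounded_linear_inner_left[of i]
  have *: "frechet_derivative (\<lambda>y. frechet_derivative h (at y) u) (at x) v \<bullet> i =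
     frechet_derivative (\<lambda>y. frechet_derivative (\<lambda>z. h z \<bullet> i) (at y) u) (at x) v" for u v
  proof -
    have "frechet_derivative (\<lambda>y. frechet_derivative h (at y) u) (at x) v \<bullet> i =
       frechet_derivative (\<lambda>y. frechet_derivative h (at y) u \<bullet> i) (at x) v"
      using smooth_on_differentiable[OF smooth_on_frechet[OF assms(2)] assms(3)]
      by (rule frechet_derivative_bounded_linear[OF bl, symmetric])
    also have "frechet_derivative (\<lambda>y. frechet_derivative h (at y) u \<bullet> i) (at x) =
       frechet_derivative (\<lambda>y. frechet_derivative (\<lambda>z. h z \<bullet> i) (at y) u) (at x)"
    proof (rule frechet_derivative_transform_within_open[OF _ assms(1,3)])
      show "(\<lambda>y. frechet_derivative h (at y) u \<bullet> i) differentiable at x"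
        using smooth_on_differentiable[OF smooth_on_bounded_linear[OF assms(1) bl smooth_on_frechet[OF assms(2)]] assms(3)] .
    qed (use frechet_derivative_bounded_linear[OF bl smooth_on_differentiable[OF assms(2)]] in auto)
    finally show ?thesis .
  qed
  show "frechet_derivative (\<lambda>y. frechet_derivative h (at y) u) (at x) v \<bullet> i =
         frechet_derivative (\<lambda>y. frechet_derivative h (at y) v) (at x) u \<bullet> i"
    unfolding * by (rule symmetric_second_frechet_real[OF assms(1) _ assms(3)])
      (rule smooth_on_bounded_linear[OF assms(1) bl assms(2)])
qed

section \<open>Families of linear and bilinear maps\<close>

text \<open>A product rule in which the second factor is merely continuous: it holds because the
  first factor vanishes at the point. It makes inverses of linear maps differentiable once they are
  known to be continuous.\<close>

lemma has_derivative_scaleR_zero: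
  fixes f :: "'d::real_normed_vector \<Rightarrow> real" and g :: "'d \<Rightarrow> 'f::real_normed_vector"
  assumes "(f has_derivative f') (at x)" "f x = 0" "isCont g x"
  shows "((\<lambda>y. f y *\<^sub>R g y) has_derivative (\<lambda>h. f' h *\<^sub>R g x)) (at x)"
proof -
  have bl: "bounded_linear f'" using assms(1) by (rule has_derivative_bounded_linear)
  then obtain K where K: "\<And>h. norm (f' h) \<le> norm h * K" using bounded_linear.bounded by blast
  let ?q = "\<lambda>h. norm (f (x + h) - f x - f' h) / norm h"
  have q: "?q \<midarrow>0\<rightarrow> 0" using assms(1) by (simp add: has_derivative_at)
  have g: "(\<lambda>h. norm (g (x + h) - g x)) \<midarrow>0\<rightarrow> 0"
    using assms(3) by (intro tendsto_norm_zero) (simp add: isCont_iff LIM_zero_iff)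
  have "((\<lambda>y. f y *\<^sub>R (g y - g x)) has_derivative (\<lambda>h. 0)) (at x)"
    unfolding has_derivative_at
  proof (intro conjI)
    show "(\<lambda>h. norm (f (x + h) *\<^sub>R (g (x + h) - g x) - f x *\<^sub>R (g x - g x) - 0) / norm h) \<midarrow>0\<rightarrow> 0"
    proof (rule Lim_null_comparison)
      show "(\<lambda>h. (?q h + K) * norm (g (x + h) - g x)) \<midarrow>0\<rightarrow> 0"
        using tendsto_mult[OF tendsto_add[OF q tendsto_const[of K]] g] by simp
      have "norm (f (x + h)) / norm h \<le> ?q h + K" if "h \<noteq> 0" for h
      proof -
        have "norm (f (x + h)) \<le> norm (f (x + h) - f x - f' h) + norm h * K"
          using norm_triangle_ineq[of "f (x + h) - f x - f' h" "f' h"] K[of h] assms(2) by simp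
        then show ?thesis using that by (simp add: field_simps)
      qed
      then have "norm (norm (f (x + h) *\<^sub>R (g (x + h) - g x) - f x *\<^sub>R (g x - g x) - 0) / norm h)
          \<le> (?q h + K) * norm (g (x + h) - g x)" if "h \<noteq> 0" for h
        using mult_right_mono[OF _ norm_ge_zero[of "g (x + h) - g x"], of "norm (f (x + h)) / norm h" "?q h + K"] that
        by simp
      then show "\<forall>\<^sub>F h in at 0. norm (norm (f (x + h) *\<^sub>R (g (x + h) - g x) - f x *\<^sub>R (g x - g x) - 0) / norm h)
          \<le> (?q h + K) * norm (g (x + h) - g x)"
        by (simp add: eventually_at_filter)
    qed
  qed simp
  moreover have "((\<lambda>y. f y *\<^sub>R g x) has_derivative (\<lambda>h. f' h *\<^sub>R g x)) (at x)"
    using assms(1) by (rule has_derivative_scaleR_left)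
  ultimately have "((\<lambda>y. f y *\<^sub>R (g y - g x) + f y *\<^sub>R g x) has_derivative (\<lambda>h. 0 + f' h *\<^sub>R g x)) (at x)"
    by (rule has_derivative_add)
  then show ?thesis by (simp add: scaleR_diff_right)
qed

lemma linear_inv_apply:
  fixes L :: "'e::euclidean_space \<Rightarrow> 'e"
  assumes "linear L" "inj L"
  shows "L (inv L v) = v" "linear (inv L)"
  using linear_injective_imp_surjective[OF assms] inj_linear_imp_inv_linear[OF assms]
  by (simp_all add: surj_f_inv_f)

lemma linear_eq_basis_sum:
  fixes L :: "'e::euclidean_space \<Rightarrow> 'f::real_vector"
  assumes "linear L"
  shows "L v = (\<Sum>i\<in>Basis. (v \<bullet> i) *\<^sub>R L i)"
proof -
  have "L (\<Sum>i\<in>Basis. (v \<bullet> i) *\<^sub>R i) = (\<Sum>i\<in>Basis. (v \<bullet> i) *\<^sub>R L i)"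
    by (simp add: linear_sum[OF assms] linear_scale[OF assms])
  then show ?thesis by (simp add: euclidean_representation)
qed

text \<open>The injective map \<open>A x0\<close> is bounded below by some \<open>m\<close>, hence
  \<open>A x\<close> by \<open>m / 2\<close> for \<open>x\<close> nearby. So the distance of the two
  inverses at \<open>v\<close> is controlled by \<open>A x - A x0\<close> at the single vector
  \<open>inv (A x0) v\<close>.\<close>

lemma isCont_inv_linear:
  fixes A :: "'d::real_normed_vector \<Rightarrow> 'e::euclidean_space \<Rightarrow> 'e"
  assumes "open S" "x0 \<in> S" and lin: "\<And>x. x \<in> S \<Longrightarrow> linear (A x)" and inj: "\<And>x. x \<in> S \<Longrightarrow> inj (A x)"
    and cont: "\<And>v. isCont (\<lambda>x. A x v) x0"
  shows "isCont (\<lambda>x. inv (A x) v) x0"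
proof -
  obtain m where m: "m > 0" "\<And>u. m * norm u \<le> norm (A x0 u)"
    using linear_inj_bounded_below_pos[OF lin inj] assms(2) by metis
  \<comment> \<open>Dominates the operator norm of \<open>A x - A x0\<close>, although continuity is
    given for each fixed vector separately.\<close>
  define s where "s = (\<lambda>x. \<Sum>i\<in>Basis. norm (A x i - A x0 i))"
  have "(s \<longlongrightarrow> (\<Sum>i\<in>(Basis::'e set). 0)) (at x0)"
    unfolding s_def using cont by (intro tendsto_sum tendsto_norm_zero) (simp add: isCont_def LIM_zero_iff)
  then have "\<forall>\<^sub>F x in at x0. s x < m / 2" using m(1) by (intro order_tendstoD) auto
  moreover have "\<forall>\<^sub>F x in at x0. x \<in> S" using assms(1,2) eventually_at_topological by blast
  ultimately have ev: "\<forall>\<^sub>F x in at x0. norm (inv (A x) v - inv (A x0) v) \<le>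
      (2 / m) * norm (A x (inv (A x0) v) - A x0 (inv (A x0) v))"
  proof eventually_elim
    case (elim x)
    have "norm (A x u - A x0 u) \<le> (m / 2) * norm u" for u
    proof -
      have "linear (\<lambda>u. A x u - A x0 u)" using lin elim assms(2) linear_compose_sub by blast
      then have "A x u - A x0 u = (\<Sum>i\<in>Basis. (u \<bullet> i) *\<^sub>R (A x i - A x0 i))" by (rule linear_eq_basis_sum)
      also have "norm \<dots> \<le> (\<Sum>i\<in>Basis. norm u * norm (A x i - A x0 i))"
        by (rule order_trans[OF norm_sum]) (auto intro!: sum_mono mult_right_mono Basis_le_norm)
      also have "\<dots> = norm u * s x" by (simp add: s_def sum_distrib_left)
      also have "\<dots> \<le> norm u * (m / 2)" using elim by (intro mult_left_mono) auto
      finally show ?thesis by (simp add: mult.commute)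
    qed
    then have low: "norm (A x u) \<ge> (m / 2) * norm u" for u
      using m(2)[of u] norm_triangle_ineq2[of "A x0 u" "A x u"] norm_minus_commute[of "A x u" "A x0 u"]
      by (smt (verit) field_sum_of_halves distrib_right)
    let ?z = "inv (A x) v - inv (A x0) v"
    have "A x ?z = A x0 (inv (A x0) v) - A x (inv (A x0) v)"
      using lin inj elim assms(2) by (simp add: linear_diff linear_inv_apply)
    then have "(m / 2) * norm ?z \<le> norm (A x (inv (A x0) v) - A x0 (inv (A x0) v))"
      using low[of ?z] by (metis norm_minus_commute)
    then show ?case using m(1) by (simp add: field_simps)
  qed
  have "((\<lambda>x. (2 / m) * norm (A x (inv (A x0) v) - A x0 (inv (A x0) v))) \<longlongrightarrow> 0) (at x0)"
    using cont by (intro tendsto_mult_right_zero tendsto_norm_zero) (simp add: isCont_def LIM_zero_iff)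
  from Lim_null_comparison[OF ev this] show ?thesis by (simp add: isCont_def LIM_zero_iff)
qed

text \<open>With \<open>z = inv (A x0) v\<close> and \<open>w x = A x z - A x0 z\<close> one has
  \<open>inv (A x) v = z - inv (A x) (w x)\<close>. As \<open>w\<close> vanishes at
  \<open>x0\<close>, continuity of the inverse suffices to differentiate the last term.\<close>

lemma has_derivative_inv_linear:
  fixes A :: "'d::real_normed_vector \<Rightarrow> 'e::euclidean_space \<Rightarrow> 'e"
  assumes "open S" "x0 \<in> S" and lin: "\<And>x. x \<in> S \<Longrightarrow> linear (A x)" and inj: "\<And>x. x \<in> S \<Longrightarrow> inj (A x)"
    and der: "\<And>v. (\<lambda>x. A x v) differentiable (at x0)"
  shows "((\<lambda>x. inv (A x) v) has_derivative (\<lambda>h. - (\<Sum>j\<in>Basis.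
    ((\<Sum>i\<in>Basis. (inv (A x0) v \<bullet> i) *\<^sub>R frechet_derivative (\<lambda>x. A x i) (at x0) h) \<bullet> j) *\<^sub>R inv (A x0) j))) (at x0)"
    (is "(_ has_derivative ?D) _")
proof -
  have cont: "isCont (\<lambda>x. A x v) x0" for v
    by (rule differentiable_imp_continuous_within[OF der])
  let ?z = "inv (A x0) v"
  define w where "w = (\<lambda>x. \<Sum>i\<in>Basis. (?z \<bullet> i) *\<^sub>R A x i - (?z \<bullet> i) *\<^sub>R A x0 i)"
  have w: "(w has_derivative (\<lambda>h. \<Sum>i\<in>Basis. (?z \<bullet> i) *\<^sub>R frechet_derivative (\<lambda>x. A x i) (at x0) h - 0)) (at x0)"
    unfolding w_def
    by (intro has_derivative_sum has_derivative_diff has_derivative_scaleR_right has_derivative_const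
       iffD1[OF frechet_derivative_works der])
  have w0: "w x0 = 0" by (simp add: w_def)
  have "((\<lambda>x. ?z - (\<Sum>j\<in>Basis. (w x \<bullet> j) *\<^sub>R inv (A x) j)) has_derivative (\<lambda>h. 0 - (\<Sum>j\<in>Basis.
      ((\<Sum>i\<in>Basis. (?z \<bullet> i) *\<^sub>R frechet_derivative (\<lambda>x. A x i) (at x0) h - 0) \<bullet> j) *\<^sub>R inv (A x0) j))) (at x0)"
    by (intro has_derivative_diff has_derivative_const has_derivative_sum has_derivative_scaleR_zero
        has_derivative_inner_left w isCont_inv_linear[OF assms(1,2) lin inj cont]) (simp add: w0)
  then have "((\<lambda>x. ?z - (\<Sum>j\<in>Basis. (w x \<bullet> j) *\<^sub>R inv (A x) j)) has_derivative ?D) (at x0)" by simp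
  then show ?thesis
  proof (rule has_derivative_transform_within_open[OF _ assms(1,2)])
    fix x assume x: "x \<in> S"
    have "w x = A x ?z - A x0 ?z"
      using linear_eq_basis_sum[OF lin[OF x], of ?z] linear_eq_basis_sum[OF lin[OF assms(2)], of ?z]
      by (simp add: w_def sum_subtractf)
    also have "\<dots> = A x (?z - inv (A x) v)"
      using lin inj x assms(2) by (simp add: linear_diff linear_inv_apply)
    finally have "inv (A x) (w x) = ?z - inv (A x) v" using inj[OF x] by simp
    then show "?z - (\<Sum>j\<in>Basis. (w x \<bullet> j) *\<^sub>R inv (A x) j) = inv (A x) v"
      using linear_eq_basis_sum[OF linear_inv_apply(2)[OF lin[OF x] inj[OF x]], of "w x"] by simp
  qed
qed

text \<open>The derivative is built from the inverse itself and the derivative of \<open>A\<close>,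
  so the induction on the order closes.\<close>

lemma differentiable_upto_inv_linear:
  fixes A :: "'d::real_normed_vector \<Rightarrow> 'e::euclidean_space \<Rightarrow> 'e"
  assumes "open S" and lin: "\<And>x. x \<in> S \<Longrightarrow> linear (A x)" and inj: "\<And>x. x \<in> S \<Longrightarrow> inj (A x)"
    and "\<And>v. differentiable_upto k S (\<lambda>x. A x v)"
  shows "differentiable_upto k S (\<lambda>x. inv (A x) v)"
  using assms(4)
proof (induction k arbitrary: v)
  case 0
  then have "isCont (\<lambda>x. A x v) x" if "x \<in> S" for x v
    using that assms(1) by (simp add: continuous_on_eq_continuous_at)
  then show ?case
    using isCont_inv_linear[OF assms(1) _ lin inj] by (auto intro!: continuous_at_imp_continuous_on)
next
  case (Suc k)
  note inner = bounded_bilinear.differentiable_upto[OF bounded_bilinear_inner assms(1)]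
  note scaleR = bounded_bilinear.differentiable_upto[OF bounded_bilinear_scaleR assms(1)]
  have IH: "differentiable_upto k S (\<lambda>x. inv (A x) v)" for v
    by (rule Suc.IH[OF differentiable_upto_Suc[OF Suc.prems]])
  show ?case
  proof (rule differentiable_upto_SucI[OF assms(1)])
    fix x assume x: "x \<in> S"
    have "(\<lambda>x. A x v) differentiable (at x)" for v using Suc.prems x by auto
    from has_derivative_inv_linear[OF assms(1) x lin inj this, of v]
    show "((\<lambda>x. inv (A x) v) has_derivative (\<lambda>h. - (\<Sum>j\<in>Basis.
    ((\<Sum>i\<in>Basis. (inv (A x) v \<bullet> i) *\<^sub>R frechet_derivative (\<lambda>x. A x i) (at x) h) \<bullet> j) *\<^sub>R inv (A x) j))) (at x)" .
  next
    fix h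
    show "differentiable_upto k S (\<lambda>x. - (\<Sum>j\<in>Basis.
    ((\<Sum>i\<in>Basis. (inv (A x) v \<bullet> i) *\<^sub>R frechet_derivative (\<lambda>x. A x i) (at x) h) \<bullet> j) *\<^sub>R inv (A x) j))"
      by (intro differentiable_upto_bounded_linear[OF assms(1) bounded_linear_minus[OF bounded_linear_ident]]
          differentiable_upto_sum[OF assms(1)] inner scaleR IH differentiable_upto_const
          differentiable_upto_frechet[OF Suc.prems])
  qed
qed

lemma smooth_on_inv_linear:
  fixes A :: "'d::real_normed_vector \<Rightarrow> 'e::euclidean_space \<Rightarrow> 'e"
  assumes "open S" "\<And>x. x \<in> S \<Longrightarrow> linear (A x)" "\<And>x. x \<in> S \<Longrightarrow> inj (A x)"
    and "\<And>v. smooth_on S (\<lambda>x. A x v)" "smooth_on S u"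
  shows "smooth_on S (\<lambda>x. inv (A x) (u x))"
proof (rule smooth_on_cong[OF assms(1)])
  have inv: "smooth_on S (\<lambda>x. inv (A x) v)" for v
    using assms(4) unfolding smooth_on_def
    by (intro allI differentiable_upto_inv_linear[OF assms(1-3)]) auto
  show "smooth_on S (\<lambda>x. \<Sum>i\<in>Basis. (u x \<bullet> i) *\<^sub>R inv (A x) i)"
    by (intro smooth_on_sum smooth_on_scaleR smooth_on_inner smooth_on_const inv assms)
qed (simp add: linear_eq_basis_sum[OF linear_inv_apply(2)[OF assms(2,3)], symmetric])

section \<open>Families of bilinear forms\<close>

lemma bilinear_eq_basis_sum:
  fixes b :: "'e::euclidean_space \<Rightarrow> 'e \<Rightarrow> 'f::real_vector"
  assumes "bilinear b"
  shows "b u w = (\<Sum>i\<in>Basis. (u \<bullet> i) *\<^sub>R (\<Sum>j\<in>Basis. (w \<bullet> j) *\<^sub>R b i j))"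
proof -
  have "b u w = (\<Sum>i\<in>Basis. (u \<bullet> i) *\<^sub>R b i w)"
    using assms by (intro linear_eq_basis_sum[of "\<lambda>u. b u w"]) (simp add: bilinear_def)
  also have "\<dots> = (\<Sum>i\<in>Basis. (u \<bullet> i) *\<^sub>R (\<Sum>j\<in>Basis. (w \<bullet> j) *\<^sub>R b i j))"
    using assms by (intro sum.cong refl arg_cong[where f="scaleR _"] linear_eq_basis_sum) (simp add: bilinear_def)
  finally show ?thesis .
qed

lemma bilinear_frechet_derivative:
  fixes b :: "'d::real_normed_vector \<Rightarrow> 'e::euclidean_space \<Rightarrow> 'e \<Rightarrow> real"
  assumes "open S" "x \<in> S" and bil: "\<And>x. x \<in> S \<Longrightarrow> bilinear (b x)"
    and der: "\<And>u w. (\<lambda>x. b x u w) differentiable (at x)"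
  shows "bilinear (\<lambda>u w. frechet_derivative (\<lambda>x. b x u w) (at x) h)"
proof -
  have D: "((\<lambda>x. b x u w) has_derivative frechet_derivative (\<lambda>x. b x u w) (at x)) (at x)" for u w
    using der frechet_derivative_works by blast
  have 1: "frechet_derivative (\<lambda>x. b x (u + u') w) (at x) h =
     frechet_derivative (\<lambda>x. b x u w) (at x) h + frechet_derivative (\<lambda>x. b x u' w) (at x) h" for u u' w
    using frechet_derivative_at[OF has_derivative_transform_within_open[OF has_derivative_add[OF D[of u w] D[of u' w]] assms(1,2),
     of "\<lambda>x. b x (u + u') w"]] bil by (simp add: bilinear_ladd fun_eq_iff)
  have 2: "frechet_derivative (\<lambda>x. b x u (w + w')) (at x) h =
     frechet_derivative (\<lambda>x. b x u w) (at x) h + frechet_derivative (\<lambda>x. b x u w') (at x) h" for u w w'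
    using frechet_derivative_at[OF has_derivative_transform_within_open[OF has_derivative_add[OF D[of u w] D[of u w']] assms(1,2),
     of "\<lambda>x. b x u (w + w')"]] bil by (simp add: bilinear_radd fun_eq_iff)
  have 3: "frechet_derivative (\<lambda>x. b x (c *\<^sub>R u) w) (at x) h = c *\<^sub>R frechet_derivative (\<lambda>x. b x u w) (at x) h" for c u w
    using frechet_derivative_at[OF has_derivative_transform_within_open[OF has_derivative_scaleR_right[OF D[of u w]] assms(1,2),
     of c "\<lambda>x. b x (c *\<^sub>R u) w"]] bil by (simp add: bilinear_lmul fun_eq_iff)
  have 4: "frechet_derivative (\<lambda>x. b x u (c *\<^sub>R w)) (at x) h = c *\<^sub>R frechet_derivative (\<lambda>x. b x u w) (at x) h" for c u w
    using frechet_derivative_at[OF has_derivative_transform_within_open[OF has_derivative_scaleR_right[OF D[of u w]] assms(1,2),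
     of c "\<lambda>x. b x u (c *\<^sub>R w)"]] bil by (simp add: bilinear_rmul fun_eq_iff)
  show ?thesis unfolding bilinear_def by (intro conjI allI linearI 1 2 3 4)
qed

text \<open>Differentiability of \<open>b\<close> is given for fixed arguments only. The expansion
  into the matrix entries \<open>b x i j\<close> reduces the claim to the product rule, and
  bilinearity reassembles the three terms.\<close>

lemma has_derivative_bilinear_family:
  fixes b :: "'d::real_normed_vector \<Rightarrow> 'e::euclidean_space \<Rightarrow> 'e \<Rightarrow> real"
    and X :: "'z::real_normed_vector \<Rightarrow> 'd"
  assumes "open S" "X z \<in> S" and bil: "\<And>x. x \<in> S \<Longrightarrow> bilinear (b x)"
    and der: "\<And>u w. (\<lambda>x. b x u w) differentiable (at (X z))"
    and X: "(X has_derivative X') (at z)" and u: "(u has_derivative u') (at z)" and w: "(w has_derivative w') (at z)"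
  shows "((\<lambda>z. b (X z) (u z) (w z)) has_derivative (\<lambda>h. frechet_derivative (\<lambda>x. b x (u z) (w z)) (at (X z)) (X' h)
     + b (X z) (u' h) (w z) + b (X z) (u z) (w' h))) (at z)"
    (is "(_ has_derivative ?D) _")
proof -
  let ?d = "\<lambda>u w. frechet_derivative (\<lambda>x. b x u w) (at (X z))"
  have D: "((\<lambda>z. b (X z) i j) has_derivative (\<lambda>h. ?d i j (X' h))) (at z)" for i j
    using has_derivative_compose[OF X iffD1[OF frechet_derivative_works der]] .
  note b0 = bil[OF assms(2)] bilinear_frechet_derivative[OF assms(1,2) bil der]
  have "((\<lambda>z. \<Sum>i\<in>Basis. (u z \<bullet> i) *\<^sub>R (\<Sum>j\<in>Basis. (w z \<bullet> j) *\<^sub>R b (X z) i j)) has_derivative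
    (\<lambda>h. \<Sum>i\<in>Basis. (u z \<bullet> i) *\<^sub>R (\<Sum>j\<in>Basis. (w z \<bullet> j) *\<^sub>R ?d i j (X' h) + (w' h \<bullet> j) *\<^sub>R b (X z) i j)
       + (u' h \<bullet> i) *\<^sub>R (\<Sum>j\<in>Basis. (w z \<bullet> j) *\<^sub>R b (X z) i j))) (at z)"
    by (intro has_derivative_sum has_derivative_scaleR has_derivative_inner_left D u w)
  also have "(\<lambda>h. \<Sum>i\<in>Basis. (u z \<bullet> i) *\<^sub>R (\<Sum>j\<in>Basis. (w z \<bullet> j) *\<^sub>R ?d i j (X' h) + (w' h \<bullet> j) *\<^sub>R b (X z) i j)
       + (u' h \<bullet> i) *\<^sub>R (\<Sum>j\<in>Basis. (w z \<bullet> j) *\<^sub>R b (X z) i j)) = ?D"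
  proof
    fix h
    have "?d (u z) (w z) (X' h) = (\<Sum>i\<in>Basis. (u z \<bullet> i) *\<^sub>R (\<Sum>j\<in>Basis. (w z \<bullet> j) *\<^sub>R ?d i j (X' h)))"
      using bilinear_eq_basis_sum[OF b0(2)] .
    then show "(\<Sum>i\<in>Basis. (u z \<bullet> i) *\<^sub>R (\<Sum>j\<in>Basis. (w z \<bullet> j) *\<^sub>R ?d i j (X' h) + (w' h \<bullet> j) *\<^sub>R b (X z) i j)
       + (u' h \<bullet> i) *\<^sub>R (\<Sum>j\<in>Basis. (w z \<bullet> j) *\<^sub>R b (X z) i j)) = ?D h"
      unfolding bilinear_eq_basis_sum[OF b0(1), of "u' h" "w z"] bilinear_eq_basis_sum[OF b0(1), of "u z" "w' h"]
      by (simp only: sum.distrib scaleR_add_right add_ac)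
  qed
  finally have *: "((\<lambda>z. \<Sum>i\<in>Basis. (u z \<bullet> i) *\<^sub>R (\<Sum>j\<in>Basis. (w z \<bullet> j) *\<^sub>R b (X z) i j)) has_derivative ?D) (at z)" .
  have "isCont X z" using X by (rule has_derivative_continuous)
  then have "\<forall>\<^sub>F y in nhds z. X y \<in> S"
    using assms(1,2) by (metis continuous_within eventually_nhds topological_tendstoD tendsto_at_iff_tendsto_nhds)
  then obtain T where T: "open T" "z \<in> T" "\<And>y. y \<in> T \<Longrightarrow> X y \<in> S" unfolding eventually_nhds by blast
  show ?thesis
    by (rule has_derivative_transform_within_open[OF * T(1,2)]) (use T(3) bilinear_eq_basis_sum[OF bil] in simp)
qed

section \<open>Ordinary differential equations and submersions\<close>

text \<open>The difference of two integrals starting at \<open>-d\<close> is the oriented integral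
  from \<open>0\<close> to \<open>t\<close>; the expression \<open>integral {0..t} h\<close> would
  be zero for negative \<open>t\<close>.\<close>

lemma indefinite_integral_bound:
  fixes h :: "real \<Rightarrow> 'e::banach"
  assumes "0 \<le> d" "\<bar>t\<bar> \<le> d" "continuous_on UNIV h" "\<And>s. norm (h s) \<le> B"
  shows "norm (integral {-d..t} h - integral {-d..0} h) \<le> B * \<bar>t\<bar>"
proof -
  have int: "h integrable_on {a..b}" for a b
    using assms(3) by (intro integrable_continuous_real) (auto intro: continuous_on_subset)
  have cont: "continuous_on {a..b} h" for a b using assms(3) by (rule continuous_on_subset) simp
  show ?thesis
  proof (cases "0 \<le> t")
    case True
    have "integral {-d..0} h + integral {0..t} h = integral {-d..t} h"
      using True assms(1) by (intro Henstock_Kurzweil_Integration.integral_combine int) auto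
    then have "integral {-d..t} h - integral {-d..0} h = integral {0..t} h" by (simp add: algebra_simps)
    then show ?thesis using integral_bound[OF True cont, of B] assms(4) True by simp
  next
    case False
    have "integral {-d..t} h + integral {t..0} h = integral {-d..0} h"
      using False assms(1,2) by (intro Henstock_Kurzweil_Integration.integral_combine int) auto
    then have "integral {-d..t} h - integral {-d..0} h = - integral {t..0} h" by (simp add: algebra_simps)
    then show ?thesis using integral_bound[OF _ cont, of t 0 B] assms(4) False by simp
  qed
qed

text \<open>With a field that is bounded and Lipschitz on the whole space, the Picard operator acts
  on all bounded continuous curves, a complete space on which the contraction principle applies
  directly.\<close>

lemma picard_lindeloef_lipschitz:
  fixes F :: "'e::euclidean_space \<Rightarrow> 'e"
  assumes "0 \<le> L" "0 < M" "0 < r"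
    and lip: "\<And>y y'. norm (F y - F y') \<le> L * norm (y - y')" and bd: "\<And>y. norm (F y) \<le> M"
  obtains d x where "0 < d" "x 0 = z"
    "\<And>t. t \<in> {-d<..<d} \<Longrightarrow> dist z (x t) \<le> r \<and> (x has_vector_derivative F (x t)) (at t)"
proof -
  \<comment> \<open>The first bound keeps the solution within distance \<open>r\<close> of
    \<open>z\<close>, as its speed is at most \<open>M\<close>. The second makes the Picard operator
    contract by the factor \<open>1 / 2\<close>.\<close>
  define d where "d = min (r / M) (1 / (2 * (L + 1)))"
  have d: "0 < d" "M * d \<le> r" "L * d \<le> 1 / 2"
  proof -
    show "0 < d" using assms by (simp add: d_def)
    show "M * d \<le> r" using assms by (simp add: d_def min_def field_simps)
    have "L * d \<le> L * (1 / (2 * (L + 1)))" using assms by (intro mult_left_mono) (auto simp: d_def)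
    also have "\<dots> \<le> 1 / 2" using assms by (simp add: field_simps)
    finally show "L * d \<le> 1 / 2" .
  qed
  have contF: "continuous_on UNIV F"
    using lip by (intro lipschitz_on_continuous_on[of L] lipschitz_onI) (auto simp: dist_norm assms)
  \<comment> \<open>Clamping time to \<open>[-d, d]\<close> turns a curve on this interval into a
    bounded continuous function on the whole line, as \<open>bcontfun\<close> demands.\<close>
  define c where "c = (\<lambda>t. max (-d) (min d t))"
  have c: "\<bar>c t\<bar> \<le> d" for t using d by (auto simp: c_def)
  have contF': "continuous_on T (\<lambda>s. F (apply_bcontfun \<phi> s))" for \<phi> :: "real \<Rightarrow>\<^sub>C 'e" and T
    using contF by (rule continuous_on_compose2) auto
  define K where "K = (\<lambda>\<phi> t. z + (integral {-d..t} (\<lambda>s. F (apply_bcontfun \<phi> s)) - integral {-d..0} (\<lambda>s. F (apply_bcontfun \<phi> s))))"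
  have K: "norm (K \<phi> t - z) \<le> M * \<bar>t\<bar>" if "\<bar>t\<bar> \<le> d" for \<phi> t
    using indefinite_integral_bound[OF less_imp_le[OF d(1)] that contF', of \<phi> M] bd by (simp add: K_def)
  define P where "P = (\<lambda>\<phi>. Bcontfun (\<lambda>t. K \<phi> (c t)))"
  have contK: "continuous_on {-d..d} (K \<phi>)" for \<phi>
    unfolding K_def
    by (intro continuous_intros indefinite_integral_continuous_1 integrable_continuous_real contF')
  have "(\<lambda>t. K \<phi> (c t)) \<in> bcontfun" for \<phi>
  proof (rule bcontfun_normI)
    have "continuous_on UNIV c" unfolding c_def by (intro continuous_intros)
    then show "continuous_on UNIV (\<lambda>t. K \<phi> (c t))"
      by (rule continuous_on_compose2[OF contK]) (use c in \<open>auto simp: abs_le_iff minus_le_iff\<close>)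
    show "norm (K \<phi> (c t)) \<le> norm z + M * d" for t
    proof -
      have "norm (K \<phi> (c t)) \<le> norm z + norm (K \<phi> (c t) - z)" by norm
      also have "norm (K \<phi> (c t) - z) \<le> M * d"
        using K[OF c, of \<phi> t] mult_left_mono[OF c[of t], of M] assms by linarith
      finally show ?thesis by simp
    qed
  qed
  then have P: "apply_bcontfun (P \<phi>) t = K \<phi> (c t)" for \<phi> t by (simp add: P_def Bcontfun_inverse)
  have "dist (P \<phi>) (P \<psi>) \<le> (1 / 2) * dist \<phi> \<psi>" for \<phi> \<psi>
  proof (rule dist_bound)
    fix t
    let ?h = "\<lambda>s. F (apply_bcontfun \<phi> s) - F (apply_bcontfun \<psi> s)"
    have int: "(\<lambda>s. F (apply_bcontfun \<phi> s)) integrable_on {a..b}" for a b and \<phi> :: "real \<Rightarrow>\<^sub>C 'e"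
      by (intro integrable_continuous_real contF')
    have "K \<phi> (c t) - K \<psi> (c t) = integral {-d..c t} ?h - integral {-d..0} ?h"
      by (simp add: K_def Henstock_Kurzweil_Integration.integral_diff[OF int int])
    also have "norm \<dots> \<le> (L * dist \<phi> \<psi>) * \<bar>c t\<bar>"
    proof (rule indefinite_integral_bound[OF less_imp_le[OF d(1)] c])
      show "continuous_on UNIV ?h" by (intro continuous_on_diff contF')
      show "norm (?h s) \<le> L * dist \<phi> \<psi>" for s
        using lip[of "apply_bcontfun \<phi> s" "apply_bcontfun \<psi> s"]
          mult_left_mono[OF dist_bounded[of \<phi> s \<psi>] assms(1)] by (simp add: dist_norm)
    qed
    also have "\<dots> \<le> (L * dist \<phi> \<psi>) * d" using c assms by (intro mult_left_mono) auto
    also have "\<dots> = (L * d) * dist \<phi> \<psi>" by simp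
    also have "\<dots> \<le> (1 / 2) * dist \<phi> \<psi>" using d by (intro mult_right_mono) auto
    finally show "dist (apply_bcontfun (P \<phi>) t) (apply_bcontfun (P \<psi>) t) \<le> (1 / 2) * dist \<phi> \<psi>"
      by (simp add: P dist_norm)
  qed
  then obtain \<phi> where "P \<phi> = \<phi>"
    using banach_fix_type[of "1 / 2" P] by auto
  then have \<phi>: "apply_bcontfun \<phi> t = K \<phi> (c t)" for t using P[of \<phi> t] by simp
  have c_id: "c t = t" if "t \<in> {-d<..<d}" for t using that by (auto simp: c_def)
  show thesis
  proof (rule that[of d "apply_bcontfun \<phi>"])
    show "apply_bcontfun \<phi> 0 = z" using \<phi>[of 0] d by (simp add: c_id K_def)
    fix t assume t: "t \<in> {-d<..<d}"
    have "((\<lambda>t. integral {-d..t} (\<lambda>s. F (apply_bcontfun \<phi> s))) has_vector_derivative F (apply_bcontfun \<phi> t))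
       (at t within {-d..d})"
      using t by (intro integral_has_vector_derivative contF') auto
    then have "((\<lambda>t. integral {-d..t} (\<lambda>s. F (apply_bcontfun \<phi> s))) has_vector_derivative F (apply_bcontfun \<phi> t)) (at t)"
      using t at_within_interior[of t "{-d..d}"] by simp
    then have "(K \<phi> has_vector_derivative F (apply_bcontfun \<phi> t)) (at t)"
      unfolding K_def by (auto intro!: derivative_eq_intros)
    then have "(apply_bcontfun \<phi> has_vector_derivative F (apply_bcontfun \<phi> t)) (at t)"
      by (rule has_vector_derivative_transform_within_open[where S="{-d<..<d}"]) (use t \<phi> c_id in auto)
    moreover have "norm (apply_bcontfun \<phi> t - z) \<le> r" if "\<bar>t\<bar> \<le> d"
      using K[OF that, of \<phi>] mult_left_mono[OF that, of M] d(2) assms(2) t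
      unfolding \<phi> c_id[OF t] by linarith
    ultimately show "dist z (apply_bcontfun \<phi> t) \<le> r \<and>
       (apply_bcontfun \<phi> has_vector_derivative F (apply_bcontfun \<phi> t)) (at t)"
      using t by (simp add: dist_norm norm_minus_commute abs_le_iff)
  qed (use d in auto)
qed

lemma smooth_on_lipschitz_compact_convex:
  fixes f :: "'e::euclidean_space \<Rightarrow> 'f::real_normed_vector"
  assumes "smooth_on S f" "C \<subseteq> S" "compact C" "convex C"
  obtains L where "0 \<le> L" "\<And>x y. x \<in> C \<Longrightarrow> y \<in> C \<Longrightarrow> norm (f x - f y) \<le> L * norm (x - y)"
proof -
  have "\<exists>B. \<forall>x\<in>C. norm (frechet_derivative f (at x) i) \<le> B" for i
  proof -
    have "continuous_on C (\<lambda>x. frechet_derivative f (at x) i)"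
      using smooth_on_continuous[OF smooth_on_frechet[OF assms(1)]] assms(2) by (rule continuous_on_subset)
    from compact_imp_bounded[OF compact_continuous_image[OF this assms(3)]]
    show ?thesis by (auto simp: bounded_iff)
  qed
  then obtain B where B: "\<And>i x. x \<in> C \<Longrightarrow> norm (frechet_derivative f (at x) i) \<le> B i" by metis
  \<comment> \<open>The maximum with 0 matters when \<open>C\<close> is empty: then the bounds
    \<open>B\<close> are arbitrary and may be negative.\<close>
  define L where "L = max 0 (\<Sum>i\<in>(Basis::'e set). B i)"
  have "onorm (frechet_derivative f (at x)) \<le> L" if "x \<in> C" for x
  proof (rule onorm_bound)
    fix v
    have "frechet_derivative f (at x) v = (\<Sum>i\<in>Basis. (v \<bullet> i) *\<^sub>R frechet_derivative f (at x) i)"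
      using smooth_on_differentiable[OF assms(1)] that assms(2) by (intro frechet_derivative_basis) auto
    also have "norm \<dots> \<le> (\<Sum>i\<in>Basis. norm v * B i)"
      by (rule order_trans[OF norm_sum]) (auto intro!: sum_mono mult_mono Basis_le_norm B[OF that])
    also have "\<dots> = (\<Sum>i\<in>Basis. B i) * norm v" by (simp add: sum_distrib_left mult.commute)
    also have "\<dots> \<le> L * norm v" by (intro mult_right_mono) (auto simp: L_def)
    finally show "norm (frechet_derivative f (at x) v) \<le> L * norm v" .
  qed (simp add: L_def)
  then have "norm (f x - f y) \<le> L * norm (x - y)" if "x \<in> C" "y \<in> C" for x y
    using that smooth_on_has_derivative[OF assms(1)] assms(2)
    by (intro differentiable_bound[OF assms(4)]) (auto intro: has_derivative_at_withinI)
  then show thesis using that[of L] by (simp add: L_def)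
qed

text \<open>Bootstrapping: if \<open>x\<close> has \<open>k\<close> derivatives, so has
  \<open>f (x t)\<close>, which is the derivative of \<open>x\<close>.\<close>

lemma smooth_on_ode_solution:
  fixes x :: "real \<Rightarrow> 'e::euclidean_space"
  assumes "open S" "smooth_on S f" "open I"
    and "\<And>t. t \<in> I \<Longrightarrow> x t \<in> S \<and> (x has_vector_derivative f (x t)) (at t)"
  shows "smooth_on I x"
  unfolding smooth_on_def
proof
  fix k show "differentiable_upto k I x"
  proof (induction k)
    case 0
    have "isCont x t" if "t \<in> I" for t
      using assms(4)[OF that] has_derivative_continuous unfolding has_vector_derivative_def by blast
    then show ?case by (auto intro: continuous_at_imp_continuous_on)
  next
    case (Suc k)
    show ?case
    proof (rule differentiable_upto_SucI[OF assms(3)])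
      fix t assume "t \<in> I"
      then show "(x has_derivative (\<lambda>h. h *\<^sub>R f (x t))) (at t)"
        using assms(4) by (simp add: has_vector_derivative_def)
    next
      fix h :: real
      have "differentiable_upto k I (\<lambda>t. f (x t))"
        using assms(4)
        by (intro differentiable_upto_compose[OF assms(3,1) _ assms(2)[unfolded smooth_on_def, rule_format] Suc])
          auto
      then show "differentiable_upto k I (\<lambda>t. h *\<^sub>R f (x t))"
        by (intro differentiable_upto_bounded_linear[OF assms(3) bounded_linear_scaleR_right])
    qed
  qed
qed

text \<open>Composing \<open>f\<close> with the nearest-point projection onto a closed ball makes it
  bounded and globally Lipschitz. The solution stays in that ball, where the projection is the
  identity.\<close>

lemma smooth_ode_local_solution:
  fixes f :: "'e::euclidean_space \<Rightarrow> 'e"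
  assumes "open S" "z \<in> S" "smooth_on S f"
  obtains d x where "0 < d" "x 0 = z" "smooth_on {-d<..<d} x"
    "\<And>t. t \<in> {-d<..<d} \<Longrightarrow> x t \<in> S \<and> (x has_vector_derivative f (x t)) (at t)"
proof -
  obtain r where r: "0 < r" "cball z r \<subseteq> S" using assms open_contains_cball by blast
  let ?C = "cball z r"
  have C: "compact ?C" "convex ?C" "closed ?C" "?C \<noteq> {}" using r by auto
  obtain L where L: "0 \<le> L" "\<And>x y. x \<in> ?C \<Longrightarrow> y \<in> ?C \<Longrightarrow> norm (f x - f y) \<le> L * norm (x - y)"
    using smooth_on_lipschitz_compact_convex[OF assms(3) r(2) C(1,2)] by blast
  have "bounded (f ` ?C)"
    using C(1) smooth_on_continuous[OF assms(3)] r(2)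
    by (intro compact_imp_bounded compact_continuous_image) (auto intro: continuous_on_subset)
  then obtain M where M: "0 < M" "\<And>x. x \<in> ?C \<Longrightarrow> norm (f x) \<le> M" by (auto simp: bounded_pos)
  let ?p = "closest_point ?C"
  have p: "?p y \<in> ?C" for y using C by (intro closest_point_in_set)
  have lip: "norm (f (?p y) - f (?p y')) \<le> L * norm (y - y')" for y y'
    using L(2)[OF p[of y] p[of y']] mult_left_mono[OF closest_point_lipschitz[OF C(2,3,4), of y y'] L(1)]
    unfolding dist_norm by linarith
  obtain d x where dx: "0 < d" "x 0 = z"
    "\<And>t. t \<in> {-d<..<d} \<Longrightarrow> dist z (x t) \<le> r \<and> (x has_vector_derivative f (?p (x t))) (at t)"
    using picard_lindeloef_lipschitz[OF L(1) M(1) r(1), of "\<lambda>y. f (?p y)" z] lip M(2)[OF p] by metis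
  have sol: "x t \<in> S \<and> (x has_vector_derivative f (x t)) (at t)" if "t \<in> {-d<..<d}" for t
    using dx(3)[OF that] r(2) closest_point_self[of "x t" ?C] by auto
  show thesis
    by (rule that[OF dx(1,2) smooth_on_ode_solution[OF assms(1,3)] sol]) (use sol in auto)
qed

section \<open>Straightening a submersion\<close>

text \<open>\<open>\<Phi> x = x + R (F x - L x)\<close>, with \<open>L\<close> the derivative of \<open>F\<close> at \<open>x0\<close> and \<open>R\<close> a right inverse of \<open>L\<close>,
  straightens the fibres of \<open>F\<close>: it is a local diffeomorphism at \<open>x0\<close> with \<open>F = L \<circ> \<Phi>\<close>.\<close>

lemma submersion_straightening:
  fixes F :: "'e::euclidean_space \<Rightarrow> 'f::euclidean_space"
  assumes "open S" "x0 \<in> S" "smooth_on S F" "surj (frechet_derivative F (at x0))"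
  obtains L R U V and \<Phi> \<Psi> :: "'e \<Rightarrow> 'e" where "linear L" "linear R" "\<forall>y. L (R y) = y"
    "open U" "x0 \<in> U" "U \<subseteq> S" "open V" "homeomorphism U V \<Phi> \<Psi>"
    "\<forall>x\<in>U. L (\<Phi> x) = F x" "smooth_on V \<Psi>"
proof -
  define L where "L = frechet_derivative F (at x0)"
  have linL: "linear L"
    unfolding L_def using smooth_on_differentiable[OF assms(3,2)] by (rule linear_frechet_derivative)
  obtain R where R: "linear R" "L \<circ> R = id"
    using linear_surjective_right_inverse[OF linL] assms(4) by (auto simp: L_def)
  have LR: "L (R y) = y" for y using R(2) by (metis comp_apply id_apply)
  note bl = linear_conv_bounded_linear[THEN iffD1]
  define \<Phi> where "\<Phi> = (\<lambda>x. x + R (F x - L x))"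
  have smooth: "smooth_on S \<Phi>" unfolding \<Phi>_def
    by (intro smooth_on_add smooth_on_ident smooth_on_bounded_linear[OF _ bl[OF R(1)]] smooth_on_diff
        assms(1,3) smooth_on_bounded_linear[OF _ bl[OF linL]])
  define D where "D = (\<lambda>x. Blinfun (frechet_derivative \<Phi> (at x)))"
  have D: "blinfun_apply (D x) = frechet_derivative \<Phi> (at x)" if "x \<in> S" for x
    unfolding D_def
    by (rule bounded_linear_Blinfun_apply[OF has_derivative_bounded_linear[OF smooth_on_has_derivative[OF smooth that]]])
  have contD: "continuous_on S D"
  proof (rule continuous_on_blinfun_componentwise)
    fix i :: 'e
    show "continuous_on S (\<lambda>x. blinfun_apply (D x) i)"
      using smooth_on_continuous[OF smooth_on_frechet[OF smooth]] by (simp add: D cong: continuous_on_cong)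
  qed
  \<comment> \<open>The correction \<open>R (F x - L x)\<close> has derivative zero at
    \<open>x0\<close>, so the inverse function theorem applies with the identity as
    derivative.\<close>
  have "(\<Phi> has_derivative (\<lambda>h. h + R (L h - L h))) (at x0)"
    unfolding \<Phi>_def L_def
    using smooth_on_has_derivative[OF assms(3,2)] bounded_linear_imp_has_derivative[OF bl[OF linL]]
    unfolding L_def
    by (intro has_derivative_add has_derivative_ident bounded_linear.has_derivative[OF bl[OF R(1)]] has_derivative_diff)
  then have "frechet_derivative \<Phi> (at x0) = (\<lambda>h. h)"
    using linear_0[OF R(1)] by (simp add: frechet_derivative_at[symmetric])
  then have "id_blinfun o\<^sub>L D x0 = id_blinfun" by (intro blinfun_eqI) (simp add: D assms(2))
  obtain U V \<Psi> G where IFT: "open U" "U \<subseteq> S" "x0 \<in> U" "open V" "homeomorphism U V \<Phi> \<Psi>"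
    "\<And>y. y \<in> V \<Longrightarrow> (\<Psi> has_derivative G y) (at y)"
    "\<And>y. y \<in> V \<Longrightarrow> G y = inv (blinfun_apply (D (\<Psi> y)))"
    "\<And>y. y \<in> V \<Longrightarrow> bij (blinfun_apply (D (\<Psi> y)))"
    using inverse_function_theorem[OF assms(1) _ contD assms(2) \<open>id_blinfun o\<^sub>L D x0 = id_blinfun\<close>, of \<Phi>]
      smooth_on_has_derivative[OF smooth] D by metis
  have \<Psi>U: "\<Psi> y \<in> U" if "y \<in> V" for y using IFT(5) that by (auto simp: homeomorphism_def)
  have injD: "inj (frechet_derivative \<Phi> (at x))" if "x \<in> U" for x
  proof -
    have "\<Phi> x \<in> V" "\<Psi> (\<Phi> x) = x" using IFT(5) that by (auto simp: homeomorphism_def)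
    then show ?thesis using IFT(8)[of "\<Phi> x"] IFT(2) that D[of x] by (auto simp: bij_def)
  qed
  have inv_smooth: "smooth_on U (\<lambda>x. inv (frechet_derivative \<Phi> (at x)) v)" for v
    using IFT(2) injD
    by (intro smooth_on_inv_linear[OF IFT(1)] smooth_on_const smooth_on_frechet[OF smooth_on_subset[OF IFT(2) smooth]]
        linear_frechet_derivative smooth_on_differentiable[OF smooth]) auto
  \<comment> \<open>The inverse function theorem yields one derivative only. It equals the inverse
    of the derivative of \<open>\<Phi>\<close>, taken at \<open>\<Psi> y\<close>, so each order of
    regularity of \<open>\<Psi>\<close> gives the next.\<close>
  have "smooth_on V \<Psi>"
    unfolding smooth_on_def
  proof
    fix k show "differentiable_upto k V \<Psi>"
    proof (induction k)
      case 0
      then show ?case using IFT(5) by (simp add: homeomorphism_def)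
    next
      case (Suc k)
      show ?case
      proof (rule differentiable_upto_SucI[OF IFT(4)])
        fix y assume "y \<in> V"
        then show "(\<Psi> has_derivative (\<lambda>h. inv (frechet_derivative \<Phi> (at (\<Psi> y))) h)) (at y)"
          using IFT(6,7)[of y] D[of "\<Psi> y"] \<Psi>U[of y] IFT(2) by auto
      next
        fix v
        show "differentiable_upto k V (\<lambda>y. inv (frechet_derivative \<Phi> (at (\<Psi> y))) v)"
          using \<Psi>U
          by (intro differentiable_upto_compose[OF IFT(4,1) _ inv_smooth[of v, unfolded smooth_on_def, rule_format] Suc])
            auto
      qed
    qed
  qed
  moreover have "L (\<Phi> x) = F x" for x
    by (simp add: \<Phi>_def linear_add[OF linL] LR)
  ultimately show thesis
    using that[OF linL R(1) _ IFT(1,3,2,4,5)] LR by blast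
qed

text \<open>In straightened coordinates \<open>F\<close> is the linear map \<open>L\<close>, and its
  right inverse \<open>R\<close> becomes an affine section \<open>l\<close> through
  \<open>\<Phi> x0\<close>; \<open>\<Psi>\<close> carries it back.\<close>

lemma submersion_local_section:
  fixes F :: "'e::euclidean_space \<Rightarrow> 'f::euclidean_space"
  assumes "open S" "x0 \<in> S" "smooth_on S F" "surj (frechet_derivative F (at x0))"
  obtains \<sigma> W where "open W" "F x0 \<in> W" "\<And>y. y \<in> W \<Longrightarrow> \<sigma> y \<in> S \<and> F (\<sigma> y) = y"
    "smooth_on W \<sigma>"
proof -
  obtain L R U V and \<Phi> \<Psi> :: "'e \<Rightarrow> 'e" where *: "linear L" "linear R" "\<forall>y. L (R y) = y"
    "open U" "x0 \<in> U" "U \<subseteq> S" "open V" "homeomorphism U V \<Phi> \<Psi>"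
    "\<forall>x\<in>U. L (\<Phi> x) = F x" "smooth_on V \<Psi>"
    using submersion_straightening[OF assms] .
  define l where "l = (\<lambda>y. \<Phi> x0 + R (y - F x0))"
  define W where "W = l -` V"
  have smooth_l: "smooth_on UNIV l" unfolding l_def
    by (intro smooth_on_add smooth_on_const smooth_on_diff smooth_on_ident open_UNIV
        smooth_on_bounded_linear[OF open_UNIV linear_conv_bounded_linear[THEN iffD1, OF *(2)]])
  show thesis
  proof (rule that[of W "\<lambda>y. \<Psi> (l y)"])
    show W: "open W" unfolding W_def
      using *(7) smooth_on_continuous[OF smooth_l] by (simp add: continuous_on_open_vimage)
    show "F x0 \<in> W" using *(5,8) by (auto simp: W_def l_def linear_0[OF *(2)] homeomorphism_def)
    show "\<Psi> (l y) \<in> S \<and> F (\<Psi> (l y)) = y" if "y \<in> W" for y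
    proof -
      have "l y \<in> V" using that by (simp add: W_def)
      then have U: "\<Psi> (l y) \<in> U" and "\<Phi> (\<Psi> (l y)) = l y" using *(8) by (auto simp: homeomorphism_def)
      then have "F (\<Psi> (l y)) = L (l y)" using *(9)[rule_format, OF U] by simp
      also have "\<dots> = y" by (simp add: l_def linear_add[OF *(1)] *(3) *(9)[rule_format, OF *(5)])
      finally show ?thesis using U *(6) by auto
    qed
    show "smooth_on W (\<lambda>y. \<Psi> (l y))"
      by (rule smooth_on_compose[OF W *(7) _ *(10) smooth_on_subset[OF _ smooth_l]]) (auto simp: W_def)
  qed
qed

text \<open>Straightening makes the fibre an affine subspace, so within a ball it contains the
  segment between any two of its points. Along the segment \<open>F\<close> is constant, its
  velocity therefore lies in the kernel, and \<open>\<mu>\<close> has derivative zero. The kernel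
  condition is used at every point of the segment.\<close>

lemma submersion_locally_constant_on_fibre:
  fixes F :: "'e::euclidean_space \<Rightarrow> 'f::euclidean_space" and \<mu> :: "'e \<Rightarrow> real"
  assumes "open S" "x0 \<in> S" "smooth_on S F" "surj (frechet_derivative F (at x0))"
    and "smooth_on S \<mu>"
    and ker: "\<And>x v. x \<in> S \<Longrightarrow> frechet_derivative F (at x) v = 0 \<Longrightarrow> frechet_derivative \<mu> (at x) v = 0"
  obtains N where "open N" "x0 \<in> N" "N \<subseteq> S" "\<And>x. x \<in> N \<Longrightarrow> F x = F x0 \<Longrightarrow> \<mu> x = \<mu> x0"
proof -
  obtain L R U V and \<Phi> \<Psi> :: "'e \<Rightarrow> 'e" where *: "linear L" "linear R" "\<forall>y. L (R y) = y"
    "open U" "x0 \<in> U" "U \<subseteq> S" "open V" "homeomorphism U V \<Phi> \<Psi>"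
    "\<forall>x\<in>U. L (\<Phi> x) = F x" "smooth_on V \<Psi>"
    using submersion_straightening[OF assms(1-4)] .
  have V: "\<Phi> x \<in> V" "\<Psi> (\<Phi> x) = x" if "x \<in> U" for x using that *(8) by (auto simp: homeomorphism_def)
  have U: "\<Psi> y \<in> U" "\<Phi> (\<Psi> y) = y" if "y \<in> V" for y using that *(8) by (auto simp: homeomorphism_def)
  obtain r where r: "r > 0" "ball (\<Phi> x0) r \<subseteq> V" using V[OF *(5)] *(7) open_contains_ball by blast
  let ?B = "ball (\<Phi> x0) r"
  define N where "N = U \<inter> \<Phi> -` ?B"
  have N: "x0 \<in> N" "N \<subseteq> S" using *(5,6) r(1) by (auto simp: N_def)
  have "open N" unfolding N_def
    using *(8) by (intro continuous_open_preimage *(4) open_ball) (auto simp: homeomorphism_def)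
  from this N show thesis
  proof (rule that)
    fix x assume that: "x \<in> N" "F x = F x0"
    have xU: "x \<in> U" using that by (simp add: N_def)
    define l where "l = (\<lambda>t. \<Phi> x0 + t *\<^sub>R (\<Phi> x - \<Phi> x0))"
    have contl: "continuous_on UNIV l" unfolding l_def by (intro continuous_intros)
    have lB: "l t \<in> ?B" if "t \<in> {0..1}" for t
    proof -
      have "(1 - t) *\<^sub>R \<Phi> x0 + t *\<^sub>R \<Phi> x \<in> ?B"
        using \<open>x \<in> N\<close> r(1) that by (intro convexD[OF convex_ball]) (auto simp: N_def)
      then show ?thesis by (simp add: l_def algebra_simps)
    qed
    have "((\<lambda>t. \<mu> (\<Psi> (l t))) has_real_derivative 0) (at t within {0..1})" if "t \<in> {0..1}" for t
    proof -
      have lV: "l t \<in> V" using lB[OF that] r by auto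
      let ?c = "\<lambda>h. frechet_derivative \<Psi> (at (l t)) (h *\<^sub>R (\<Phi> x - \<Phi> x0))"
      have "(l has_derivative (\<lambda>h. h *\<^sub>R (\<Phi> x - \<Phi> x0))) (at t)"
        unfolding l_def by (auto intro!: derivative_eq_intros)
      from has_derivative_compose[OF this smooth_on_has_derivative[OF *(10) lV]]
      have d: "((\<lambda>t. \<Psi> (l t)) has_derivative ?c) (at t)" .
      have S: "\<Psi> (l t) \<in> S" using U[OF lV] *(6) by auto
      have dF: "((\<lambda>t. F (\<Psi> (l t))) has_derivative (\<lambda>h. frechet_derivative F (at (\<Psi> (l t))) (?c h))) (at t)"
        using has_derivative_compose[OF d smooth_on_has_derivative[OF assms(3) S]] .
      have "F (\<Psi> (l s)) = F x0" if "l s \<in> V" for s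
        using *(9)[rule_format, OF U(1)[OF that]] U(2)[OF that] *(9)[rule_format, OF *(5)] *(9)[rule_format, OF xU] \<open>F x = F x0\<close>
        by (simp add: l_def linear_add[OF *(1)] linear_scale[OF *(1)] linear_diff[OF *(1)])
      moreover have "open (l -` V)"
        using *(7) contl by (simp add: continuous_on_open_vimage)
      ultimately have "((\<lambda>t. F x0) has_derivative (\<lambda>h. frechet_derivative F (at (\<Psi> (l t))) (?c h))) (at t)"
        using lV by (intro has_derivative_transform_within_open[OF dF, of "l -` V"]) auto
      then have "(\<lambda>h. frechet_derivative F (at (\<Psi> (l t))) (?c h)) = (\<lambda>h. 0)"
        using has_derivative_unique has_derivative_const by blast
      then have "frechet_derivative \<mu> (at (\<Psi> (l t))) (?c h) = 0" for h
        using ker[OF S] by metis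
      then have "((\<lambda>t. \<mu> (\<Psi> (l t))) has_derivative (\<lambda>h. 0)) (at t)"
        using has_derivative_compose[OF d smooth_on_has_derivative[OF assms(5) S]] by simp
      from has_derivative_eq_rhs[OF has_derivative_at_withinI[OF this], of "(*) 0"] show ?thesis
        by (simp add: has_field_derivative_def fun_eq_iff)
    qed
    then have "\<exists>c. \<forall>t\<in>{0..1}. \<mu> (\<Psi> (l t)) = c"
      by (intro has_field_derivative_zero_constant) auto
    then have "\<mu> (\<Psi> (l 1)) = \<mu> (\<Psi> (l 0))" by auto
    then show "\<mu> x = \<mu> x0" using V(2)[OF xU] V(2)[OF *(5)] by (simp add: l_def)
  qed
qed

section \<open>Geodesics in a coordinate domain\<close>

definition coord_metric :: "'e::euclidean_space set \<Rightarrow> ('e \<Rightarrow> 'e \<Rightarrow> 'e \<Rightarrow> real) \<Rightarrow> bool" where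
  "coord_metric S b \<longleftrightarrow> open S \<and>
     (\<forall>x\<in>S. bilinear (b x) \<and> (\<forall>u w. b x u w = b x w u) \<and> (\<forall>u. u \<noteq> 0 \<longrightarrow> 0 < b x u u)) \<and>
     (\<forall>u w. smooth_on S (\<lambda>x. b x u w))"

text \<open>Christoffel symbols of the first kind with \<open>v\<close> in both lower slots. The two
  equal terms merge and absorb the factor \<open>1 / 2\<close>; the geodesic equation uses this
  diagonal part alone.\<close>

definition lower_christoffel :: "('e::euclidean_space \<Rightarrow> 'e \<Rightarrow> 'e \<Rightarrow> real) \<Rightarrow> 'e \<Rightarrow> 'e \<Rightarrow> 'e \<Rightarrow> real" where
  "lower_christoffel b x v w =
     frechet_derivative (\<lambda>y. b y v w) (at x) v - frechet_derivative (\<lambda>y. b y v v) (at x) w / 2"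

text \<open>The operator that represents \<open>b\<close> through the ambient inner product. Its
  inverse raises indices.\<close>

definition gram :: "('e::euclidean_space \<Rightarrow> 'e \<Rightarrow> real) \<Rightarrow> 'e \<Rightarrow> 'e" where
  "gram b u = (\<Sum>i\<in>Basis. b u i *\<^sub>R i)"

lemma coord_metricD:
  assumes "coord_metric S b"
  shows "open S" "\<And>x. x \<in> S \<Longrightarrow> bilinear (b x)" "\<And>x u w. x \<in> S \<Longrightarrow> b x u w = b x w u"
    "\<And>x u. x \<in> S \<Longrightarrow> u \<noteq> 0 \<Longrightarrow> 0 < b x u u" "\<And>u w. smooth_on S (\<lambda>x. b x u w)"
    "\<And>x u w. x \<in> S \<Longrightarrow> (\<lambda>x. b x u w) differentiable (at x)"
  using assms smooth_on_differentiable unfolding coord_metric_def by blast+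

lemma linear_gram: "bilinear b \<Longrightarrow> linear (gram b)"
  unfolding gram_def
  by (intro linearI) (simp_all add: bilinear_ladd bilinear_lmul scaleR_add_left sum.distrib scaleR_sum_right)

lemma gram_inner:
  assumes "bilinear b" shows "gram b u \<bullet> w = b u w"
proof -
  have "linear (b u)" using assms by (simp add: bilinear_def)
  from linear_eq_basis_sum[OF this, of w] show ?thesis
    by (simp add: gram_def inner_sum_left inner_commute[of w] mult.commute)
qed

lemma inj_gram:
  assumes "bilinear b" "\<And>u. u \<noteq> 0 \<Longrightarrow> 0 < b u u"
  shows "inj (gram b)"
proof -
  have "u = 0" if "gram b u = 0" for u
    using gram_inner[OF assms(1), of u u] assms(2)[of u] that by auto
  then show ?thesis by (simp add: linear_injective_0[OF linear_gram[OF assms(1)]])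
qed

text \<open>The vector \<open>\<Sum>i\<in>Basis. l i *\<^sub>R i\<close> represents \<open>l\<close>
  for the ambient inner product, and the inverse of \<open>gram b\<close> converts this into the
  representation, unique by definiteness, with respect to \<open>b\<close>.\<close>

lemma riesz_gram:
  fixes l :: "'e::euclidean_space \<Rightarrow> real"
  assumes "bilinear b" "\<And>u. u \<noteq> 0 \<Longrightarrow> 0 < b u u" "linear l"
  shows "b (inv (gram b) (\<Sum>i\<in>Basis. l i *\<^sub>R i)) w = l w"
    and "(\<forall>w. b z w = l w) \<longleftrightarrow> z = inv (gram b) (\<Sum>i\<in>Basis. l i *\<^sub>R i)"
proof -
  have *: "(\<Sum>i\<in>Basis. l i *\<^sub>R i) \<bullet> w = l w" for w
    using linear_eq_basis_sum[OF assms(3), of w]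
    by (simp add: inner_sum_left inner_commute[of w] mult.commute)
  have g: "gram b (inv (gram b) (\<Sum>i\<in>Basis. l i *\<^sub>R i)) = (\<Sum>i\<in>Basis. l i *\<^sub>R i)"
    using assms by (intro linear_inv_apply(1) linear_gram inj_gram)
  show sol: "b (inv (gram b) (\<Sum>i\<in>Basis. l i *\<^sub>R i)) w = l w" for w
    unfolding gram_inner[OF assms(1), symmetric] g by (rule *)
  show "(\<forall>w. b z w = l w) \<longleftrightarrow> z = inv (gram b) (\<Sum>i\<in>Basis. l i *\<^sub>R i)"
  proof
    assume a: "\<forall>w. b z w = l w"
    have "gram b z = gram b (inv (gram b) (\<Sum>i\<in>Basis. l i *\<^sub>R i))"
      unfolding g by (rule euclidean_eqI) (simp add: gram_inner[OF assms(1)] a *)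
    then show "z = inv (gram b) (\<Sum>i\<in>Basis. l i *\<^sub>R i)"
      using inj_gram[OF assms(1,2)] by (simp add: inj_eq)
  qed (simp add: sol)
qed

lemma coord_metric_frechet:
  assumes "coord_metric S b" "x \<in> S"
  shows "linear (frechet_derivative (\<lambda>y. b y u w) (at x))"
    and "bilinear (\<lambda>u w. frechet_derivative (\<lambda>y. b y u w) (at x) h)"
  using coord_metricD[OF assms(1)] assms(2)
  by (auto intro!: linear_frechet_derivative bilinear_frechet_derivative)

lemma linear_lower_christoffel:
  assumes "coord_metric S b" "x \<in> S"
  shows "linear (lower_christoffel b x v)"
proof -
  have "linear (\<lambda>w. frechet_derivative (\<lambda>y. b y v w) (at x) v)"
    using coord_metric_frechet(2)[OF assms] by (simp add: bilinear_def)
  moreover have "linear (\<lambda>w. (1 / 2) *\<^sub>R frechet_derivative (\<lambda>y. b y v v) (at x) w)"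
    using coord_metric_frechet(1)[OF assms] by (intro linear_compose_scale_right)
  ultimately show ?thesis
    unfolding lower_christoffel_def using linear_compose_sub by fastforce
qed

lemma smooth_on_vector_derivative:
  fixes x :: "real \<Rightarrow> 'e::real_normed_vector"
  assumes "open I" "smooth_on I x"
  shows "smooth_on I (\<lambda>t. vector_derivative x (at t))"
    and "t \<in> I \<Longrightarrow> (x has_vector_derivative vector_derivative x (at t)) (at t)"
proof -
  show v: "(x has_vector_derivative vector_derivative x (at t)) (at t)" if "t \<in> I" for t
    using smooth_on_differentiable[OF assms(2) that] vector_derivative_works by blast
  then have "frechet_derivative x (at t) 1 = vector_derivative x (at t)" if "t \<in> I" for t
    using frechet_derivative_at[of x "\<lambda>h. h *\<^sub>R vector_derivative x (at t)" t] that
    by (simp add: has_vector_derivative_def) (metis scaleR_one)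
  then show "smooth_on I (\<lambda>t. vector_derivative x (at t))"
    using smooth_on_cong[OF assms(1) _ smooth_on_frechet[OF assms(2), of 1], of "\<lambda>t. vector_derivative x (at t)"]
    by simp
qed

text \<open>Joint smoothness in position and velocity is required by the first-order system for
  geodesics. The velocity enters polynomially through its components, so smoothness for fixed
  vectors suffices.\<close>

lemma smooth_on_lower_christoffel:
  assumes "coord_metric S b"
  shows "smooth_on (S \<times> UNIV) (\<lambda>z. lower_christoffel b (fst z) (snd z) w)"
proof -
  let ?d = "\<lambda>x u w h. frechet_derivative (\<lambda>y. b y u w) (at x) h"
  note S = coord_metricD(1)[OF assms]
  have op: "open (S \<times> (UNIV :: 'a set))" using S by (intro open_Times open_UNIV)
  have sm: "smooth_on (S \<times> UNIV) (\<lambda>z :: 'a \<times> 'a. ?d (fst z) u w h)" for u w h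
    by (rule smooth_on_compose[OF op S _ smooth_on_frechet[OF coord_metricD(5)[OF assms]]
          smooth_on_bounded_linear[OF op bounded_linear_fst smooth_on_ident[OF op]]]) auto
  note sn = smooth_on_bounded_linear[OF op bounded_linear_snd smooth_on_ident[OF op]]
  have "smooth_on (S \<times> UNIV) (\<lambda>z. (\<Sum>i\<in>Basis. (snd z \<bullet> i) *\<^sub>R (\<Sum>j\<in>Basis. (snd z \<bullet> j) *\<^sub>R ?d (fst z) j w i))
      - (1 / 2) *\<^sub>R (\<Sum>i\<in>Basis. (snd z \<bullet> i) *\<^sub>R (\<Sum>j\<in>Basis. (snd z \<bullet> j) *\<^sub>R ?d (fst z) i j w)))"
    by (intro smooth_on_diff smooth_on_sum smooth_on_scaleR smooth_on_inner smooth_on_const sm sn op)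
  then show ?thesis
  proof (rule smooth_on_cong[OF op, rotated])
    fix z :: "'a \<times> 'a" assume "z \<in> S \<times> UNIV"
    then have x: "fst z \<in> S" by auto
    let ?v = "snd z"
    have lin: "linear (\<lambda>u. ?d (fst z) u w h)" for h
      using coord_metric_frechet(2)[OF assms x] by (simp add: bilinear_def)
    have "?d (fst z) ?v w ?v = (\<Sum>i\<in>Basis. (?v \<bullet> i) *\<^sub>R ?d (fst z) ?v w i)"
      by (rule linear_eq_basis_sum[OF coord_metric_frechet(1)[OF assms x]])
    also have "\<dots> = (\<Sum>i\<in>Basis. (?v \<bullet> i) *\<^sub>R (\<Sum>j\<in>Basis. (?v \<bullet> j) *\<^sub>R ?d (fst z) j w i))"
      by (intro sum.cong refl arg_cong[where f="scaleR _"] linear_eq_basis_sum[OF lin])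
    finally show "(\<Sum>i\<in>Basis. (?v \<bullet> i) *\<^sub>R (\<Sum>j\<in>Basis. (?v \<bullet> j) *\<^sub>R ?d (fst z) j w i))
      - (1 / 2) *\<^sub>R (\<Sum>i\<in>Basis. (?v \<bullet> i) *\<^sub>R (\<Sum>j\<in>Basis. (?v \<bullet> j) *\<^sub>R ?d (fst z) i j w))
      = lower_christoffel b (fst z) ?v w"
      using bilinear_eq_basis_sum[OF coord_metric_frechet(2)[OF assms x], of ?v ?v w]
      by (simp add: lower_christoffel_def)
  qed
qed

text \<open>The second condition is the geodesic equation with the index of the Christoffel symbols lowered,
  which avoids inverting the metric.\<close>

definition coord_geodesic ::
    "('e::euclidean_space \<Rightarrow> 'e \<Rightarrow> 'e \<Rightarrow> real) \<Rightarrow> 'e set \<Rightarrow> real set \<Rightarrow> (real \<Rightarrow> 'e) \<Rightarrow> bool" where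
  "coord_geodesic b S I x \<longleftrightarrow> smooth_on I x \<and> (\<forall>t\<in>I. x t \<in> S \<and>
     (\<forall>w. b (x t) (vector_derivative (\<lambda>s. vector_derivative x (at s)) (at t)) w
        + lower_christoffel b (x t) (vector_derivative x (at t)) w = 0))"

text \<open>The geodesic equation is read as an autonomous first-order system for the pair of
  position and velocity on \<open>S \<times> UNIV\<close>.\<close>

lemma coord_geodesic_exists:
  assumes "coord_metric S b" "x0 \<in> S"
  obtains d x where "0 < d" "coord_geodesic b S {-d<..<d} x" "x 0 = x0" "vector_derivative x (at 0) = v0"
proof -
  note cm = coord_metricD[OF assms(1)]
  have op: "open (S \<times> (UNIV :: 'a set))" using cm(1) by (intro open_Times open_UNIV)
  \<comment> \<open>The acceleration that the equation prescribes at position \<open>fst z\<close>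
    and velocity \<open>snd z\<close>: the Riesz vector of minus the lowered Christoffel
    form.\<close>
  define acc where "acc = (\<lambda>z :: 'a \<times> 'a. inv (gram (b (fst z))) (\<Sum>i\<in>Basis. - lower_christoffel b (fst z) (snd z) i *\<^sub>R i))"
  have acc: "b (fst z) (acc z) w + lower_christoffel b (fst z) (snd z) w = 0" if "fst z \<in> S" for z w
    using riesz_gram(1)[OF cm(2,4)[OF that] linear_compose_neg[OF linear_lower_christoffel[OF assms(1) that]], of "snd z" w]
    by (simp add: acc_def)
  note fst' = smooth_on_bounded_linear[OF op bounded_linear_fst smooth_on_ident[OF op]]
  note snd' = smooth_on_bounded_linear[OF op bounded_linear_snd smooth_on_ident[OF op]]
  have "smooth_on (S \<times> UNIV) acc"
    unfolding acc_def
  proof (rule smooth_on_inv_linear[OF op])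
    fix z :: "'a \<times> 'a" assume "z \<in> S \<times> UNIV"
    then show "linear (gram (b (fst z)))" "inj (gram (b (fst z)))"
      using cm(2,4) by (auto intro!: linear_gram inj_gram)
  next
    fix v
    have "smooth_on (S \<times> UNIV) (\<lambda>z :: 'a \<times> 'a. b (fst z) v i)" for i
      using smooth_on_compose[OF op cm(1) _ cm(5)[of v i] fst'] by auto
    then show "smooth_on (S \<times> UNIV) (\<lambda>z :: 'a \<times> 'a. gram (b (fst z)) v)"
      unfolding gram_def by (intro smooth_on_sum smooth_on_scaleR smooth_on_const op)
  next
    show "smooth_on (S \<times> UNIV) (\<lambda>z. \<Sum>i\<in>Basis. - lower_christoffel b (fst z) (snd z) i *\<^sub>R i)"
      by (intro smooth_on_sum smooth_on_scaleR smooth_on_const smooth_on_minus smooth_on_lower_christoffel op assms(1))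
  qed
  then have "smooth_on (S \<times> UNIV) (\<lambda>z. (snd z, acc z))"
    by (intro smooth_on_Pair op snd')
  moreover have "(x0, v0) \<in> S \<times> UNIV" using assms(2) by simp
  ultimately obtain d z where z: "0 < d" "z 0 = (x0, v0)" "smooth_on {-d<..<d} z"
    "\<And>t. t \<in> {-d<..<d} \<Longrightarrow> z t \<in> S \<times> UNIV \<and> (z has_vector_derivative (snd (z t), acc (z t))) (at t)"
    using smooth_ode_local_solution[OF op] by blast
  define x where "x = (\<lambda>t. fst (z t))"
  have d1: "(x has_vector_derivative snd (z t)) (at t)" if "t \<in> {-d<..<d}" for t
    using bounded_linear.has_vector_derivative[OF bounded_linear_fst z(4)[OF that, THEN conjunct2]]
    by (simp add: x_def)
  then have vd: "vector_derivative x (at t) = snd (z t)" if "t \<in> {-d<..<d}" for t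
    using that vector_derivative_at by blast
  have d2: "vector_derivative (\<lambda>s. vector_derivative x (at s)) (at t) = acc (z t)" if "t \<in> {-d<..<d}" for t
  proof (rule vector_derivative_at, rule has_vector_derivative_transform_within_open[where S="{-d<..<d}"])
    show "((\<lambda>s. snd (z s)) has_vector_derivative acc (z t)) (at t)"
      using bounded_linear.has_vector_derivative[OF bounded_linear_snd z(4)[OF that, THEN conjunct2]] by simp
  qed (use that vd in auto)
  have "smooth_on {-d<..<d} x"
    unfolding x_def by (intro smooth_on_bounded_linear[OF _ bounded_linear_fst z(3)]) simp
  moreover have "x t \<in> S \<and> b (x t) (acc (z t)) w + lower_christoffel b (x t) (snd (z t)) w = 0"
    if "t \<in> {-d<..<d}" for t w
    using acc[of "z t" w] z(4)[OF that] by (auto simp: x_def)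
  ultimately have "coord_geodesic b S {-d<..<d} x"
    unfolding coord_geodesic_def using d2 vd by (metis (no_types, lifting))
  moreover have "x 0 = x0" "vector_derivative x (at 0) = v0" using z(1,2) vd[of 0] by (simp_all add: x_def)
  ultimately show thesis using that[OF z(1)] by blast
qed

section \<open>Change of coordinates in the geodesic equation\<close>

lemma pullback_has_derivative:
  fixes F :: "'e::euclidean_space \<Rightarrow> 'f::euclidean_space"
  assumes "coord_metric T b" "open S" "smooth_on S F" "F ` S \<subseteq> T" "x \<in> S"
  shows "((\<lambda>x. b (F x) (frechet_derivative F (at x) u) (frechet_derivative F (at x) w)) has_derivative
    (\<lambda>h. frechet_derivative (\<lambda>y. b y (frechet_derivative F (at x) u) (frechet_derivative F (at x) w)) (at (F x))
          (frechet_derivative F (at x) h)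
       + b (F x) (frechet_derivative (\<lambda>x. frechet_derivative F (at x) u) (at x) h) (frechet_derivative F (at x) w)
       + b (F x) (frechet_derivative F (at x) u) (frechet_derivative (\<lambda>x. frechet_derivative F (at x) w) (at x) h)))
    (at x)"
proof -
  have Fx: "F x \<in> T" using assms by auto
  show ?thesis
    using coord_metricD[OF assms(1)] Fx
    by (intro has_derivative_bilinear_family[where S=T] smooth_on_has_derivative[OF _ assms(5)]
        smooth_on_frechet assms(3)) auto
qed

text \<open>Second derivatives of \<open>\<tau>\<close> arise in the acceleration of the image curve
  and in the derivatives of the pulled back metric. The one in the acceleration matches the one from
  \<open>frechet_derivative (\<lambda>y. b y v w) (at x) v\<close>; the remaining two cancel by
  symmetry of the second derivative and of \<open>b'\<close>.\<close>

lemma coord_geodesic_equation_transform: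
  fixes \<tau> :: "'e::euclidean_space \<Rightarrow> 'e" and x :: "real \<Rightarrow> 'e"
  assumes b: "coord_metric S b" and b': "coord_metric T b'"
    and \<tau>: "smooth_on S \<tau>" "\<tau> ` S \<subseteq> T"
    and pull: "\<And>y u w. y \<in> S \<Longrightarrow>
      b y u w = b' (\<tau> y) (frechet_derivative \<tau> (at y) u) (frechet_derivative \<tau> (at y) w)"
    and I: "open I" "t \<in> I" and x: "smooth_on I x" "x ` I \<subseteq> S"
  shows "b' (\<tau> (x t)) (vector_derivative (\<lambda>s. vector_derivative (\<lambda>r. \<tau> (x r)) (at s)) (at t)) (frechet_derivative \<tau> (at (x t)) w)
      + lower_christoffel b' (\<tau> (x t)) (vector_derivative (\<lambda>r. \<tau> (x r)) (at t)) (frechet_derivative \<tau> (at (x t)) w)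
    = b (x t) (vector_derivative (\<lambda>s. vector_derivative x (at s)) (at t)) w
      + lower_christoffel b (x t) (vector_derivative x (at t)) w"
proof -
  let ?D = "\<lambda>y u. frechet_derivative \<tau> (at y) u"
  let ?D2 = "\<lambda>y u h. frechet_derivative (\<lambda>x. ?D x u) (at y) h"
  define v where "v = (\<lambda>s. vector_derivative x (at s))"
  define a where "a = vector_derivative v (at t)"
  note S = coord_metricD(1)[OF b]
  have xs: "x s \<in> S" if "s \<in> I" for s using x(2) that by auto
  have xv: "(x has_vector_derivative v s) (at s)" if "s \<in> I" for s
    using smooth_on_vector_derivative(2)[OF I(1) x(1) that] by (simp add: v_def)
  have va: "(v has_vector_derivative a) (at t)"
    using smooth_on_vector_derivative(2)[OF I(1) smooth_on_vector_derivative(1)[OF I(1) x(1)] I(2)]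
    by (simp add: v_def a_def)
  have linD: "linear (?D y)" if "y \<in> S" for y
    using smooth_on_differentiable[OF \<tau>(1) that] by (rule linear_frechet_derivative)
  have v1: "vector_derivative (\<lambda>r. \<tau> (x r)) (at s) = ?D (x s) (v s)" if "s \<in> I" for s
  proof (rule vector_derivative_at)
    show "((\<lambda>r. \<tau> (x r)) has_vector_derivative ?D (x s) (v s)) (at s)"
      using has_derivative_compose[OF xv[OF that, unfolded has_vector_derivative_def]
          smooth_on_has_derivative[OF \<tau>(1) xs[OF that]]]
      by (simp add: has_vector_derivative_def linear_scale[OF linD[OF xs[OF that]]])
  qed
  have D2sym: "?D2 (x t) u h = ?D2 (x t) h u" for u h
    using symmetric_second_frechet[OF S \<tau>(1) xs[OF I(2)]] .
  \<comment> \<open>The velocity of the image curve is expanded so that each summand is a scalar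
    function times a derivative of \<open>\<tau>\<close> in a fixed direction, which the product
    rule can handle.\<close>
  have "((\<lambda>s. \<Sum>i\<in>Basis. (v s \<bullet> i) *\<^sub>R ?D (x s) i) has_vector_derivative
      (\<Sum>i\<in>Basis. (v t \<bullet> i) *\<^sub>R ?D2 (x t) i (v t) + (a \<bullet> i) *\<^sub>R ?D (x t) i)) (at t)"
    unfolding has_vector_derivative_def
  proof (rule has_derivative_eq_rhs)
    show "((\<lambda>s. \<Sum>i\<in>Basis. (v s \<bullet> i) *\<^sub>R ?D (x s) i) has_derivative
      (\<lambda>h. \<Sum>i\<in>Basis. (v t \<bullet> i) *\<^sub>R ?D2 (x t) i (h *\<^sub>R v t) + ((h *\<^sub>R a) \<bullet> i) *\<^sub>R ?D (x t) i)) (at t)"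
      by (intro has_derivative_sum has_derivative_scaleR has_derivative_inner_left
          va[unfolded has_vector_derivative_def]
          has_derivative_compose[OF xv[OF I(2), unfolded has_vector_derivative_def]
          smooth_on_has_derivative[OF smooth_on_frechet[OF \<tau>(1)] xs[OF I(2)]]])
    have "linear (?D2 (x t) i)" for i
      by (rule linear_frechet_derivative[OF smooth_on_differentiable[OF smooth_on_frechet[OF \<tau>(1)] xs[OF I(2)]]])
    then show "(\<lambda>h. \<Sum>i\<in>Basis. (v t \<bullet> i) *\<^sub>R ?D2 (x t) i (h *\<^sub>R v t) + ((h *\<^sub>R a) \<bullet> i) *\<^sub>R ?D (x t) i)
      = (\<lambda>h. h *\<^sub>R (\<Sum>i\<in>Basis. (v t \<bullet> i) *\<^sub>R ?D2 (x t) i (v t) + (a \<bullet> i) *\<^sub>R ?D (x t) i))"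
      by (simp add: fun_eq_iff linear_scale scaleR_sum_right scaleR_add_right ac_simps)
  qed
  also have "(\<Sum>i\<in>Basis. (v t \<bullet> i) *\<^sub>R ?D2 (x t) i (v t) + (a \<bullet> i) *\<^sub>R ?D (x t) i)
      = ?D2 (x t) (v t) (v t) + ?D (x t) a"
  proof -
    have "?D2 (x t) (v t) (v t) = (\<Sum>i\<in>Basis. (v t \<bullet> i) *\<^sub>R ?D2 (x t) (v t) i)"
      by (rule frechet_derivative_basis[OF smooth_on_differentiable[OF smooth_on_frechet[OF \<tau>(1)] xs[OF I(2)]]])
    also have "\<dots> = (\<Sum>i\<in>Basis. (v t \<bullet> i) *\<^sub>R ?D2 (x t) i (v t))"
      by (intro sum.cong refl arg_cong[where f="scaleR _"] D2sym)
    finally show ?thesis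
      by (simp add: sum.distrib linear_eq_basis_sum[OF linD[OF xs[OF I(2)]], of a])
  qed
  finally have v2': "((\<lambda>s. \<Sum>i\<in>Basis. (v s \<bullet> i) *\<^sub>R ?D (x s) i) has_vector_derivative ?D2 (x t) (v t) (v t) + ?D (x t) a) (at t)" .
  have v2: "vector_derivative (\<lambda>s. vector_derivative (\<lambda>r. \<tau> (x r)) (at s)) (at t) = ?D2 (x t) (v t) (v t) + ?D (x t) a"
  proof (rule vector_derivative_at, rule has_vector_derivative_transform_within_open[OF v2' I])
    show "(\<Sum>i\<in>Basis. (v s \<bullet> i) *\<^sub>R ?D (x s) i) = vector_derivative (\<lambda>r. \<tau> (x r)) (at s)" if "s \<in> I" for s
      using v1[OF that] linear_eq_basis_sum[OF linD[OF xs[OF that]], of "v s"] by simp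
  qed
  have dtr: "frechet_derivative (\<lambda>y. b y u w) (at (x t)) h =
      frechet_derivative (\<lambda>y. b' y (?D (x t) u) (?D (x t) w)) (at (\<tau> (x t))) (?D (x t) h)
      + b' (\<tau> (x t)) (?D2 (x t) u h) (?D (x t) w) + b' (\<tau> (x t)) (?D (x t) u) (?D2 (x t) w h)" for u w h
    using frechet_derivative_at[OF has_derivative_transform_within_open[OF
        pullback_has_derivative[OF b' S \<tau> xs[OF I(2)], of u w] S xs[OF I(2)], of "\<lambda>y. b y u w"]] pull
    by (simp add: fun_eq_iff)
  have T: "\<tau> (x t) \<in> T" using \<tau>(2) xs[OF I(2)] by auto
  have vt: "vector_derivative x (at t) = v t" by (simp add: v_def)
  have sym: "b' (\<tau> (x t)) (?D (x t) (v t)) (?D2 (x t) w (v t)) = b' (\<tau> (x t)) (?D2 (x t) w (v t)) (?D (x t) (v t))"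
    by (rule coord_metricD(3)[OF b' T])
  show ?thesis
    unfolding v2 v1[OF I(2)] lower_christoffel_def v_def[symmetric] a_def[symmetric] vt dtr pull[OF xs[OF I(2)]]
      bilinear_ladd[OF coord_metricD(2)[OF b' T]] D2sym[of "v t" w] sym
    by (simp add: field_simps)
qed

section \<open>The derivative of the conserved quantity along a geodesic\<close>

lemma clairaut_polynomial:
  assumes b: "coord_metric S b" "x0 \<in> S"
    and Q: "\<And>x. x \<in> S \<Longrightarrow> bilinear (Q x)" "\<And>u w. (\<lambda>x. Q x u w) differentiable (at x0)"
      "\<And>u w. Q x0 u w = Q x0 w u"
    and \<phi>: "\<phi> differentiable (at x0)"
    and clairaut: "\<And>x d. 0 < d \<Longrightarrow> coord_geodesic b S {-d<..<d} x \<Longrightarrow> x 0 = x0 \<Longrightarrow>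
        vector_derivative x (at 0) = v \<Longrightarrow>
      \<exists>C. \<forall>\<^sub>F t in nhds 0. \<phi> (x t) * Q (x t) (vector_derivative x (at t)) (vector_derivative x (at t)) =
         C * b (x t) (vector_derivative x (at t)) (vector_derivative x (at t))"
  obtains a where "\<forall>w. b x0 a w = - lower_christoffel b x0 v w"
    "frechet_derivative \<phi> (at x0) v * Q x0 v v +
     \<phi> x0 * (frechet_derivative (\<lambda>x. Q x v v) (at x0) v + 2 * Q x0 v a) = 0"
proof -
  note cm = coord_metricD[OF b(1)]
  obtain d x where x: "0 < d" "coord_geodesic b S {-d<..<d} x" "x 0 = x0" "vector_derivative x (at 0) = v"
    using coord_geodesic_exists[OF b] by blast
  let ?I = "{-d<..<d}" and ?v = "\<lambda>t. vector_derivative x (at t)"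
  define a where "a = vector_derivative ?v (at 0)"
  have I: "open ?I" "0 \<in> ?I" using x(1) by auto
  have sm: "smooth_on ?I x" using x(2) by (simp add: coord_geodesic_def)
  have a: "b x0 a w = - lower_christoffel b x0 v w" for w
  proof -
    have "b x0 a w + lower_christoffel b x0 v w = 0"
      using x(2) I(2) unfolding coord_geodesic_def a_def by (metis x(3,4))
    then show ?thesis by simp
  qed
  have dx: "(x has_derivative (\<lambda>h. h *\<^sub>R v)) (at 0)"
    using smooth_on_vector_derivative(2)[OF I(1) sm I(2)] x(4) by (simp add: has_vector_derivative_def)
  have dv: "(?v has_derivative (\<lambda>h. h *\<^sub>R a)) (at 0)"
    using smooth_on_vector_derivative(2)[OF I(1) smooth_on_vector_derivative(1)[OF I(1) sm] I(2)]
    by (simp add: has_vector_derivative_def a_def)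
  obtain C where C: "\<forall>\<^sub>F t in nhds 0. \<phi> (x t) * Q (x t) (?v t) (?v t) = C * b (x t) (?v t) (?v t)"
    using clairaut[OF x] by blast
  have dq: "((\<lambda>t. Q (x t) (?v t) (?v t)) has_derivative
      (\<lambda>h. frechet_derivative (\<lambda>x. Q x v v) (at x0) (h *\<^sub>R v) + Q x0 (h *\<^sub>R a) v + Q x0 v (h *\<^sub>R a))) (at 0)"
    using has_derivative_bilinear_family[where b=Q, OF cm(1) _ Q(1) _ dx dv dv] Q(2) b(2) x(3,4) by simp
  have db: "((\<lambda>t. b (x t) (?v t) (?v t)) has_derivative
      (\<lambda>h. frechet_derivative (\<lambda>x. b x v v) (at x0) (h *\<^sub>R v) + b x0 (h *\<^sub>R a) v + b x0 v (h *\<^sub>R a))) (at 0)"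
    using has_derivative_bilinear_family[where b=b, OF cm(1) _ cm(2) _ dx dv dv] cm(6) b(2) x(3,4) by simp
  have dphi: "((\<lambda>t. \<phi> (x t)) has_derivative (\<lambda>h. frechet_derivative \<phi> (at x0) (h *\<^sub>R v))) (at 0)"
    using has_derivative_compose[OF dx, of \<phi>] \<phi> x(3) by (simp add: frechet_derivative_works)
  have "((\<lambda>t. \<phi> (x t) * Q (x t) (?v t) (?v t)) has_derivative
     (\<lambda>h. \<phi> (x 0) * (frechet_derivative (\<lambda>x. Q x v v) (at x0) (h *\<^sub>R v) + Q x0 (h *\<^sub>R a) v + Q x0 v (h *\<^sub>R a))
       + frechet_derivative \<phi> (at x0) (h *\<^sub>R v) * Q (x 0) (?v 0) (?v 0))) (at 0)"
    by (rule has_derivative_mult[OF dphi dq])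
  moreover have "((\<lambda>t. \<phi> (x t) * Q (x t) (?v t) (?v t)) has_derivative
     (\<lambda>h. C * (frechet_derivative (\<lambda>x. b x v v) (at x0) (h *\<^sub>R v) + b x0 (h *\<^sub>R a) v + b x0 v (h *\<^sub>R a)))) (at 0)"
  proof -
    obtain U where U: "open U" "0 \<in> U" "\<And>t. t \<in> U \<Longrightarrow> \<phi> (x t) * Q (x t) (?v t) (?v t) = C * b (x t) (?v t) (?v t)"
      using C unfolding eventually_nhds by blast
    show ?thesis
      by (rule has_derivative_transform_within_open[OF has_derivative_mult_right[OF db] U(1,2)]) (simp add: U(3))
  qed
  ultimately have "\<phi> (x 0) * (frechet_derivative (\<lambda>x. Q x v v) (at x0) (1 *\<^sub>R v) + Q x0 (1 *\<^sub>R a) v + Q x0 v (1 *\<^sub>R a))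
       + frechet_derivative \<phi> (at x0) (1 *\<^sub>R v) * Q (x 0) (?v 0) (?v 0)
     = C * (frechet_derivative (\<lambda>x. b x v v) (at x0) (1 *\<^sub>R v) + b x0 (1 *\<^sub>R a) v + b x0 v (1 *\<^sub>R a))"
    using has_derivative_unique by (metis (no_types, lifting))
  then have "frechet_derivative \<phi> (at x0) v * Q x0 v v +
     \<phi> x0 * (frechet_derivative (\<lambda>x. Q x v v) (at x0) v + 2 * Q x0 v a)
     = C * (frechet_derivative (\<lambda>x. b x v v) (at x0) v + 2 * b x0 a v)"
    using cm(3)[OF b(2), of v a] Q(3)[of a v] x(3,4) by (simp add: algebra_simps)
  \<comment> \<open>Conservation of speed: the geodesic equation tested with \<open>v\<close>
    itself. Hence the unknown constant \<open>C\<close> disappears.\<close>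
  also have "\<dots> = 0" by (simp add: a lower_christoffel_def)
  finally show thesis using that a by blast
qed

section \<open>The Clairaut relation in coordinates\<close>

text \<open>The first-order identity is applied to \<open>v = s *\<^sub>R X + V\<close> and compared
  in degree 2 in \<open>s\<close>. Since \<open>Q x0 v v\<close> reduces to \<open>Q x0 V V\<close>,
  the derivative of \<open>\<phi>\<close> contributes in degrees 0 and 1 only, so nothing about it
  survives.\<close>

lemma clairaut_second_order:
  fixes b :: "'e::euclidean_space \<Rightarrow> 'e \<Rightarrow> 'e \<Rightarrow> real"
  assumes b: "coord_metric S b" "x0 \<in> S"
    and Q: "\<And>x. x \<in> S \<Longrightarrow> bilinear (Q x)" "\<And>u w. (\<lambda>x. Q x u w) differentiable (at x0)"
      "\<And>u w. Q x0 u w = Q x0 w u"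
    and \<phi>: "\<phi> differentiable (at x0)" "\<phi> x0 \<noteq> 0"
    and clairaut: "\<And>x d. 0 < d \<Longrightarrow> coord_geodesic b S {-d<..<d} x \<Longrightarrow> x 0 = x0 \<Longrightarrow>
        vector_derivative x (at 0) \<noteq> 0 \<Longrightarrow>
      \<exists>C. \<forall>\<^sub>F t in nhds 0. \<phi> (x t) * Q (x t) (vector_derivative x (at t)) (vector_derivative x (at t)) =
         C * b (x t) (vector_derivative x (at t)) (vector_derivative x (at t))"
    and X: "X \<noteq> 0" "\<And>Z. Q x0 X Z = 0" and V: "V \<noteq> 0" "\<And>Z. Q x0 V Z = b x0 V Z"
  shows "frechet_derivative (\<lambda>x. Q x X X) (at x0) V
      + frechet_derivative (\<lambda>x. Q x V X) (at x0) X + frechet_derivative (\<lambda>x. Q x X V) (at x0) X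
      - 2 * frechet_derivative (\<lambda>x. b x X V) (at x0) X + frechet_derivative (\<lambda>x. b x X X) (at x0) V = 0"
proof -
  note cm = coord_metricD[OF b(1)]
  let ?q = "\<lambda>h u w. frechet_derivative (\<lambda>x. Q x u w) (at x0) h"
  let ?d = "\<lambda>h u w. frechet_derivative (\<lambda>x. b x u w) (at x0) h"
  note Q0 = Q(1)[OF b(2)]
  \<comment> \<open>Orthogonality of \<open>X\<close> and \<open>V\<close> ensures that
    \<open>s *\<^sub>R X + V\<close> never vanishes; the Clairaut hypothesis covers nonzero initial
    velocities only.\<close>
  have bX: "b x0 V X = 0" using V(2)[of X] Q(3)[of V X] X(2)[of V] by simp
  have ne: "s *\<^sub>R X + V \<noteq> 0" for s :: real
  proof
    assume "s *\<^sub>R X + V = 0"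
    then have "V = - s *\<^sub>R X" by (simp add: eq_neg_iff_add_eq_0 add.commute)
    then have "b x0 V V = - s * b x0 V X"
      using cm(2)[OF b(2)] by (metis bilinear_rmul real_scaleR_def)
    then show False using bX cm(4)[OF b(2) V(1)] by simp
  qed
  have eq: "(s * frechet_derivative \<phi> (at x0) X + frechet_derivative \<phi> (at x0) V) * Q x0 V V +
     \<phi> x0 * (?q (s *\<^sub>R X + V) (s *\<^sub>R X + V) (s *\<^sub>R X + V)
       - 2 * ?d (s *\<^sub>R X + V) (s *\<^sub>R X + V) V + ?d V (s *\<^sub>R X + V) (s *\<^sub>R X + V)) = 0" for s
  proof -
    let ?v = "s *\<^sub>R X + V"
    obtain a where a: "\<forall>w. b x0 a w = - lower_christoffel b x0 ?v w"
      "frechet_derivative \<phi> (at x0) ?v * Q x0 ?v ?v + \<phi> x0 * (?q ?v ?v ?v + 2 * Q x0 ?v a) = 0"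
    proof (rule clairaut_polynomial[where b=b and Q=Q and v="?v" and \<phi>=\<phi>, OF b Q \<phi>(1)])
      fix x :: "real \<Rightarrow> 'e" and d :: real
      assume x: "0 < d" "coord_geodesic b S {-d<..<d} x" "x 0 = x0" "vector_derivative x (at 0) = ?v"
      show "\<exists>C. \<forall>\<^sub>F t in nhds 0. \<phi> (x t) * Q (x t) (vector_derivative x (at t)) (vector_derivative x (at t)) =
         C * b (x t) (vector_derivative x (at t)) (vector_derivative x (at t))"
        by (rule clairaut[OF x(1-3)]) (simp add: x(4) ne)
    qed (assumption, rule that)
    have Qv: "Q x0 ?v Z = Q x0 V Z" for Z
      by (simp add: bilinear_ladd[OF Q0] bilinear_lmul[OF Q0] X(2))
    have e1: "Q x0 ?v ?v = Q x0 V V" using Qv Q(3) by metis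
    \<comment> \<open>Only the \<open>V\<close> part of the velocity is seen by \<open>Q\<close>,
      and there \<open>Q\<close> agrees with \<open>b\<close>; so the geodesic equation eliminates
      the acceleration.\<close>
    have e2: "Q x0 ?v a = - lower_christoffel b x0 ?v V"
      using Qv V(2) cm(3)[OF b(2)] a(1) by metis
    have e3: "frechet_derivative \<phi> (at x0) ?v = s * frechet_derivative \<phi> (at x0) X + frechet_derivative \<phi> (at x0) V"
      using linear_frechet_derivative[OF \<phi>(1)] by (simp add: linear_add linear_scale)
    show ?thesis using a(2) unfolding e1 e2 e3 lower_christoffel_def by (simp add: algebra_simps)
  qed
  have ql: "linear (\<lambda>h. ?q h u w)" for u w using Q(2) by (rule linear_frechet_derivative)
  have qb: "bilinear (\<lambda>u w. ?q h u w)" for h using bilinear_frechet_derivative[OF cm(1) b(2) Q(1,2)] .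
  note dl = coord_metric_frechet(1)[OF b] and db = coord_metric_frechet(2)[OF b]
  note exp = linear_add[OF ql] linear_scale[OF ql] bilinear_ladd[OF qb] bilinear_lmul[OF qb]
    bilinear_radd[OF qb] bilinear_rmul[OF qb]
    linear_add[OF dl] linear_scale[OF dl] bilinear_ladd[OF db] bilinear_lmul[OF db]
    bilinear_radd[OF db] bilinear_rmul[OF db]
  have dsym: "?d h u w = ?d h w u" for h u w
  proof -
    have "((\<lambda>x. b x w u) has_derivative frechet_derivative (\<lambda>x. b x u w) (at x0)) (at x0)"
      by (rule has_derivative_transform_within_open[OF iffD1[OF frechet_derivative_works cm(6)[OF b(2)]] cm(1) b(2)])
        (rule cm(3))
    from frechet_derivative_at[OF this] show ?thesis by simp
  qed
  \<comment> \<open>The value at 1 plus the value at -1 minus twice the value at 0 is twice the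
    coefficient of the square of \<open>s\<close>, for any cubic polynomial.\<close>
  have "\<phi> x0 * (?q V X X + ?q X V X + ?q X X V - 2 * ?d X X V + ?d V X X) = 0"
    using eq[of 1] eq[of "-1"] eq[of 0] unfolding exp dsym[where u=V and w=X]
    by (simp add: algebra_simps)
  then show ?thesis using \<phi>(2) by simp
qed

text \<open>Substituting \<open>Q = b - \<mu> G\<close> into the second-order identity removes the
  derivatives of \<open>b\<close>: those along \<open>X\<close> cancel against the acceleration
  term, and the one along \<open>V\<close> is exchanged for derivatives of \<open>\<mu> G\<close>
  because \<open>Q x X X\<close> is stationary at \<open>x0\<close>. The derivatives of
  \<open>G\<close> then cancel, which leaves that of \<open>\<mu>\<close>.\<close>

lemma dilation_vertical_derivative:
  fixes F :: "'e::euclidean_space \<Rightarrow> 'f::euclidean_space" and \<mu> \<phi> :: "'e \<Rightarrow> real"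
    and b :: "'e \<Rightarrow> 'e \<Rightarrow> 'e \<Rightarrow> real" and b' :: "'f \<Rightarrow> 'f \<Rightarrow> 'f \<Rightarrow> real"
  defines "G \<equiv> \<lambda>x u w. b' (F x) (frechet_derivative F (at x) u) (frechet_derivative F (at x) w)"
  assumes b: "coord_metric S b" "x0 \<in> S" and b': "coord_metric T b'"
    and F: "smooth_on S F" "F ` S \<subseteq> T"
    and \<mu>: "smooth_on S \<mu>" "0 < \<mu> x0" and \<phi>: "\<phi> differentiable (at x0)" "\<phi> x0 \<noteq> 0"
    and le: "\<And>x u. x \<in> S \<Longrightarrow> \<mu> x * G x u u \<le> b x u u"
    and clairaut: "\<And>x d. 0 < d \<Longrightarrow> coord_geodesic b S {-d<..<d} x \<Longrightarrow> x 0 = x0 \<Longrightarrow>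
        vector_derivative x (at 0) \<noteq> 0 \<Longrightarrow>
      \<exists>C. \<forall>\<^sub>F t in nhds 0. \<phi> (x t) *
          (b (x t) (vector_derivative x (at t)) (vector_derivative x (at t))
           - \<mu> (x t) * G (x t) (vector_derivative x (at t)) (vector_derivative x (at t))) =
         C * b (x t) (vector_derivative x (at t)) (vector_derivative x (at t))"
    and X: "X \<noteq> 0" "\<And>Z. \<mu> x0 * G x0 X Z = b x0 X Z"
    and V: "frechet_derivative F (at x0) V = 0"
  shows "frechet_derivative \<mu> (at x0) V = 0"
proof (cases "V = 0")
  case True
  then show ?thesis
    using linear_0[OF linear_frechet_derivative[OF smooth_on_differentiable[OF \<mu>(1) b(2)]]] by simp
next
  case False
  note cm = coord_metricD[OF b(1)]
  let ?DF = "\<lambda>x u. frechet_derivative F (at x) u"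
  let ?D2 = "\<lambda>u h. frechet_derivative (\<lambda>x. ?DF x u) (at x0) h"
  define Q where "Q = (\<lambda>x u w. b x u w - \<mu> x * G x u w)"
  have Fx: "F x \<in> T" if "x \<in> S" for x using F(2) that by auto
  have linF: "linear (?DF x)" if "x \<in> S" for x
    using smooth_on_differentiable[OF F(1) that] by (rule linear_frechet_derivative)
  have G: "bilinear (G x)" "G x u w = G x w u" if "x \<in> S" for x u w
  proof -
    note 1 = coord_metricD(2)[OF b' Fx[OF that]] and 2 = linF[OF that]
    show "bilinear (G x)" unfolding bilinear_def G_def
      by (intro conjI allI linearI)
        (simp_all add: linear_add[OF 2] linear_scale[OF 2] bilinear_ladd[OF 1] bilinear_lmul[OF 1]
          bilinear_radd[OF 1] bilinear_rmul[OF 1])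
    show "G x u w = G x w u" unfolding G_def by (rule coord_metricD(3)[OF b' Fx[OF that]])
  qed
  have G0: "G x u w = 0" if "x \<in> S" "?DF x u = 0 \<or> ?DF x w = 0" for x u w
    using that bilinear_lzero bilinear_rzero coord_metricD(2)[OF b' Fx[OF that(1)]]
    unfolding G_def by metis
  define dG where "dG = (\<lambda>h u w. frechet_derivative (\<lambda>y. b' y (?DF x0 u) (?DF x0 w)) (at (F x0)) (?DF x0 h)
       + b' (F x0) (?D2 u h) (?DF x0 w) + b' (F x0) (?DF x0 u) (?D2 w h))"
  have dG: "((\<lambda>x. G x u w) has_derivative (\<lambda>h. dG h u w)) (at x0)" for u w
    unfolding G_def dG_def by (rule pullback_has_derivative[OF b' cm(1) F b(2)])
  let ?d = "\<lambda>h u w. frechet_derivative (\<lambda>x. b x u w) (at x0) h"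
  let ?dm = "frechet_derivative \<mu> (at x0)"
  have dQ: "((\<lambda>x. Q x u w) has_derivative (\<lambda>h. ?d h u w - (\<mu> x0 * dG h u w + ?dm h * G x0 u w))) (at x0)" for u w
    unfolding Q_def
    by (intro has_derivative_diff has_derivative_mult dG smooth_on_has_derivative[OF \<mu>(1) b(2)]
        smooth_on_has_derivative[OF cm(5) b(2)])
  have q: "frechet_derivative (\<lambda>x. Q x u w) (at x0) h = ?d h u w - (\<mu> x0 * dG h u w + ?dm h * G x0 u w)" for u w h
    using frechet_derivative_at[OF dQ] by metis
  have Qbil: "bilinear (Q x)" if "x \<in> S" for x
    unfolding Q_def bilinear_def using cm(2)[OF that] G(1)[OF that]
    by (intro conjI allI linearI)
      (simp_all add: bilinear_ladd bilinear_lmul bilinear_radd bilinear_rmul algebra_simps)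
  have Qsym: "Q x0 u w = Q x0 w u" for u w
    using cm(3)[OF b(2), of u w] G(2)[OF b(2), of u w] by (simp add: Q_def)
  have QX: "Q x0 X Z = 0" for Z using X(2) by (simp add: Q_def)
  have QV: "Q x0 V Z = b x0 V Z" for Z using G0[OF b(2)] V by (simp add: Q_def)
  have Qdiff: "(\<lambda>x. Q x u w) differentiable (at x0)" for u w using dQ by (auto simp: differentiable_def)
  have "frechet_derivative (\<lambda>x. Q x X X) (at x0) V
      + frechet_derivative (\<lambda>x. Q x V X) (at x0) X + frechet_derivative (\<lambda>x. Q x X V) (at x0) X
      - 2 * frechet_derivative (\<lambda>x. b x X V) (at x0) X + frechet_derivative (\<lambda>x. b x X X) (at x0) V = 0"
  proof (rule clairaut_second_order[where Q=Q, OF b Qbil Qdiff Qsym \<phi> _ X(1) QX False QV])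
    fix x :: "real \<Rightarrow> 'e" and d :: real
    assume "0 < d" "coord_geodesic b S {-d<..<d} x" "x 0 = x0" "vector_derivative x (at 0) \<noteq> 0"
    from clairaut[OF this]
    show "\<exists>C. \<forall>\<^sub>F t in nhds 0. \<phi> (x t) * Q (x t) (vector_derivative x (at t)) (vector_derivative x (at t)) =
         C * b (x t) (vector_derivative x (at t)) (vector_derivative x (at t))"
      by (simp add: Q_def)
  qed
  moreover have min: "frechet_derivative (\<lambda>x. Q x X X) (at x0) V = 0"
  proof -
    have "\<forall>y\<in>S. Q x0 X X \<le> Q y X X" using le QX by (auto simp: Q_def)
    from differential_zero_maxmin[OF b(2) cm(1) dQ disjI2[OF this]]
    show ?thesis unfolding q by metis
  qed
  \<comment> \<open>As \<open>dF V = 0\<close>, every term vanishes except those pairing the mixed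
    second derivative of \<open>F\<close> along \<open>X\<close> and \<open>V\<close> with
    \<open>dF X\<close>. This pairing occurs twice in \<open>dG V X X\<close> and once in each of
    the others.\<close>
  moreover have "dG V X X = 2 * dG X X V" "dG X V X = dG X X V"
  proof -
    have s: "?D2 X V = ?D2 V X" using symmetric_second_frechet[OF cm(1) F(1) b(2)] .
    note bl = coord_metricD(2,3)[OF b' Fx[OF b(2)]]
    have z: "frechet_derivative (\<lambda>y. b' y u 0) (at (F x0)) h = 0" "frechet_derivative (\<lambda>y. b' y 0 u) (at (F x0)) h = 0" for u h
      using bilinear_rzero bilinear_lzero coord_metric_frechet(2)[OF b' Fx[OF b(2)], of h] by blast+
    have l0: "frechet_derivative (\<lambda>y. b' y u w) (at (F x0)) 0 = 0" for u w
      by (rule linear_0[OF coord_metric_frechet(1)[OF b' Fx[OF b(2)]]])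
    show "dG V X X = 2 * dG X X V" "dG X V X = dG X X V"
      using bl(2)[of "?D2 V X" "?DF x0 X"]
      by (simp_all add: dG_def V z l0 s bilinear_rzero[OF bl(1)] bilinear_lzero[OF bl(1)])
  qed
  moreover have "?d X V X = ?d X X V"
  proof -
    have "((\<lambda>x. b x X V) has_derivative frechet_derivative (\<lambda>x. b x V X) (at x0)) (at x0)"
      by (rule has_derivative_transform_within_open[OF iffD1[OF frechet_derivative_works cm(6)[OF b(2)]] cm(1) b(2)])
        (rule cm(3))
    from frechet_derivative_at[OF this] show ?thesis by simp
  qed
  moreover have "G x0 X V = 0" "G x0 V X = 0" using G0[OF b(2)] V by auto
  ultimately have "?dm V * G x0 X X = 0" unfolding q by (simp add: algebra_simps)
  moreover have "\<mu> x0 * G x0 X X > 0" using X cm(4)[OF b(2)] by simp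
  ultimately show ?thesis by auto
qed

section \<open>Manifolds and charts\<close>

lemma smooth_atlasD:
  assumes "smooth_atlas A" "c \<in> A"
  shows "open (fst c)" "open (snd c ` fst c)" "continuous_on (fst c) (snd c)"
    "continuous_on (snd c ` fst c) (chart_inv c)"
    "\<And>p. p \<in> fst c \<Longrightarrow> chart_inv c (snd c p) = p"
  using assms unfolding smooth_atlas_def homeomorphism_def by blast+

lemma chart_inv_image:
  assumes "smooth_atlas A" "c \<in> A" "x \<in> snd c ` (fst c \<inter> W)"
  shows "chart_inv c x \<in> fst c" "chart_inv c x \<in> W" "snd c (chart_inv c x) = x"
  using assms smooth_atlasD(5)[OF assms(1,2)] by auto

lemma open_chart_image:
  assumes "smooth_atlas A" "c \<in> A" "open W"
  shows "open (snd c ` (fst c \<inter> W))"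
proof -
  have "snd c ` (fst c \<inter> W) = snd c ` fst c \<inter> chart_inv c -` W"
    using smooth_atlasD(5)[OF assms(1,2)] by force
  then show ?thesis
    using continuous_open_preimage[OF smooth_atlasD(4,2)[OF assms(1,2)] assms(3)] by simp
qed

lemma charts_at_nonempty: "smooth_atlas A \<Longrightarrow> \<exists>c. c \<in> charts_at A p"
  unfolding smooth_atlas_def charts_at_def by blast

section \<open>Transition maps and tangent vectors\<close>

abbreviation transition_deriv :: "('a, 'e::euclidean_space) chart \<Rightarrow> ('a, 'e) chart \<Rightarrow> 'a \<Rightarrow> 'e \<Rightarrow> 'e" where
  "transition_deriv c d p \<equiv> frechet_derivative (snd d \<circ> chart_inv c) (at (snd c p))"

lemma transition_smooth:
  "smooth_atlas A \<Longrightarrow> c \<in> A \<Longrightarrow> d \<in> A \<Longrightarrow> smooth_on (snd c ` (fst c \<inter> fst d)) (snd d \<circ> chart_inv c)"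
  unfolding smooth_atlas_def by blast

lemma transition_has_derivative:
  assumes "smooth_atlas A" "c \<in> charts_at A p" "d \<in> charts_at A p"
  shows "((snd d \<circ> chart_inv c) has_derivative transition_deriv c d p) (at (snd c p))"
  using assms by (intro smooth_on_has_derivative[OF transition_smooth[OF assms(1)]]) (auto simp: charts_at_def)

lemma linear_transition_deriv:
  assumes "smooth_atlas A" "c \<in> charts_at A p" "d \<in> charts_at A p"
  shows "linear (transition_deriv c d p)"
  using transition_has_derivative[OF assms] has_derivative_linear by blast

lemma transition_deriv_self:
  assumes "smooth_atlas A" "c \<in> charts_at A p"
  shows "transition_deriv c c p u = u"
proof -
  have c: "c \<in> A" "p \<in> fst c" using assms by (auto simp: charts_at_def)
  have "((snd c \<circ> chart_inv c) has_derivative (\<lambda>u. u)) (at (snd c p))"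
    by (rule has_derivative_transform_within_open[OF has_derivative_ident smooth_atlasD(2)[OF assms(1) c(1)]])
      (use c smooth_atlasD(5)[OF assms(1) c(1)] in auto)
  from frechet_derivative_at[OF this] show ?thesis by metis
qed

lemma transition_deriv_compose:
  assumes "smooth_atlas A" "c \<in> charts_at A p" "d \<in> charts_at A p" "e \<in> charts_at A p"
  shows "transition_deriv d e p (transition_deriv c d p u) = transition_deriv c e p u"
proof -
  have c: "c \<in> A" "p \<in> fst c" and d: "d \<in> A" "p \<in> fst d" using assms by (auto simp: charts_at_def)
  have "((\<lambda>x. (snd e \<circ> chart_inv d) ((snd d \<circ> chart_inv c) x)) has_derivative
     (\<lambda>u. transition_deriv d e p (transition_deriv c d p u))) (at (snd c p))"
    using has_derivative_compose[OF transition_has_derivative[OF assms(1,2,3)], of "snd e \<circ> chart_inv d"]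
      transition_has_derivative[OF assms(1,3,4)] smooth_atlasD(5)[OF assms(1) c(1) c(2)] by simp
  then have "((snd e \<circ> chart_inv c) has_derivative
     (\<lambda>u. transition_deriv d e p (transition_deriv c d p u))) (at (snd c p))"
    by (rule has_derivative_transform_within_open[OF _ open_chart_image[OF assms(1) c(1) smooth_atlasD(1)[OF assms(1) d(1)]]])
     (use c d chart_inv_image[OF assms(1) c(1)] smooth_atlasD(5)[OF assms(1) d(1)] in auto)
  from frechet_derivative_at[OF this] show ?thesis by metis
qed

lemma coord_vec_in_tangent_space:
  assumes "smooth_atlas A" "c \<in> charts_at A p"
  shows "coord_vec A p c u \<in> tangent_space A p"
  using transition_deriv_compose[OF assms(1,2)] by (auto simp: tangent_space_def coord_vec_def)

lemma coord_vec_same: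
  "smooth_atlas A \<Longrightarrow> c \<in> charts_at A p \<Longrightarrow> coord_vec A p c u c = u"
  by (simp add: coord_vec_def transition_deriv_self)

lemma coord_vec_tangent:
  assumes "v \<in> tangent_space A p" "c \<in> charts_at A p"
  shows "coord_vec A p c (v c) = v"
proof
  fix d
  show "coord_vec A p c (v c) d = v d"
  proof (cases "d \<in> charts_at A p")
    case True
    then have "v d = transition_deriv c d p (v c)" using assms unfolding tangent_space_def by blast
    then show ?thesis using True by (simp add: coord_vec_def)
  next
    case False
    then have "v d = 0" using assms unfolding tangent_space_def by blast
    then show ?thesis using False by (simp add: coord_vec_def)
  qed
qed

lemma coord_vec_linear:
  assumes "smooth_atlas A" "c \<in> charts_at A p"
  shows "coord_vec A p c (r *\<^sub>R u + s *\<^sub>R w) = (\<lambda>d. r *\<^sub>R coord_vec A p c u d + s *\<^sub>R coord_vec A p c w d)"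
  using linear_transition_deriv[OF assms]
  by (auto simp: coord_vec_def fun_eq_iff linear_add linear_scale)

lemma coord_vec_0:
  assumes "smooth_atlas A" "c \<in> charts_at A p"
  shows "coord_vec A p c u = (\<lambda>d. 0) \<longleftrightarrow> u = 0"
proof
  assume "coord_vec A p c u = (\<lambda>d. 0)"
  then show "u = 0" using coord_vec_same[OF assms, of u] by simp
qed (use linear_transition_deriv[OF assms] in \<open>auto simp: coord_vec_def fun_eq_iff linear_0\<close>)

section \<open>Metric, Christoffel symbols and geodesics in charts\<close>

lemma metric_coord_at:
  assumes "smooth_atlas A" "c \<in> charts_at A p" "u \<in> tangent_space A p" "v \<in> tangent_space A p"
  shows "metric_coord A g c (snd c p) (u c) (v c) = g p u v"
proof -
  have "chart_inv c (snd c p) = p"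
    using assms(2) smooth_atlasD(5)[OF assms(1)] by (auto simp: charts_at_def)
  then show ?thesis
    using coord_vec_tangent[OF assms(3,2)] coord_vec_tangent[OF assms(4,2)]
    by (simp add: metric_coord_def)
qed

lemma coord_metric_metric_coord:
  assumes "riemannian_manifold A g" "c \<in> A"
  shows "coord_metric (snd c ` fst c) (metric_coord A g c)"
  unfolding coord_metric_def
proof (intro conjI ballI allI impI)
  have A: "smooth_atlas A" and g: "riemannian_metric A g" using assms(1) by (auto simp: riemannian_manifold_def)
  show "open (snd c ` fst c)" using smooth_atlasD(2)[OF A assms(2)] .
  show "smooth_on (snd c ` fst c) (\<lambda>x. metric_coord A g c x u w)" for u w
    using g assms(2) by (auto simp: riemannian_metric_def)
  fix x assume "x \<in> snd c ` fst c"
  then obtain p where p: "p \<in> fst c" "x = snd c p" by blast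
  have c: "c \<in> charts_at A p" using p assms(2) by (simp add: charts_at_def)
  have m: "metric_coord A g c x u w = g p (coord_vec A p c u) (coord_vec A p c w)" for u w
    using p smooth_atlasD(5)[OF A assms(2)] by (simp add: metric_coord_def)
  note T = coord_vec_in_tangent_space[OF A c]
  show sym: "metric_coord A g c x u w = metric_coord A g c x w u" for u w
    unfolding m using g T by (simp add: riemannian_metric_def)
  have lin: "metric_coord A g c x (r *\<^sub>R u + s *\<^sub>R v) w = r * metric_coord A g c x u w + s * metric_coord A g c x v w" for r s u v w
    unfolding m coord_vec_linear[OF A c] using g T by (simp add: riemannian_metric_def)
  have linl: "linear (\<lambda>u. metric_coord A g c x u w)" for w
    using lin[of 1 _ 1] lin[of _ _ 0 0] by (intro linearI) auto
  have comm: "metric_coord A g c x u = (\<lambda>w. metric_coord A g c x w u)" for u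
    by (rule ext) (rule sym)
  have "linear (metric_coord A g c x u)" for u by (subst comm) (rule linl)
  with linl show "bilinear (metric_coord A g c x)"
    by (simp add: bilinear_def)
  show "0 < metric_coord A g c x u u" if "u \<noteq> 0" for u
    using g T that coord_vec_0[OF A c] by (simp add: m riemannian_metric_def)
qed

text \<open>Positive definiteness makes the defining equation uniquely solvable, so the definite
  description in \<open>christoffel\<close> really denotes a solution.\<close>

lemma christoffel_lower:
  assumes "riemannian_manifold A g" "c \<in> A" "x \<in> snd c ` fst c"
  shows "metric_coord A g c x (christoffel A g c x v v) w = lower_christoffel (metric_coord A g c) x v w"
proof -
  let ?b = "metric_coord A g c"
  note cm = coord_metric_metric_coord[OF assms(1,2)]
  note r = riesz_gram[OF coord_metricD(2,4)[OF cm assms(3)] linear_lower_christoffel[OF cm assms(3), where v=v]]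
  have "christoffel A g c x v v = (THE z. \<forall>w. ?b x z w = lower_christoffel ?b x v w)"
    unfolding christoffel_def lower_christoffel_def by (simp add: field_simps)
  also have "\<dots> = inv (gram (?b x)) (\<Sum>i\<in>Basis. lower_christoffel ?b x v i *\<^sub>R i)"
    by (rule the_equality) (simp add: r(1), rule iffD1[OF r(2)])
  finally show ?thesis using r(1) by simp
qed

lemma coord_metric_subset:
  "coord_metric S b \<Longrightarrow> open S' \<Longrightarrow> S' \<subseteq> S \<Longrightarrow> coord_metric S' b"
  unfolding coord_metric_def using smooth_on_subset by blast

lemma metric_coord_transition:
  assumes "riemannian_manifold A g" "c \<in> A" "d \<in> A" "x \<in> snd c ` (fst c \<inter> fst d)"
  shows "metric_coord A g c x u w = metric_coord A g d ((snd d \<circ> chart_inv c) x)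
     (frechet_derivative (snd d \<circ> chart_inv c) (at x) u) (frechet_derivative (snd d \<circ> chart_inv c) (at x) w)"
proof -
  have A: "smooth_atlas A" using assms(1) by (simp add: riemannian_manifold_def)
  define p where "p = chart_inv c x"
  have p: "p \<in> fst c" "p \<in> fst d" "snd c p = x" using chart_inv_image[OF A assms(2,4)] by (auto simp: p_def)
  have cd: "c \<in> charts_at A p" "d \<in> charts_at A p" using p assms by (auto simp: charts_at_def)
  have e: "coord_vec A p c u d = frechet_derivative (snd d \<circ> chart_inv c) (at x) u" for u
    using cd p by (simp add: coord_vec_def)
  have "metric_coord A g c x u w = g p (coord_vec A p c u) (coord_vec A p c w)"
    by (simp add: metric_coord_def p_def Let_def)
  also have "\<dots> = metric_coord A g d (snd d p) (coord_vec A p c u d) (coord_vec A p c w d)"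
    by (rule metric_coord_at[OF A cd(2) coord_vec_in_tangent_space[OF A cd(1)] coord_vec_in_tangent_space[OF A cd(1)], symmetric])
  finally show ?thesis unfolding e by (simp add: p_def)
qed

text \<open>The curve is built in the single chart \<open>c\<close>, whereas \<open>geodesic\<close>
  demands the equation in each chart around each of its points. The transformation law settles this
  for the lowered equation, and nondegeneracy of the metric raises the index again.\<close>

lemma geodesic_of_coord_geodesic:
  fixes A :: "('a::{t2_space,second_countable_topology}, 'e::euclidean_space) chart set"
  assumes M: "riemannian_manifold A g" "c \<in> A" and S: "S \<subseteq> snd c ` fst c"
    and I: "open I" "is_interval I" and x: "coord_geodesic (metric_coord A g c) S I x"
  shows "geodesic A g I (chart_inv c \<circ> x)"
proof -
  have A: "smooth_atlas A" using M(1) by (simp add: riemannian_manifold_def)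
  let ?\<alpha> = "chart_inv c \<circ> x"
  have xS: "x t \<in> snd c ` fst c" if "t \<in> I" for t using x S that by (auto simp: coord_geodesic_def)
  have sx: "smooth_on I x" using x by (simp add: coord_geodesic_def)
  have cont: "continuous_on I ?\<alpha>"
    using continuous_on_compose2[OF smooth_atlasD(4)[OF A M(2)] smooth_on_continuous[OF sx]] xS by (auto simp: comp_def)
  have op: "open (I \<inter> ?\<alpha> -` fst e)" if "e \<in> A" for e
    using continuous_open_preimage[OF cont I(1) smooth_atlasD(1)[OF A that]] .
  have im: "x ` (I \<inter> ?\<alpha> -` fst e) \<subseteq> snd c ` (fst c \<inter> fst e)" for e :: "('a, 'e) chart"
  proof
    fix y assume "y \<in> x ` (I \<inter> ?\<alpha> -` fst e)"
    then obtain t where t: "y = x t" "t \<in> I" "chart_inv c (x t) \<in> fst e" by auto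
    obtain p where p: "p \<in> fst c" "x t = snd c p" using xS[OF t(2)] by auto
    then show "y \<in> snd c ` (fst c \<inter> fst e)" using t smooth_atlasD(5)[OF A M(2)] by auto
  qed
  have sub: "smooth_on (I \<inter> ?\<alpha> -` fst e) x" for e :: "('a, 'e) chart"
    by (rule smooth_on_subset[OF _ sx]) simp
  have "smooth_on (I \<inter> ?\<alpha> -` fst e) (snd e \<circ> ?\<alpha>)" if "e \<in> A" for e
    using smooth_on_compose[OF op[OF that] open_chart_image[OF A M(2) smooth_atlasD(1)[OF A that]] im
        transition_smooth[OF A M(2) that] sub] by (simp add: comp_def)
  then have "smooth_curve A I ?\<alpha>" using cont by (simp add: smooth_curve_def)
  moreover have "vector_derivative (\<lambda>s. vector_derivative (snd e \<circ> ?\<alpha>) (at s)) (at t)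
        + christoffel A g e (snd e (?\<alpha> t)) (vector_derivative (snd e \<circ> ?\<alpha>) (at t)) (vector_derivative (snd e \<circ> ?\<alpha>) (at t)) = 0"
    if t: "t \<in> I" and e: "e \<in> charts_at A (?\<alpha> t)" for t e
  proof -
    have eA: "e \<in> A" "?\<alpha> t \<in> fst e" using e by (auto simp: charts_at_def)
    let ?\<tau> = "snd e \<circ> chart_inv c" and ?S = "snd c ` (fst c \<inter> fst e)" and ?I = "I \<inter> ?\<alpha> -` fst e"
    let ?b = "metric_coord A g c" and ?b' = "metric_coord A g e"
    define v a where "v = vector_derivative (snd e \<circ> ?\<alpha>) (at t)"
      and "a = vector_derivative (\<lambda>s. vector_derivative (snd e \<circ> ?\<alpha>) (at s)) (at t)"
    have tI: "t \<in> ?I" using t eA by auto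
    have xt: "x t \<in> ?S" using im tI by blast
    note cm = coord_metric_metric_coord[OF M] and cm' = coord_metric_metric_coord[OF M(1) eA(1)]
    have comp: "snd e \<circ> ?\<alpha> = (\<lambda>r. ?\<tau> (x r))" by (simp add: comp_def)
    have y: "snd e (?\<alpha> t) \<in> snd e ` fst e" using eA by auto
    have \<tau>S: "?\<tau> ` ?S \<subseteq> snd e ` fst e" using chart_inv_image[OF A M(2)] by auto
    have eq: "?b' (snd e (?\<alpha> t)) a (frechet_derivative ?\<tau> (at (x t)) w)
       + lower_christoffel ?b' (snd e (?\<alpha> t)) v (frechet_derivative ?\<tau> (at (x t)) w) = 0" for w
    proof -
      have "?b' (?\<tau> (x t)) (vector_derivative (\<lambda>s. vector_derivative (\<lambda>r. ?\<tau> (x r)) (at s)) (at t)) (frechet_derivative ?\<tau> (at (x t)) w)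
      + lower_christoffel ?b' (?\<tau> (x t)) (vector_derivative (\<lambda>r. ?\<tau> (x r)) (at t)) (frechet_derivative ?\<tau> (at (x t)) w)
      = ?b (x t) (vector_derivative (\<lambda>s. vector_derivative x (at s)) (at t)) w
      + lower_christoffel ?b (x t) (vector_derivative x (at t)) w"
        by (rule coord_geodesic_equation_transform[OF
            coord_metric_subset[OF cm open_chart_image[OF A M(2) smooth_atlasD(1)[OF A eA(1)]]] cm'
            transition_smooth[OF A M(2) eA(1)] \<tau>S metric_coord_transition[OF M eA(1)] op[OF eA(1)] tI sub im]) auto
      also have "\<dots> = 0" using x t by (simp add: coord_geodesic_def)
      finally show ?thesis by (simp add: v_def a_def comp_def)
    qed
    \<comment> \<open>The transformed equation is tested only against images under the derivative of
      the transition map. This derivative is invertible, so these are all vectors.\<close>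
    have surj: "\<exists>w. frechet_derivative ?\<tau> (at (x t)) w = z" for z
    proof -
      define p where "p = ?\<alpha> t"
      have p: "c \<in> charts_at A p" "e \<in> charts_at A p" "snd c p = x t"
        using chart_inv_image[OF A M(2) xt] e M(2) by (auto simp: p_def charts_at_def)
      show ?thesis
        using transition_deriv_compose[OF A p(2,1,2), of z] transition_deriv_self[OF A p(2), of z] p(3) by metis
    qed
    have b': "bilinear (?b' (snd e (?\<alpha> t)))" using coord_metricD(2)[OF cm' y] .
    have "?b' (snd e (?\<alpha> t)) (a + christoffel A g e (snd e (?\<alpha> t)) v v) w = 0" for w
      using surj[of w] eq christoffel_lower[OF M(1) eA(1) y] by (metis bilinear_ladd[OF b'])
    then have "a + christoffel A g e (snd e (?\<alpha> t)) v v = 0"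
      using coord_metricD(4)[OF cm' y] by (metis less_irrefl)
    then show ?thesis by (simp add: v_def a_def)
  qed
  ultimately show ?thesis using I by (simp add: geodesic_def)
qed

text \<open>\<open>differential\<close> evaluates in a chart obtained by \<open>SOME\<close>; the
  chain rule for the transition map trades it for any chart at hand.\<close>

lemma differential_coord:
  assumes A: "smooth_atlas A" and F: "smooth_map A B F" and B: "smooth_atlas B"
    and v: "v \<in> tangent_space A p" and c: "c \<in> charts_at A p" and d: "d \<in> charts_at B (F p)"
  shows "differential A B F p v d = frechet_derivative (snd d \<circ> F \<circ> chart_inv c) (at (snd c p)) (v c)"
proof -
  define e where "e = (SOME c. c \<in> charts_at A p)"
  have e: "e \<in> charts_at A p" unfolding e_def using c by (rule someI)
  have cA: "c \<in> A" "p \<in> fst c" and eA: "e \<in> A" "p \<in> fst e" and dB: "d \<in> B" "F p \<in> fst d"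
    using c d e by (auto simp: charts_at_def)
  have sm: "smooth_on (snd c ` (fst c \<inter> F -` fst d)) (snd d \<circ> F \<circ> chart_inv c)"
    using F cA dB by (simp add: smooth_map_def)
  have "((\<lambda>x. (snd d \<circ> F \<circ> chart_inv c) ((snd c \<circ> chart_inv e) x)) has_derivative
    (\<lambda>u. frechet_derivative (snd d \<circ> F \<circ> chart_inv c) (at (snd c p)) (transition_deriv e c p u))) (at (snd e p))"
    using has_derivative_compose[OF transition_has_derivative[OF A e c], of "snd d \<circ> F \<circ> chart_inv c"]
      smooth_on_has_derivative[OF sm, of "snd c p"] cA dB smooth_atlasD(5)[OF A eA] by simp
  then have "((snd d \<circ> F \<circ> chart_inv e) has_derivative
    (\<lambda>u. frechet_derivative (snd d \<circ> F \<circ> chart_inv c) (at (snd c p)) (transition_deriv e c p u))) (at (snd e p))"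
    by (rule has_derivative_transform_within_open[OF _ open_chart_image[OF A eA(1) smooth_atlasD(1)[OF A cA(1)]]])
      (use cA eA chart_inv_image[OF A eA(1)] smooth_atlasD(5)[OF A cA(1)] in auto)
  from frechet_derivative_at[OF this]
  have "frechet_derivative (snd d \<circ> F \<circ> chart_inv e) (at (snd e p)) (v e) =
    frechet_derivative (snd d \<circ> F \<circ> chart_inv c) (at (snd c p)) (transition_deriv e c p (v e))" by metis
  moreover have "v c = transition_deriv e c p (v e)" using v c e unfolding tangent_space_def by blast
  ultimately show ?thesis using d by (simp add: differential_def e_def[symmetric])
qed

lemma velocity_in_tangent_space:
  assumes A: "smooth_atlas A" and \<alpha>: "smooth_curve A I \<alpha>" "open I" "t \<in> I"
  shows "velocity A \<alpha> t \<in> tangent_space A (\<alpha> t)"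
proof -
  have "vector_derivative (snd d \<circ> \<alpha>) (at t) = transition_deriv c d (\<alpha> t) (vector_derivative (snd c \<circ> \<alpha>) (at t))"
    if c: "c \<in> charts_at A (\<alpha> t)" and d: "d \<in> charts_at A (\<alpha> t)" for c d
  proof -
    have cA: "c \<in> A" "\<alpha> t \<in> fst c" using c by (auto simp: charts_at_def)
    let ?I = "I \<inter> \<alpha> -` fst c"
    have op: "open ?I"
      using \<alpha> continuous_open_preimage[OF _ \<alpha>(2) smooth_atlasD(1)[OF A cA(1)]] by (simp add: smooth_curve_def)
    have t: "t \<in> ?I" using cA \<alpha> by simp
    have sm: "smooth_on ?I (snd c \<circ> \<alpha>)" using \<alpha>(1) cA by (simp add: smooth_curve_def)
    have "((\<lambda>s. (snd d \<circ> chart_inv c) ((snd c \<circ> \<alpha>) s)) has_derivative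
       (\<lambda>h. transition_deriv c d (\<alpha> t) (h *\<^sub>R vector_derivative (snd c \<circ> \<alpha>) (at t)))) (at t)"
      using has_derivative_compose[OF smooth_on_vector_derivative(2)[OF op sm t, unfolded has_vector_derivative_def]]
        transition_has_derivative[OF A c d] by (simp add: comp_def)
    then have "((snd d \<circ> \<alpha>) has_derivative
       (\<lambda>h. transition_deriv c d (\<alpha> t) (h *\<^sub>R vector_derivative (snd c \<circ> \<alpha>) (at t)))) (at t)"
      by (rule has_derivative_transform_within_open[OF _ op t]) (use smooth_atlasD(5)[OF A cA(1)] in auto)
    then show ?thesis
      by (intro vector_derivative_at)
       (simp add: has_vector_derivative_def linear_scale[OF linear_transition_deriv[OF A c d]])
  qed
  note * = this
  show ?thesis
    unfolding tangent_space_def velocity_def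
  proof (intro CollectI conjI ballI allI impI)
    fix c d assume "c \<in> charts_at A (\<alpha> t)" "d \<in> charts_at A (\<alpha> t)"
    then show "(if d \<in> charts_at A (\<alpha> t) then vector_derivative (snd d \<circ> \<alpha>) (at t) else 0) =
      transition_deriv c d (\<alpha> t)
        (if c \<in> charts_at A (\<alpha> t) then vector_derivative (snd c \<circ> \<alpha>) (at t) else 0)"
      using *[of c d] by simp
  qed simp
qed

section \<open>Conformal submersions\<close>

text \<open>The map \<open>h\<close> is the adjoint of \<open>L\<close> with respect to
  \<open>b\<close> and the ambient inner product, so its values are orthogonal to the kernel of
  \<open>L\<close>. If \<open>L (h z) = 0\<close>, then \<open>h z\<close> has length zero, so
  \<open>z\<close> is orthogonal to the range of \<open>L\<close> and vanishes. Thus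
  \<open>L\<close> composed with \<open>h\<close> is injective, hence onto.\<close>

lemma horizontal_lift_exists:
  fixes L :: "'e::euclidean_space \<Rightarrow> 'f::euclidean_space" and b :: "'e \<Rightarrow> 'e \<Rightarrow> real"
  assumes b: "bilinear b" "\<And>u. u \<noteq> 0 \<Longrightarrow> 0 < b u u" and L: "linear L" "surj L"
  obtains h where "L h = y" "\<forall>w. L w = 0 \<longrightarrow> b h w = 0"
proof -
  define h where "h = (\<lambda>z. inv (gram b) (\<Sum>i\<in>Basis. (z \<bullet> L i) *\<^sub>R i))"
  have linL: "linear (\<lambda>w. z \<bullet> L w)" for z
    by (intro linearI) (simp_all add: linear_add[OF L(1)] linear_scale[OF L(1)] inner_add_right)
  have h: "b (h z) w = z \<bullet> L w" for z w
    unfolding h_def by (rule riesz_gram(1)[OF b linL])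
  have "linear h"
  proof -
    have "linear (\<lambda>z. \<Sum>i\<in>Basis. (z \<bullet> L i) *\<^sub>R i :: 'e)"
      by (intro linearI) (simp_all add: inner_add_left scaleR_add_left sum.distrib scaleR_sum_right)
    from linear_compose[OF this linear_inv_apply(2)[OF linear_gram[OF b(1)] inj_gram[OF b]]]
    show ?thesis by (simp add: h_def comp_def)
  qed
  then have lin: "linear (\<lambda>z. L (h z))" using linear_compose[OF _ L(1), of h] by (simp add: comp_def)
  have "z = 0" if "L (h z) = 0" for z
  proof -
    have "h z = 0" using h[of z "h z"] that b(2)[of "h z"] by auto
    then have "z \<bullet> L w = 0" for w using h[of z w] bilinear_lzero[OF b(1)] by simp
    then have "z \<bullet> z = 0" using L(2) by (metis surjD)
    then show ?thesis by simp
  qed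
  then have "inj (\<lambda>z. L (h z))" by (simp add: linear_injective_0[OF lin])
  then have "surj (\<lambda>z. L (h z))" using linear_injective_imp_surjective[OF lin] by blast
  then obtain z where "L (h z) = y" by (metis surjD)
  then show thesis using that[of "h z"] h by simp
qed

text \<open>Conformality is given for pairs of horizontal vectors. One of them may be arbitrary,
  since changing it by a vertical vector affects neither side. The inequality is Pythagoras: the
  horizontal part is no longer than the vector; it yields the nonnegativity of
  \<open>Q\<close>.\<close>

lemma conformal_on_horizontal:
  fixes L :: "'e::euclidean_space \<Rightarrow> 'f::euclidean_space" and b :: "'e \<Rightarrow> 'e \<Rightarrow> real"
    and b' :: "'f \<Rightarrow> 'f \<Rightarrow> real" and l :: real
  assumes b: "bilinear b" "\<And>u. u \<noteq> 0 \<Longrightarrow> 0 < b u u" "\<And>u w. b u w = b w u" and L: "linear L" "surj L"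
    and conf: "\<And>h k. (\<forall>w. L w = 0 \<longrightarrow> b h w = 0) \<Longrightarrow> (\<forall>w. L w = 0 \<longrightarrow> b k w = 0) \<Longrightarrow>
      b' (L h) (L k) = l * b h k" and "0 < l"
  shows "(\<forall>w. L w = 0 \<longrightarrow> b X w = 0) \<Longrightarrow> b' (L X) (L Z) = l * b X Z"
    and "b' (L u) (L u) \<le> l * b u u"
proof -
  show "b' (L X) (L Z) = l * b X Z" if X: "\<forall>w. L w = 0 \<longrightarrow> b X w = 0"
  proof -
    obtain h where h: "L h = L Z" "\<forall>w. L w = 0 \<longrightarrow> b h w = 0"
      using horizontal_lift_exists[OF b(1,2) L] by blast
    have "b X (Z - h) = 0" using X h(1) by (simp add: linear_diff[OF L(1)])
    then have "b X Z = b X h" using bilinear_rsub[OF b(1)] by simp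
    then show ?thesis using conf[OF X h(2)] h(1) by simp
  qed
  obtain h where h: "L h = L u" "\<forall>w. L w = 0 \<longrightarrow> b h w = 0"
    using horizontal_lift_exists[OF b(1,2) L] by blast
  have z: "b h (u - h) = 0" using h by (simp add: linear_diff[OF L(1)])
  have "b u u = b (h + (u - h)) (h + (u - h))" by simp
  also have "\<dots> = b h h + b (u - h) (u - h)"
    unfolding bilinear_ladd[OF b(1)] bilinear_radd[OF b(1)] using z b(3)[of h "u - h"] by simp
  also have "\<dots> \<ge> b h h"
    using b(2)[of "u - h"] bilinear_lzero[OF b(1)] by (cases "u - h = 0") (auto simp: less_imp_le)
  finally have "l * b h h \<le> l * b u u" using \<open>0 < l\<close> by simp
  then show "b' (L u) (L u) \<le> l * b u u" using conf[OF h(2,2)] h(1) by simp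
qed

lemma smooth_fun_chart: "smooth_fun A h \<Longrightarrow> c \<in> A \<Longrightarrow> smooth_on (snd c ` fst c) (\<lambda>x. h (chart_inv c x))"
  by (simp add: smooth_fun_def comp_def)

abbreviation coord_map :: "('a, 'e) chart \<Rightarrow> ('b, 'f) chart \<Rightarrow> ('a \<Rightarrow> 'b) \<Rightarrow> 'e \<Rightarrow> 'f" where
  "coord_map c d F \<equiv> snd d \<circ> F \<circ> chart_inv c"

lemma conformal_submersionD:
  assumes "conformal_submersion A g B g' F lam"
  shows "riemannian_manifold A g" "riemannian_manifold B g'" "smooth_atlas A" "smooth_atlas B"
    "smooth_map A B F" "smooth_fun A lam" "\<And>p. 0 < lam p"
    "\<And>p. differential A B F p ` tangent_space A p = tangent_space B (F p)"
  using assms by (auto simp: conformal_submersion_def submersion_def riemannian_manifold_def)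

section \<open>A conformal submersion at one point, in a pair of charts\<close>

context
  fixes A :: "('a::{t2_space,second_countable_topology}, 'e::euclidean_space) chart set"
    and g :: "('a, 'e) metric"
    and B :: "('b::{t2_space,second_countable_topology}, 'f::euclidean_space) chart set"
    and g' :: "('b, 'f) metric" and F :: "'a \<Rightarrow> 'b" and lam :: "'a \<Rightarrow> real"
    and p :: 'a and c :: "('a, 'e) chart" and d :: "('b, 'f) chart"
    and L :: "'e \<Rightarrow> 'f" and b :: "'e \<Rightarrow> 'e \<Rightarrow> real" and b' :: "'f \<Rightarrow> 'f \<Rightarrow> real"
  assumes conf: "conformal_submersion A g B g' F lam"
    and c: "c \<in> charts_at A p" and d: "d \<in> charts_at B (F p)"
  defines "L \<equiv> frechet_derivative (coord_map c d F) (at (snd c p))"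
    and "b \<equiv> metric_coord A g c (snd c p)" and "b' \<equiv> metric_coord B g' d (snd d (F p))"
begin

lemma coord_map_smooth_at: "smooth_on (snd c ` (fst c \<inter> F -` fst d)) (coord_map c d F)"
    "snd c p \<in> snd c ` (fst c \<inter> F -` fst d)"
  using conformal_submersionD(5)[OF conf] c d by (auto simp: smooth_map_def charts_at_def)

lemma coord_differential_linear: "linear L"
  unfolding L_def using coord_map_smooth_at by (intro linear_frechet_derivative smooth_on_differentiable)

lemma differential_in_tangent_space: "v \<in> tangent_space A p \<Longrightarrow> differential A B F p v \<in> tangent_space B (F p)"
  using conformal_submersionD(8)[OF conf] by blast

lemma coord_differential: "v \<in> tangent_space A p \<Longrightarrow> differential A B F p v d = L (v c)"
  unfolding L_def using differential_coord conformal_submersionD(3,4,5)[OF conf] c d by blast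

lemma coord_differential_surj: "surj L"
proof -
  have "\<exists>u. L u = y" for y
  proof -
    have "coord_vec B (F p) d y \<in> differential A B F p ` tangent_space A p"
      using coord_vec_in_tangent_space[OF conformal_submersionD(4)[OF conf] d] conformal_submersionD(8)[OF conf] by blast
    then obtain v where "v \<in> tangent_space A p" "differential A B F p v = coord_vec B (F p) d y" by auto
    then show ?thesis
      using coord_differential coord_vec_same[OF conformal_submersionD(4)[OF conf] d, of y] by metis
  qed
  then show ?thesis by (metis surjI)
qed

lemma coord_inner: "bilinear b" "\<And>u. u \<noteq> 0 \<Longrightarrow> 0 < b u u" "\<And>u w. b u w = b w u"
proof -
  have x: "snd c p \<in> snd c ` fst c" and cA: "c \<in> A" using c by (auto simp: charts_at_def)
  note cm = coord_metric_metric_coord[OF conformal_submersionD(1)[OF conf] cA]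
  show "bilinear b" "\<And>u. u \<noteq> 0 \<Longrightarrow> 0 < b u u" unfolding b_def using coord_metricD(2,4)[OF cm x] by auto
  show "b u w = b w u" for u w unfolding b_def by (rule coord_metricD(3)[OF cm x])
qed

lemma coord_vec_tangent_space: "coord_vec A p c u \<in> tangent_space A p" "coord_vec A p c u c = u"
  using coord_vec_in_tangent_space coord_vec_same conformal_submersionD(3)[OF conf] c by blast+

lemma metric_at: "u \<in> tangent_space A p \<Longrightarrow> v \<in> tangent_space A p \<Longrightarrow> g p u v = b (u c) (v c)"
  unfolding b_def using metric_coord_at[OF conformal_submersionD(3)[OF conf] c] by metis

lemma vertical_space_coord: "v \<in> vertical_space A B F p \<longleftrightarrow> v \<in> tangent_space A p \<and> L (v c) = 0"
proof -
  have "differential A B F p v = (\<lambda>d. 0) \<longleftrightarrow> L (v c) = 0" if v: "v \<in> tangent_space A p"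
  proof
    assume "L (v c) = 0"
    then have "differential A B F p v d = 0" using coord_differential[OF v] by simp
    then show "differential A B F p v = (\<lambda>d. 0)"
      using coord_vec_tangent[OF differential_in_tangent_space[OF v] d]
        coord_vec_0[OF conformal_submersionD(4)[OF conf] d, of 0] by metis
  qed (use coord_differential[OF v] in metis)
  then show ?thesis by (auto simp: vertical_space_def)
qed

lemma horizontal_space_coord:
  "v \<in> horizontal_space A g B F p \<longleftrightarrow> v \<in> tangent_space A p \<and> (\<forall>w. L w = 0 \<longrightarrow> b (v c) w = 0)"
proof
  assume v: "v \<in> horizontal_space A g B F p"
  then have T: "v \<in> tangent_space A p" by (simp add: horizontal_space_def)
  have "b (v c) w = 0" if "L w = 0" for w
  proof -
    have "coord_vec A p c w \<in> vertical_space A B F p"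
      using that by (simp add: vertical_space_coord coord_vec_tangent_space)
    then have "g p v (coord_vec A p c w) = 0" using v by (simp add: horizontal_space_def)
    then show ?thesis using metric_at[OF T coord_vec_tangent_space(1)] by (simp add: coord_vec_tangent_space(2))
  qed
  with T show "v \<in> tangent_space A p \<and> (\<forall>w. L w = 0 \<longrightarrow> b (v c) w = 0)" by simp
qed (auto simp: horizontal_space_def vertical_space_coord metric_at)

lemma coord_conformal:
  assumes "\<forall>w. L w = 0 \<longrightarrow> b h w = 0" "\<forall>w. L w = 0 \<longrightarrow> b k w = 0"
  shows "b' (L h) (L k) = (lam p)\<^sup>2 * b h k"
proof -
  let ?h = "coord_vec A p c h" and ?k = "coord_vec A p c k"
  note T = coord_vec_tangent_space
  have "?h \<in> horizontal_space A g B F p" "?k \<in> horizontal_space A g B F p"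
    using assms by (simp_all add: horizontal_space_coord T)
  then have "g' (F p) (differential A B F p ?h) (differential A B F p ?k) = (lam p)\<^sup>2 * g p ?h ?k"
    using conf by (simp add: conformal_submersion_def)
  also have "g p ?h ?k = b h k" using metric_at[OF T(1) T(1)] by (simp add: T(2))
  also have "g' (F p) (differential A B F p ?h) (differential A B F p ?k) = b' (L h) (L k)"
    using metric_coord_at[OF conformal_submersionD(4)[OF conf] d differential_in_tangent_space[OF T(1)]
        differential_in_tangent_space[OF T(1)], of g' h k] coord_differential[OF T(1)]
    by (simp add: b'_def T(2))
  finally show ?thesis .
qed

lemma lam_sq_pos: "0 < (lam p)\<^sup>2"
  using conformal_submersionD(7)[OF conf, of p] by simp

lemma coord_horizontal_pullback:
  shows "\<forall>w. L w = 0 \<longrightarrow> b X w = 0 \<Longrightarrow> b' (L X) (L Z) = (lam p)\<^sup>2 * b X Z"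
    and "b' (L u) (L u) \<le> (lam p)\<^sup>2 * b u u"
  by (rule conformal_on_horizontal[OF coord_inner coord_differential_linear coord_differential_surj
      coord_conformal lam_sq_pos]; assumption)+

text \<open>\<open>horizontal_part\<close> is a definite description, so unique existence comes
  first. The horizontal lift of \<open>L (v c)\<close> is one candidate; the difference of two
  candidates is both horizontal and vertical and thus has length zero.\<close>

lemma horizontal_part_coord:
  assumes v: "v \<in> tangent_space A p"
  shows "horizontal_part A g B F p v \<in> horizontal_space A g B F p"
    "L (horizontal_part A g B F p v c) = L (v c)"
proof -
  let ?P = "\<lambda>h. h \<in> horizontal_space A g B F p \<and> (\<lambda>c. v c - h c) \<in> vertical_space A B F p"
  have L: "L (v c) = L (h c)" if "?P h" for h
    using that by (simp add: vertical_space_coord linear_diff[OF coord_differential_linear])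
  obtain k where k: "L k = L (v c)" "\<forall>w. L w = 0 \<longrightarrow> b k w = 0"
    using horizontal_lift_exists[OF coord_inner(1,2) coord_differential_linear coord_differential_surj] by blast
  let ?k = "coord_vec A p c k"
  have "(\<lambda>e. v e - ?k e) = coord_vec A p c (v c - k)"
    using coord_vec_linear[OF conformal_submersionD(3)[OF conf] c, of 1 "v c" "-1" k] coord_vec_tangent[OF v c]
    by simp
  then have "(\<lambda>e. v e - ?k e) \<in> vertical_space A B F p"
    using k by (simp add: vertical_space_coord coord_vec_tangent_space linear_diff[OF coord_differential_linear])
  then have P: "?P ?k" using k by (simp add: horizontal_space_coord coord_vec_tangent_space)
  have "\<exists>!h. ?P h"
  proof (rule ex1I[where a="?k"])
    show "?P ?k" by (rule P)
    fix h assume h: "?P h"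
    have T: "h \<in> tangent_space A p" using h by (simp add: horizontal_space_def)
    have "L (h c - k) = 0" using L[OF h] k by (simp add: linear_diff[OF coord_differential_linear])
    then have "b (h c) (h c - k) = 0" "b k (h c - k) = 0" using h k by (auto simp: horizontal_space_coord)
    then have "b (h c - k) (h c - k) = 0" using bilinear_lsub[OF coord_inner(1)] by simp
    then have "h c = k" using coord_inner(2)[of "h c - k"] by auto
    then show "h = ?k" using coord_vec_tangent[OF T c] by simp
  qed
  from theI'[OF this] have "?P (horizontal_part A g B F p v)" by (simp add: horizontal_part_def)
  then show "horizontal_part A g B F p v \<in> horizontal_space A g B F p"
    "L (horizontal_part A g B F p v c) = L (v c)" using L by auto
qed

text \<open>The right-hand side is the squared length of the vertical part, because the horizontal
  part \<open>h\<close> has the same image as \<open>v\<close> and conformality measures it. The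
  factor \<open>b (v c) (v c)\<close> clears the quotient in the angle.\<close>

lemma sin_horizontal_angle:
  assumes v: "v \<in> tangent_space A p"
  shows "b (v c) (v c) * (sin (horizontal_angle A g B F p v))\<^sup>2
    = b (v c) (v c) - inverse ((lam p)\<^sup>2) * b' (L (v c)) (L (v c))"
proof -
  define h where "h = horizontal_part A g B F p v"
  have h: "h \<in> tangent_space A p" "\<forall>w. L w = 0 \<longrightarrow> b (h c) w = 0" "L (h c) = L (v c)"
    using horizontal_part_coord[OF v] by (auto simp: h_def horizontal_space_coord)
  have eq: "b' (L (v c)) (L (v c)) = (lam p)\<^sup>2 * b (h c) (h c)"
    using coord_conformal[OF h(2,2)] h(3) by simp
  have "(lam p)\<^sup>2 * b (h c) (h c) \<le> (lam p)\<^sup>2 * b (v c) (v c)"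
    unfolding eq[symmetric] by (rule coord_horizontal_pullback(2))
  then have le: "b (h c) (h c) \<le> b (v c) (v c)"
    by (rule mult_left_le_imp_le[OF _ lam_sq_pos])
  have nonneg: "0 \<le> b u u" for u
    using coord_inner(2)[of u] bilinear_lzero[OF coord_inner(1)] by (cases "u = 0") (auto simp: less_imp_le)
  show ?thesis
  \<comment> \<open>For the zero vector division by zero makes the angle \<open>arccos 0\<close>,
    and both sides of the claim vanish.\<close>
  proof (cases "v c = 0")
    case True
    then show ?thesis
      using eq le nonneg[of "h c"] bilinear_lzero[OF coord_inner(1)] by simp
  next
    case False
    then have pos: "0 < b (v c) (v c)" by (rule coord_inner(2))
    let ?y = "sqrt (b (h c) (h c)) / sqrt (b (v c) (v c))"
    have "0 \<le> ?y" "?y \<le> 1" using le nonneg[of "h c"] pos by auto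
    then have "cos (arccos ?y) = ?y" by (intro cos_arccos) auto
    then have "(sin (arccos ?y))\<^sup>2 = 1 - ?y\<^sup>2" by (simp add: sin_squared_eq)
    also have "?y\<^sup>2 = b (h c) (h c) / b (v c) (v c)"
      using nonneg[of "h c"] pos by (simp add: power_divide)
    finally have "(sin (horizontal_angle A g B F p v))\<^sup>2 = 1 - b (h c) (h c) / b (v c) (v c)"
      using metric_at[OF h(1) h(1)] metric_at[OF v v] by (simp add: horizontal_angle_def h_def Let_def)
    then show ?thesis using pos lam_sq_pos by (simp add: eq field_simps)
  qed
qed

end

section \<open>Constancy of the dilation along fibres\<close>

lemma conformal_clairaut_dilation_vertical:
  assumes conf: "conformal_submersion A g B g' F lam" and cl: "clairaut A g B F r"
    and cd: "c \<in> A" "d \<in> B" and x0: "x0 \<in> snd c ` (fst c \<inter> F -` fst d)"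
    and V: "frechet_derivative (coord_map c d F) (at x0) V = 0"
  shows "frechet_derivative (\<lambda>x. inverse ((lam (chart_inv c x))\<^sup>2)) (at x0) V = 0"
proof -
  note A = conformal_submersionD(3)[OF conf] and B = conformal_submersionD(4)[OF conf]
  let ?S = "snd c ` (fst c \<inter> F -` fst d)" and ?T = "snd d ` fst d" and ?F = "coord_map c d F"
  let ?b = "metric_coord A g c" and ?b' = "metric_coord B g' d"
  let ?\<mu> = "\<lambda>x. inverse ((lam (chart_inv c x))\<^sup>2)" and ?\<phi> = "\<lambda>x. (r (chart_inv c x))\<^sup>2"
  let ?G = "\<lambda>x u w. ?b' (?F x) (frechet_derivative ?F (at x) u) (frechet_derivative ?F (at x) w)"
  have contF: "continuous_on UNIV F" using conformal_submersionD(5)[OF conf] by (simp add: smooth_map_def)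
  have opS: "open ?S"
    using open_chart_image[OF A cd(1) open_vimage[OF smooth_atlasD(1)[OF B cd(2)] contF]] .
  have SC: "?S \<subseteq> snd c ` fst c" by auto
  have b: "coord_metric ?S ?b"
    by (rule coord_metric_subset[OF coord_metric_metric_coord[OF conformal_submersionD(1)[OF conf] cd(1)] opS SC])
  have b': "coord_metric ?T ?b'" by (rule coord_metric_metric_coord[OF conformal_submersionD(2)[OF conf] cd(2)])
  have F: "smooth_on ?S ?F" using conformal_submersionD(5)[OF conf] cd by (simp add: smooth_map_def)
  have at: "chart_inv c x \<in> fst c" "F (chart_inv c x) \<in> fst d" "snd c (chart_inv c x) = x"
    "c \<in> charts_at A (chart_inv c x)" "d \<in> charts_at B (F (chart_inv c x))" if "x \<in> ?S" for x
    using chart_inv_image[OF A cd(1) that] cd by (auto simp: charts_at_def)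
  have FT: "?F ` ?S \<subseteq> ?T" using at(2) by auto
  have lam: "smooth_on ?S (\<lambda>x. lam (chart_inv c x))"
    using smooth_on_subset[OF SC smooth_fun_chart[OF conformal_submersionD(6)[OF conf] cd(1)]] .
  have pos: "0 < lam p" for p using conformal_submersionD(7)[OF conf] .
  have \<mu>: "smooth_on ?S ?\<mu>"
    unfolding power2_eq_square
    by (intro smooth_on_inverse smooth_on_mult lam opS) (use pos in \<open>simp add: less_imp_neq[symmetric]\<close>)
  have rs: "smooth_on ?S (\<lambda>x. r (chart_inv c x))"
    using cl smooth_on_subset[OF SC smooth_fun_chart[OF _ cd(1)]] by (simp add: clairaut_def)
  have \<phi>: "?\<phi> differentiable (at x0)"
    using smooth_on_differentiable[OF smooth_on_mult[OF opS rs rs] x0] by (simp add: power2_eq_square)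
  have \<phi>0: "?\<phi> x0 \<noteq> 0" using cl by (simp add: clairaut_def less_imp_neq[symmetric])
  have pull: "(\<forall>w. frechet_derivative ?F (at x) w = 0 \<longrightarrow> ?b x X w = 0) \<Longrightarrow> ?G x X Z = (lam (chart_inv c x))\<^sup>2 * ?b x X Z"
    "?G x u u \<le> (lam (chart_inv c x))\<^sup>2 * ?b x u u" if "x \<in> ?S" for x X Z u
    using coord_horizontal_pullback[OF conf at(4,5)[OF that]] at(3)[OF that] by simp_all
  note lin = coord_differential_linear[OF conf at(4,5)[OF x0], unfolded at(3)[OF x0]]
  note surj = coord_differential_surj[OF conf at(4,5)[OF x0], unfolded at(3)[OF x0]]
  \<comment> \<open>The base has positive dimension, so a nonzero vector exists. Its horizontal lift
    serves as \<open>X\<close>.\<close>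
  obtain y :: 'd where y: "y \<noteq> 0" using nonzero_Basis SOME_Basis by blast
  obtain X where X: "frechet_derivative ?F (at x0) X = y" "\<forall>w. frechet_derivative ?F (at x0) w = 0 \<longrightarrow> ?b x0 X w = 0"
    using horizontal_lift_exists[OF coord_metricD(2,4)[OF b x0] lin surj] by blast
  show ?thesis
  proof (rule dilation_vertical_derivative[where \<mu>="?\<mu>" and \<phi>="?\<phi>" and X=X, OF b x0 b' F FT \<mu> _ \<phi> \<phi>0 _ _ _ _ V])
    show "0 < ?\<mu> x0" using pos[of "chart_inv c x0"] by simp
    show "X \<noteq> 0" using X(1) y linear_0[OF lin] by auto
    show "?\<mu> x0 * ?G x0 X Z = ?b x0 X Z" for Z
      using pull(1)[OF x0 X(2), of Z] pos[of "chart_inv c x0"] by simp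
    show "?\<mu> x * ?G x u u \<le> ?b x u u" if "x \<in> ?S" for x u
      using pull(2)[OF that, of u] pos[of "chart_inv c x"] by (simp add: field_simps)
  next
    fix x :: "real \<Rightarrow> 'b" and e :: real
    assume "0 < e" and x: "coord_geodesic ?b ?S {-e<..<e} x"
    let ?I = "{-e<..<e}" and ?\<alpha> = "chart_inv c \<circ> x" and ?v = "\<lambda>t. vector_derivative x (at t)"
    have I: "open ?I" "is_interval ?I" by (auto simp: is_interval_convex_1)
    have geo: "geodesic A g ?I ?\<alpha>"
      by (rule geodesic_of_coord_geodesic[OF conformal_submersionD(1)[OF conf] cd(1) SC I x])
    then obtain k where k: "\<And>t. t \<in> ?I \<Longrightarrow> r (?\<alpha> t) * sin (horizontal_angle A g B F (?\<alpha> t) (velocity A ?\<alpha> t)) = k"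
      using cl unfolding clairaut_def constant_on_def by blast
    \<comment> \<open>The square of the Clairaut relation, multiplied by the squared speed: the
      constant of the hypothesis becomes the square of \<open>k\<close>.\<close>
    have "?\<phi> (x t) * (?b (x t) (?v t) (?v t) - ?\<mu> (x t) * ?G (x t) (?v t) (?v t)) = k\<^sup>2 * ?b (x t) (?v t) (?v t)"
      if t: "t \<in> ?I" for t
    proof -
      have xs: "x s \<in> ?S" if "s \<in> ?I" for s using x that by (simp add: coord_geodesic_def)
      note xt = xs[OF t]
      have "smooth_curve A ?I ?\<alpha>" using geo by (simp add: geodesic_def)
      note T = velocity_in_tangent_space[OF A this I(1) t]
      have "((snd c \<circ> ?\<alpha>) has_vector_derivative ?v t) (at t)"
        by (rule has_vector_derivative_transform_within_open[OF smooth_on_vector_derivative(2)[OF I(1) _ t] I(1) t])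
          (use x at(3)[OF xs] in \<open>auto simp: coord_geodesic_def\<close>)
      then have v: "velocity A ?\<alpha> t c = ?v t"
        using at(4)[OF xt] by (simp add: velocity_def vector_derivative_at)
      have "?b (x t) (?v t) (?v t) * (sin (horizontal_angle A g B F (?\<alpha> t) (velocity A ?\<alpha> t)))\<^sup>2
          = ?b (x t) (?v t) (?v t) - ?\<mu> (x t) * ?G (x t) (?v t) (?v t)"
        using sin_horizontal_angle[OF conf at(4,5)[OF xt], of "velocity A ?\<alpha> t"] T v at(3)[OF xt] by simp
      then have "?\<phi> (x t) * (?b (x t) (?v t) (?v t) - ?\<mu> (x t) * ?G (x t) (?v t) (?v t))
        = (r (?\<alpha> t) * sin (horizontal_angle A g B F (?\<alpha> t) (velocity A ?\<alpha> t)))\<^sup>2 * ?b (x t) (?v t) (?v t)"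
        by (simp add: power_mult_distrib mult.commute)
      then show ?thesis using k[OF t] by simp
    qed
    then show "\<exists>C. \<forall>\<^sub>F t in nhds 0. ?\<phi> (x t) * (?b (x t) (?v t) (?v t) - ?\<mu> (x t) * ?G (x t) (?v t) (?v t))
       = C * ?b (x t) (?v t) (?v t)"
      using \<open>0 < e\<close> by (intro exI[of _ "k\<^sup>2"] eventually_nhds[THEN iffD2] exI[of _ "?I"]) auto
  qed
qed

text \<open>Vertical derivatives vanish on the whole chart domain, not just at \<open>p\<close>, so
  they can be integrated along the fibre.\<close>

lemma conformal_clairaut_dilation_locally_constant:
  assumes conf: "conformal_submersion A g B g' F lam" and cl: "clairaut A g B F r"
  obtains N where "open N" "p \<in> N" "\<And>q. q \<in> N \<Longrightarrow> F q = F p \<Longrightarrow> lam q = lam p"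
proof -
  note A = conformal_submersionD(3)[OF conf] and B = conformal_submersionD(4)[OF conf]
  obtain c d where c: "c \<in> charts_at A p" and d: "d \<in> charts_at B (F p)"
    using charts_at_nonempty[OF A] charts_at_nonempty[OF B] by metis
  then have cA: "c \<in> A" "p \<in> fst c" and dB: "d \<in> B" "F p \<in> fst d" by (auto simp: charts_at_def)
  let ?S = "snd c ` (fst c \<inter> F -` fst d)" and ?F = "coord_map c d F"
  let ?\<mu> = "\<lambda>x. inverse ((lam (chart_inv c x))\<^sup>2)"
  have contF: "continuous_on UNIV F" using conformal_submersionD(5)[OF conf] by (simp add: smooth_map_def)
  have opS: "open ?S"
    using open_chart_image[OF A cA(1) open_vimage[OF smooth_atlasD(1)[OF B dB(1)] contF]] .
  have pos: "0 < lam p" for p using conformal_submersionD(7)[OF conf] .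
  have "smooth_on ?S (\<lambda>x. lam (chart_inv c x))"
    by (rule smooth_on_subset[OF _ smooth_fun_chart[OF conformal_submersionD(6)[OF conf] cA(1)]]) auto
  then have \<mu>: "smooth_on ?S ?\<mu>"
    unfolding power2_eq_square
    by (intro smooth_on_inverse smooth_on_mult opS) (use pos in \<open>simp_all add: less_imp_neq[symmetric]\<close>)
  obtain N where N: "open N" "snd c p \<in> N" "N \<subseteq> ?S" "\<And>x. x \<in> N \<Longrightarrow> ?F x = ?F (snd c p) \<Longrightarrow> ?\<mu> x = ?\<mu> (snd c p)"
    using submersion_locally_constant_on_fibre[OF opS coord_map_smooth_at(2,1)[OF conf c d]
        coord_differential_surj[OF conf c d] \<mu> conformal_clairaut_dilation_vertical[OF conf cl cA(1) dB(1)]]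
    by blast
  show thesis
  proof (rule that)
    show "open (fst c \<inter> snd c -` N)"
      by (rule continuous_open_preimage[OF smooth_atlasD(3,1)[OF A cA(1)] N(1)])
    show "p \<in> fst c \<inter> snd c -` N" using cA N(2) by simp
    fix q assume q: "q \<in> fst c \<inter> snd c -` N" "F q = F p"
    have "?\<mu> (snd c q) = ?\<mu> (snd c p)"
      by (rule N(4)) (use q cA smooth_atlasD(5)[OF A cA(1)] in auto)
    then have "(lam q)\<^sup>2 = (lam p)\<^sup>2" using q cA smooth_atlasD(5)[OF A cA(1)] by simp
    then show "lam q = lam p" using pos[of p] pos[of q] by simp
  qed
qed

text \<open>Local constancy concerns neighbours within one fibre; connectedness of the fibre makes
  it global.\<close>

lemma conformal_clairaut_dilation_fibre_constant:
  assumes conf: "conformal_submersion A g B g' F lam" and cl: "clairaut A g B F r"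
    and "connected (F -` {F p})" "F q = F p"
  shows "lam q = lam p"
proof (rule connected_local_const[OF assms(3)])
  show "q \<in> F -` {F p}" "p \<in> F -` {F p}" using assms(4) by auto
  show "\<forall>a\<in>F -` {F p}. eventually (\<lambda>b. lam a = lam b) (at a within F -` {F p})"
  proof
    fix a assume a: "a \<in> F -` {F p}"
    obtain N where N: "open N" "a \<in> N" "\<And>q. q \<in> N \<Longrightarrow> F q = F a \<Longrightarrow> lam q = lam a"
      using conformal_clairaut_dilation_locally_constant[OF conf cl, of a] by blast
    show "eventually (\<lambda>b. lam a = lam b) (at a within F -` {F p})"
      unfolding eventually_at_topological
    proof (intro exI[of _ N] conjI ballI impI N(1,2))
      fix q assume "q \<in> N" "q \<in> F -` {F p}"
      then show "lam a = lam q" using N(3)[of q] a by simp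
    qed
  qed
qed

section \<open>Descent to the base\<close>

lemma smooth_fun_of_pullback:
  assumes conf: "conformal_submersion A g B g' F lam" and "surj F"
    and h: "smooth_fun A h" "\<And>x. \<psi> (F x) = h x"
  shows "smooth_fun B \<psi>"
  unfolding smooth_fun_def
proof (intro ballI smooth_on_local)
  note A = conformal_submersionD(3)[OF conf] and B = conformal_submersionD(4)[OF conf]
  fix d y assume dB: "d \<in> B" and "y \<in> snd d ` fst d"
  then obtain q where q: "q \<in> fst d" "y = snd d q" by auto
  obtain p where p: "F p = q" using \<open>surj F\<close> by (metis surjD)
  obtain c where c: "c \<in> charts_at A p" using charts_at_nonempty[OF A] by blast
  have cA: "c \<in> A" "p \<in> fst c" using c by (auto simp: charts_at_def)
  have d: "d \<in> charts_at B (F p)" using dB q p by (simp add: charts_at_def)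
  let ?S = "snd c ` (fst c \<inter> F -` fst d)" and ?F = "coord_map c d F"
  have contF: "continuous_on UNIV F" using conformal_submersionD(5)[OF conf] by (simp add: smooth_map_def)
  have opS: "open ?S"
    using open_chart_image[OF A cA(1) open_vimage[OF smooth_atlasD(1)[OF B dB] contF]] .
  obtain W \<sigma> where W: "open W" "?F (snd c p) \<in> W" "\<And>y. y \<in> W \<Longrightarrow> \<sigma> y \<in> ?S \<and> ?F (\<sigma> y) = y" "smooth_on W \<sigma>"
    using submersion_local_section[OF opS coord_map_smooth_at(2,1)[OF conf c d] coord_differential_surj[OF conf c d]]
    by metis
  have yW: "y \<in> W" using W(2) p q smooth_atlasD(5)[OF A cA] by simp
  have "smooth_on W (\<lambda>y. (h \<circ> chart_inv c) (\<sigma> y))"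
    by (rule smooth_on_compose[OF W(1) smooth_atlasD(2)[OF A cA(1)] _ _ W(4)])
      (use W(3) smooth_fun_chart[OF h(1) cA(1)] in \<open>auto simp: comp_def\<close>)
  then have "smooth_on W (\<psi> \<circ> chart_inv d)"
  proof (rule smooth_on_cong[OF W(1), rotated])
    fix z assume z: "z \<in> W"
    have "F (chart_inv c (\<sigma> z)) \<in> fst d" "snd d (F (chart_inv c (\<sigma> z))) = z"
      using W(3)[OF z] chart_inv_image(2)[OF A cA(1), of "\<sigma> z" "F -` fst d"] by simp_all
    then have "chart_inv d z = F (chart_inv c (\<sigma> z))" using smooth_atlasD(5)[OF B dB] by metis
    then show "(h \<circ> chart_inv c) (\<sigma> z) = (\<psi> \<circ> chart_inv d) z" using h(2) by simp
  qed
  then show "\<exists>T. open T \<and> y \<in> T \<and> smooth_on T (\<psi> \<circ> chart_inv d)" using W(1) yW by blast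
qed

lemma riemannian_manifold_conformal_change:
  assumes "riemannian_manifold B g'" "smooth_fun B \<psi>" "\<And>q. \<psi> q \<noteq> 0"
  shows "riemannian_manifold B (\<lambda>q u v. (\<psi> q)\<^sup>2 * g' q u v)"
proof -
  have B: "smooth_atlas B" and g': "riemannian_metric B g'" using assms(1) by (auto simp: riemannian_manifold_def)
  have "smooth_on (snd d ` fst d) (\<lambda>x. metric_coord B (\<lambda>q u v. (\<psi> q)\<^sup>2 * g' q u v) d x u w)" if d: "d \<in> B" for d u w
  proof -
    note op = smooth_atlasD(2)[OF B d]
    have "smooth_on (snd d ` fst d) (\<lambda>x. \<psi> (chart_inv d x))" using smooth_fun_chart[OF assms(2) d] .
    moreover have "smooth_on (snd d ` fst d) (\<lambda>x. metric_coord B g' d x u w)"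
      using g' d by (simp add: riemannian_metric_def)
    ultimately have "smooth_on (snd d ` fst d) (\<lambda>x. \<psi> (chart_inv d x) * \<psi> (chart_inv d x) * metric_coord B g' d x u w)"
      by (intro smooth_on_mult op)
    then show ?thesis by (simp add: metric_coord_def Let_def power2_eq_square)
  qed
  moreover have "0 < (\<psi> q)\<^sup>2 * g' q u u" if "u \<in> tangent_space B q" "u \<noteq> (\<lambda>c. 0)" for q u
    using g' that assms(3)[of q] by (simp add: riemannian_metric_def)
  moreover have "(\<psi> q)\<^sup>2 * g' q u v = (\<psi> q)\<^sup>2 * g' q v u"
    if "u \<in> tangent_space B q" "v \<in> tangent_space B q" for q u v
    using g' that by (simp add: riemannian_metric_def)
  moreover have "(\<psi> q)\<^sup>2 * g' q (\<lambda>c. a *\<^sub>R u c + b *\<^sub>R v c) w = a * ((\<psi> q)\<^sup>2 * g' q u w) + b * ((\<psi> q)\<^sup>2 * g' q v w)"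
    if "u \<in> tangent_space B q" "v \<in> tangent_space B q" "w \<in> tangent_space B q" for q u v w a b
    using g' that by (simp add: riemannian_metric_def algebra_simps)
  ultimately show ?thesis using B unfolding riemannian_manifold_def riemannian_metric_def by blast
qed

theorem corollary7:
  fixes A :: "('a::{t2_space,second_countable_topology}, 'e::euclidean_space) chart set"
    and g :: "('a, 'e) metric"
    and B :: "('b::{t2_space,second_countable_topology}, 'f::euclidean_space) chart set"
    and g' :: "('b, 'f) metric"
    and F :: "'a \<Rightarrow> 'b"
    and lam f :: "'a \<Rightarrow> real"
  assumes "smooth_fun A f"
    and "clairaut_conformal_submersion A g B g' F lam (\<lambda>x. exp (f x))"
    and "surj F"
    and "\<And>b. connected (F -` {b})"
  shows "(\<exists>!\<psi>. smooth_fun B \<psi> \<and> (\<forall>x. \<psi> (F x) = 1 / lam x)) \<and>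
         (\<forall>\<psi>. (\<forall>x. \<psi> (F x) = 1 / lam x) \<longrightarrow>
            clairaut_riemannian_submersion A g B (\<lambda>b u v. (\<psi> b)\<^sup>2 * g' b u v) F (\<lambda>x. exp (f x)))"
proof -
  have conf: "conformal_submersion A g B g' F lam" and cl: "clairaut A g B F (\<lambda>x. exp (f x))"
    using assms(2) by (auto simp: clairaut_conformal_submersion_def)
  note A = conformal_submersionD(3)[OF conf]
  have pos: "0 < lam p" for p using conformal_submersionD(7)[OF conf] .
  have "smooth_fun A (\<lambda>x. 1 / lam x)"
    unfolding smooth_fun_def
  proof
    fix c assume c: "c \<in> A"
    have "smooth_on (snd c ` fst c) (\<lambda>x. inverse (lam (chart_inv c x)))"
      by (intro smooth_on_inverse smooth_atlasD(2)[OF A c] smooth_fun_chart[OF conformal_submersionD(6)[OF conf] c]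
          less_imp_neq[OF pos, symmetric])
    then show "smooth_on (snd c ` fst c) ((\<lambda>x. 1 / lam x) \<circ> chart_inv c)"
      by (simp add: comp_def inverse_eq_divide)
  qed
  note smooth = smooth_fun_of_pullback[OF conf assms(3) this]
  have "\<exists>!\<psi>. smooth_fun B \<psi> \<and> (\<forall>x. \<psi> (F x) = 1 / lam x)"
  proof (rule ex_ex1I)
    \<comment> \<open>\<open>inv F\<close> picks an arbitrary point of each fibre; constancy of
      \<open>lam\<close> on fibres makes the value independent of the pick.\<close>
    let ?\<psi> = "\<lambda>b. 1 / lam (inv F b)"
    have "?\<psi> (F x) = 1 / lam x" for x
      using conformal_clairaut_dilation_fibre_constant[OF conf cl assms(4), of x "inv F (F x)"]
        surj_f_inv_f[OF assms(3)] by simp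
    then show "\<exists>\<psi>. smooth_fun B \<psi> \<and> (\<forall>x. \<psi> (F x) = 1 / lam x)"
      using smooth[of ?\<psi>] by blast
  next
    fix \<psi> \<psi>' assume "smooth_fun B \<psi> \<and> (\<forall>x. \<psi> (F x) = 1 / lam x)" "smooth_fun B \<psi>' \<and> (\<forall>x. \<psi>' (F x) = 1 / lam x)"
    then show "\<psi> = \<psi>'" using assms(3) by (metis ext surjD)
  qed
  moreover have "clairaut_riemannian_submersion A g B (\<lambda>b u v. (\<psi> b)\<^sup>2 * g' b u v) F (\<lambda>x. exp (f x))"
    if \<psi>: "\<forall>x. \<psi> (F x) = 1 / lam x" for \<psi>
  proof -
    have "\<psi> q \<noteq> 0" for q
      using \<psi> pos surjD[OF assms(3), of q] by (metis less_irrefl zero_less_divide_1_iff)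
    then have "riemannian_manifold B (\<lambda>q u v. (\<psi> q)\<^sup>2 * g' q u v)"
      using riemannian_manifold_conformal_change[OF conformal_submersionD(2)[OF conf] smooth[of \<psi>]] \<psi> by simp
    moreover have "smooth_fun A (\<lambda>_. 1)" by (simp add: smooth_fun_def comp_def smooth_on_const)
    moreover have "(\<psi> (F p))\<^sup>2 * g' (F p) (differential A B F p u) (differential A B F p v) = g p u v"
      if "u \<in> horizontal_space A g B F p" "v \<in> horizontal_space A g B F p" for p u v
    proof -
      have "g' (F p) (differential A B F p u) (differential A B F p v) = (lam p)\<^sup>2 * g p u v"
        using conf that by (simp add: conformal_submersion_def)
      then show ?thesis using \<psi> pos[of p] by (simp add: power_divide)
    qed
    ultimately have "conformal_submersion A g B (\<lambda>q u v. (\<psi> q)\<^sup>2 * g' q u v) F (\<lambda>_. 1)"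
      using conf by (simp add: conformal_submersion_def)
    \<comment> \<open>\<open>clairaut\<close> involves \<open>g\<close> and \<open>F\<close> but no
      metric on the base, so this part of the hypothesis is inherited as it stands.\<close>
    then show ?thesis
      using cl by (simp add: clairaut_riemannian_submersion_def riemannian_submersion_def)
  qed
  ultimately show ?thesis by blast
qed

end
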